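(* Let $0<c<1$ and $\sigma=1/c$. Let $\phi(z)$ be the algebraic function defined by $$\phi^3-\frac{(2z^2-2z-1)\sigma+(z+1)^2}{z^2}\,\phi^2+\sigma\,\frac{(z-2)\sigma+2(z+1)}{z}\,\phi-\sigma^2=0,$$ let $\phi_0$ be its branch with $\phi_0(z)=1+\frac2z+O(z^{-2})$ as $z\to\infty$, let $e_2$ be its largest positive branch point, and let $H(z)=\ln\phi_0(z)$ for $z\in\mathbb{C}\setminus[0,e_2]$, with $H(\infty)=0$. Then the equilibrium problem (E2) described in the context is solved by a pair $(\lambda,\mu)$ in which $\lambda$ is absolutely continuous, supported on $[0,e_2]$, with density $$\frac{d\lambda(x)}{dx}=\lim_{y\to0^-}\frac1\pi\operatorname{Im}H(x+iy),\qquad x\in[0,e_2].$$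
   Context: Logarithmic potential of a measure $\nu$: $\mathcal{P}^{\nu}(z)=-\int\ln|z-t|\,d\nu(t)$. Here $\mathbb{R}_+=[0,\infty)$, $\mathbb{R}_-=(-\infty,0]$, $l$ denotes Lebesgue measure, and $\nu\le l$ means that $l-\nu$ is a nonnegative measure. Equilibrium problem (E2), for given $c\in(0,1)$: find positive measures $\lambda,\mu$ with total masses $|\lambda|=2$, $|\mu|=1$, with $\lambda\le l$, $\operatorname{supp}\lambda\subset\mathbb{R}_+$, $\mu\le l$, $\operatorname{supp}\mu\subset\mathbb{R}_-$, such that for some real constants $\kappa_1,\kappa_2$ the functions $$W_1=2\mathcal{P}^{\lambda}-\mathcal{P}^{\mu}-(\ln c)\operatorname{Re}x,\qquad W_2=2\mathcal{P}^{\mu}-\mathcal{P}^{\lambda}$$ satisfy $W_1\le\kappa_1$ on $\operatorname{supp}\lambda$, $W_1\ge\kappa_1$ on $\mathbb{R}_+\cap\operatorname{supp}(l-\lambda)$, $W_2\le\kappa_2$ on $\operatorname{supp}\mu$, and $W_2\ge\kappa_2$ on $\mathbb{R}_-\cap\operatorname{supp}(l-\mu)$. The algebraic function $\phi$ has branch points at $\infty$ and at three real points $e_-<0<e_1<e_2$; the branch $\phi_0$ is analytic in $\mathbb{C}\setminus[e_1,e_2]$ and $\phi_0(0)=0$.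
   Formalization: In the supports of l−λ and l−μ, l is taken as Lebesgue measure on R₊ and R₋ respectively; with l on the whole line the point 0 would be included, where W₁≥κ₁ and W₂≥κ₂ fail for every c. *)

theory Defs
  imports
    "HOL-Analysis.Analysis"
    "HOL-Computational_Algebra.Polynomial"
    "HOL-Library.Landau_Symbols"
begin

section \<open>The equilibrium problem\<close>

text \<open>
  The integral is a Bochner integral and \<open>ln 0 = 0\<close>, so this is the usual potential provided that
  the logarithm is integrable and \<open>\<nu>\<close> has no atom at \<open>z\<close>. Both are ensured in
  \<open>solves_E2\<close> below: integrability is required there, and \<open>\<nu> \<le> l\<close> excludes atoms.
\<close>

definition log_potential :: "real measure \<Rightarrow> complex \<Rightarrow> real" where
  "log_potential \<nu> z = - (\<integral>t. ln (cmod (z - complex_of_real t)) \<partial>\<nu>)"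

definition has_log_potential :: "real measure \<Rightarrow> bool" where
  "has_log_potential \<nu> \<longleftrightarrow> (\<forall>z. integrable \<nu> (\<lambda>t. ln (cmod (z - complex_of_real t))))"

definition supp :: "'a::topological_space measure \<Rightarrow> 'a set" where
  "supp \<nu> = {x. \<forall>U. open U \<longrightarrow> x \<in> U \<longrightarrow> emeasure \<nu> U \<noteq> 0}"

text \<open>
  \<open>l - \<nu>\<close> for a measure \<open>\<nu>\<close> living on the closed set \<open>A\<close>, where \<open>l\<close> is Lebesgue measure on \<open>A\<close>.
  The difference is formed on \<open>A\<close>, not on the whole line: otherwise the endpoint \<open>0\<close> of a half-line
  \<open>A\<close> would belong to the support of \<open>l - \<nu>\<close> merely because of the mass that \<open>l\<close> has on the other
  half-line.
\<close>

definition slack :: "real set \<Rightarrow> real measure \<Rightarrow> real measure" where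
  "slack A \<nu> = diff_measure (density lborel (indicator A)) \<nu>"

definition W1 :: "real \<Rightarrow> real measure \<Rightarrow> real measure \<Rightarrow> complex \<Rightarrow> real" where
  "W1 c lam mu x = 2 * log_potential lam x - log_potential mu x - ln c * Re x"

definition W2 :: "real measure \<Rightarrow> real measure \<Rightarrow> complex \<Rightarrow> real" where
  "W2 lam mu x = 2 * log_potential mu x - log_potential lam x"

definition solves_E2 :: "real \<Rightarrow> real measure \<Rightarrow> real measure \<Rightarrow> bool" where
  "solves_E2 c lam mu \<longleftrightarrow>
     sets lam = sets borel \<and> emeasure lam UNIV = 2 \<and>
     sets mu = sets borel \<and> emeasure mu UNIV = 1 \<and>
     (\<forall>A\<in>sets borel. emeasure lam A \<le> emeasure lborel A) \<and> supp lam \<subseteq> {0..} \<and>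
     (\<forall>A\<in>sets borel. emeasure mu A \<le> emeasure lborel A) \<and> supp mu \<subseteq> {..0} \<and>
     has_log_potential lam \<and> has_log_potential mu \<and>
     (\<exists>\<kappa>\<^sub>1 \<kappa>\<^sub>2 :: real.
        (\<forall>x\<in>supp lam. W1 c lam mu (complex_of_real x) \<le> \<kappa>\<^sub>1) \<and>
        (\<forall>x\<in>{0..} \<inter> supp (slack {0..} lam). W1 c lam mu (complex_of_real x) \<ge> \<kappa>\<^sub>1) \<and>
        (\<forall>x\<in>supp mu. W2 lam mu (complex_of_real x) \<le> \<kappa>\<^sub>2) \<and>
        (\<forall>x\<in>{..0} \<inter> supp (slack {..0} mu). W2 lam mu (complex_of_real x) \<ge> \<kappa>\<^sub>2))"


section \<open>The algebraic function\<close>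

text \<open>
  The defining equation of \<open>\<phi>(z)\<close>, as a monic polynomial in \<open>\<phi>\<close>; it is meaningful for \<open>z \<noteq> 0\<close> only.
\<close>

definition phi_poly :: "real \<Rightarrow> complex \<Rightarrow> complex poly" where
  "phi_poly \<sigma> z =
     (let s = complex_of_real \<sigma> in
      [: - (s\<^sup>2),
         s * (((z - 2) * s + 2 * (z + 1)) / z),
         - (((2 * z\<^sup>2 - 2 * z - 1) * s + (z + 1)\<^sup>2) / z\<^sup>2),
         1 :])"

text \<open>
  Let \<open>F\<close> be a family of monic polynomials defining an algebraic function. A finite point \<open>a\<close> is a
  branch point of this function if its values near \<open>a\<close> cannot be split into branches that are
  single-valued and holomorphic on a punctured disc. Poles of branches at \<open>a\<close> and crossings of
  single-valued branches are not branch points.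
\<close>

definition branch_point :: "(complex \<Rightarrow> complex poly) \<Rightarrow> complex \<Rightarrow> bool" where
  "branch_point F a \<longleftrightarrow>
     \<not> (\<exists>r>0. \<exists>fs :: (complex \<Rightarrow> complex) list.
          (\<forall>f\<in>set fs. f holomorphic_on (ball a r - {a})) \<and>
          (\<forall>z\<in>ball a r - {a}. F z = (\<Prod>f\<leftarrow>fs. [: - f z, 1 :])))"

end

(*
  With k = 1 - c, the curve is rationally parametrized by q = z (phi - sigma) / (z (phi - sigma) + phi):

    z = q (k - q^2) / (k (1 - q)),   phi = (q^2 - k) / ((1 - k) q^2),

  so that over z lie the three roots of q^3 - k (1 + z) q + k z. The real locus is explicit: Im z has the
  sign of Im q ((2 Re q + 1) |1 - q|^2 - c). Hence over the lower half plane phi_0 is the root with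
  Im q > 0, Re q > 0, a second branch phi_2 is the root with Im q > 0, Re q < 0, and the third root has
  Im q < 0. The arguments of phi_0 and of sigma / phi_2 lie in (0, pi), so H = ln phi_0 ~ 2/z and
  ln (sigma / phi_2) ~ 1/z are Cauchy transforms of measures lambda and mu with densities in [0, 1] and
  masses 2 and 1.

  On the curve, d (z ln phi - 2 ln (1 - q)) = ln phi dz. So on the real axis the potentials of lambda and mu
  are, up to constants, given by the function B(q) = z ln |phi| - 2 ln |1 - q| on the sheets, and since the
  sum of B over the three sheets is affine in z, the functions W_1 and W_2 are B(q_1) - B(q_0) and
  B(q_2) - B(q_1) up to constants. They vanish where the two roots are conjugate. Where they are real, they
  lie on both sides of a critical point X of z, and B - ln |phi(X)| z is monotone across X, which gives the
  inequalities.

  The endpoint e_2 is recovered from the holomorphy of phi_0 alone: at the critical value z(X) with X > 1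
  the branch q cannot be differentiable, so this value lies in [0, e_2], and beyond it the density vanishes.
*)
theory Submission
  imports Defs "HOL-Complex_Analysis.Complex_Analysis" "HOL-Probability.Sinc_Integral" "HOL-Real_Asymp.Real_Asymp"
begin

section \<open>Cauchy transforms of densities on the real line\<close>

text \<open>The branch phi_0 is known only by its holomorphy, its equation and its expansion at
  infinity; its boundary values have to be recovered from these. Over the lower half plane no root q
  is real, and those with Im q > 0 avoid the imaginary axis, so connectedness keeps a branch in one
  quadrant as soon as one value is known: q_0 tends to 1 at infinity, and q_2 takes the value -1/2 +
  i. On the real axis roots collide and the implicit function theorem fails, so boundary values come
  from compactness and from uniqueness of the root in the closed sets \<open>K0\<close> and
  \<open>K2\<close>. Beyond lying between 0 and 1, the densities enter the inequalities only through
  the intervals on which they equal 0 or 1; the additive constants of the potentials are absorbed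
  into kappa_1 and kappa_2. Two places need separate estimates. Over 0 phi tends to 0 on both
  boundary sheets, its argument along the axis jumps by pi, and the vertical limit of each density
  is 1/2. Towards minus infinity nothing confines mu to a bounded set, and its density is bounded by
  a multiple of |x|^(-3/2) to make the logarithm integrable.\<close>

lemma integrable_inverse_one_plus_square:
  "integrable lborel (\<lambda>t::real. 1 / (1 + t\<^sup>2))"
  and integral_inverse_one_plus_square:
  "(\<integral>t. 1 / (1 + t\<^sup>2) \<partial>lborel) = pi"
  using integrable_inverse_1_plus_square LBINT_inverse_1_plus_square
  by (simp_all add: set_integrable_def interval_lebesgue_integral_def set_lebesgue_integral_def inverse_eq_divide)

lemma lborel_integrable_bound_one_plus_square:
  fixes f :: "real \<Rightarrow> complex"
  assumes "f \<in> borel_measurable borel" "\<And>t. norm (f t) \<le> C / (1 + t\<^sup>2)"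
  shows "integrable lborel f"
proof (rule Bochner_Integration.integrable_bound)
  show "integrable lborel (\<lambda>t. C * (1 / (1 + t\<^sup>2)) :: real)"
    by (intro integrable_mult_right integrable_inverse_one_plus_square)
  show "AE t in lborel. norm (f t) \<le> norm (C * (1 / (1 + t\<^sup>2)))"
    using order.trans[OF assms(2) abs_ge_self] by auto
qed (use assms(1) in simp)

lemma has_contour_integral_horizontal_line:
  assumes "a < b"
  shows "(f has_contour_integral I) (linepath (Complex a y) (Complex b y)) \<longleftrightarrow>
    ((\<lambda>t. f (Complex t y)) has_integral I) {a..b}"
proof -
  have "linepath (Complex a y) (Complex b y) x = linepath (of_real a) (of_real b) x + \<i> * of_real y" for x
    by (simp add: linepath_def complex_eq_iff algebra_simps)
  moreover have "Complex b y - Complex a y = of_real b - of_real a" by (simp add: complex_eq_iff)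
  ultimately have "(f has_contour_integral I) (linepath (Complex a y) (Complex b y)) \<longleftrightarrow>
      ((\<lambda>z. f (z + \<i> * of_real y)) has_contour_integral I) (linepath (of_real a) (of_real b))"
    unfolding has_contour_integral_linepath by simp
  then show ?thesis
    using assms by (simp add: has_contour_integral_linepath_Reals_iff Complex_eq)
qed

text \<open>Contour integration reaches the integral over the line only through symmetric segments;
  domination by |f| identifies the limit.\<close>

lemma lborel_integral_limit_symmetric:
  fixes f :: "real \<Rightarrow> complex"
  assumes "integrable lborel f"
  shows "(\<lambda>n. \<integral>t\<in>{-real n..real n}. f t \<partial>lborel) \<longlonglongrightarrow> (\<integral>t. f t \<partial>lborel)"
  unfolding set_lebesgue_integral_def
proof (rule integral_dominated_convergence)
  show "integrable lborel (\<lambda>t. norm (f t))" using assms by simp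
  show "AE t in lborel. (\<lambda>n. indicator {-real n..real n} t *\<^sub>R f t) \<longlonglongrightarrow> f t"
  proof (rule AE_I2)
    fix t :: real
    have "eventually (\<lambda>n. indicator {-real n..real n} t *\<^sub>R f t = f t) sequentially"
      using eventually_ge_at_top[of "nat \<lceil>\<bar>t\<bar>\<rceil>"]
      by eventually_elim (auto simp: indicator_def abs_le_iff nat_le_iff ceiling_le_iff)
    then show "(\<lambda>n. indicator {-real n..real n} t *\<^sub>R f t) \<longlonglongrightarrow> f t"
      by (rule tendsto_eventually)
  qed
qed (use assms in \<open>auto simp: indicator_def intro!: borel_measurable_integrable\<close>)

text \<open>The contour is closed by a large half circle below the line.\<close>
lemma lower_half_plane_line_integral:
  fixes g :: "complex \<Rightarrow> complex"
  assumes holo: "g holomorphic_on {z. Im z < 0}"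
    and bnd: "\<And>z. Im z < 0 \<Longrightarrow> R \<le> norm z \<Longrightarrow> norm (g z) \<le> C / (norm z)\<^sup>2"
    and e: "e > 0"
  shows "integrable lborel (\<lambda>t. g (Complex t (-e)))"
    and "(\<integral>t. g (Complex t (-e)) \<partial>lborel) = 0"
proof -
  define r where "r = max R 1"
  have r: "r \<ge> 1" "R \<le> r" by (auto simp: r_def)
  have C0: "C \<ge> 0"
  proof -
    have "norm (g (Complex r (-e))) \<le> C / (norm (Complex r (-e)))\<^sup>2"
      by (rule bnd) (use e r abs_Re_le_cmod[of "Complex r (-e)"] in auto)
    then have "0 \<le> C / (norm (Complex r (-e)))\<^sup>2" using norm_ge_zero order.trans by blast
    moreover have "(norm (Complex r (-e)))\<^sup>2 > 0" using e by (simp add: complex_eq_iff)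
    ultimately show ?thesis by (simp add: zero_le_divide_iff)
  qed
  have cont_g: "continuous_on {z. Im z < 0} g"
    using holo holomorphic_on_imp_continuous_on by blast
  have cont: "continuous_on UNIV (\<lambda>t. g (Complex t (-e)))"
    by (rule continuous_on_compose2[OF cont_g]) (use e in \<open>auto simp: Complex_eq intro!: continuous_intros\<close>)
  then have meas: "(\<lambda>t. g (Complex t (-e))) \<in> borel_measurable borel"
    by (rule borel_measurable_continuous_onI)
  have "bounded ((\<lambda>t. g (Complex t (-e))) ` {-r..r})"
    by (intro compact_imp_bounded compact_continuous_image continuous_on_subset[OF cont]) auto
  then obtain M where M: "\<And>t. t \<in> {-r..r} \<Longrightarrow> norm (g (Complex t (-e))) \<le> M"
    unfolding bounded_iff by fast
  have M0: "M \<ge> 0" using order.trans[OF norm_ge_zero M[of 0]] r by simp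
  \<comment> \<open>M (1 + r^2) covers |t| <= r, and 2 C covers the tail, where t^2 >= 1 gives 1 +
    t^2 <= 2 t^2.\<close>
  define K where "K = M * (1 + r\<^sup>2) + 2 * C"
  have K: "norm (g (Complex t (-e))) \<le> K / (1 + t\<^sup>2)" for t
  proof (cases "\<bar>t\<bar> \<le> r")
    case True
    have "norm (g (Complex t (-e))) * (1 + t\<^sup>2) \<le> M * (1 + r\<^sup>2)"
      using True M0 by (intro mult_mono M add_mono) (auto simp: abs_le_square_iff[symmetric])
    also have "\<dots> \<le> K" using C0 by (simp add: K_def)
    finally show ?thesis by (simp add: field_simps add_pos_nonneg)
  next
    case False
    have n: "norm (Complex t (-e)) \<ge> \<bar>t\<bar>" using abs_Re_le_cmod[of "Complex t (-e)"] by simp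
    have "norm (g (Complex t (-e))) \<le> C / (norm (Complex t (-e)))\<^sup>2"
      by (rule bnd) (use e False r n in auto)
    also have "\<dots> \<le> C / t\<^sup>2"
    proof (rule divide_left_mono)
      show "t\<^sup>2 \<le> (norm (Complex t (-e)))\<^sup>2" using n by (simp add: abs_le_square_iff[symmetric])
    qed (use C0 False r e in \<open>auto simp: complex_eq_iff\<close>)
    also have "\<dots> \<le> 2 * C / (1 + t\<^sup>2)"
    proof -
      have "t\<^sup>2 \<ge> 1" using False r power_mono[of 1 "\<bar>t\<bar>" 2] by simp
      then have "C * (1 + t\<^sup>2) \<le> C * (2 * t\<^sup>2)" using C0 by (intro mult_left_mono) auto
      then show ?thesis using \<open>t\<^sup>2 \<ge> 1\<close> C0 by (simp add: divide_simps mult_ac)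
    qed
    also have "\<dots> \<le> K / (1 + t\<^sup>2)" using M0 by (intro divide_right_mono) (auto simp: K_def)
    finally show ?thesis .
  qed
  show int: "integrable lborel (\<lambda>t. g (Complex t (-e)))"
    by (rule lborel_integrable_bound_one_plus_square[OF meas K])
  \<comment> \<open>Length pi n of the half circle times a bound for |g| on it: the centre is - i e,
    so |w| >= n - e there.\<close>
  have bound: "norm (\<integral>t\<in>{-real n..real n}. g (Complex t (-e)) \<partial>lborel) \<le> C / (real n - e)\<^sup>2 * real n * pi"
    if n: "real n > r + e" for n
  proof -
    define a where "a = Complex (-real n) (-e)"
    define b where "b = Complex (real n) (-e)"
    define pc where "pc = part_circlepath (Complex 0 (-e)) (real n) 0 (-pi)"
    have n0: "real n > 0" using n r e by linarith
    have pf: "pathfinish pc = a" "pathstart pc = b"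
      by (simp_all add: pc_def a_def b_def Complex_eq exp_minus exp_of_real cis_conv_exp[symmetric] mult.commute)
    have pcin: "w \<in> path_image pc \<Longrightarrow> Im w < 0 \<and> cmod (w - Complex 0 (-e)) = real n" for w
    proof -
      assume "w \<in> path_image pc"
      then obtain x where x: "x \<in> closed_segment 0 (-pi)" "w = Complex 0 (-e) + real n * cis x"
        unfolding pc_def path_image_part_circlepath' by auto
      have "-pi \<le> x" "x \<le> 0" using x(1) pi_gt_zero by (auto simp: closed_segment_eq_real_ivl split: if_splits)
      then have "sin x \<le> 0" using sin_ge_zero[of "-x"] by simp
      then have "real n * sin x \<le> 0" using n0 by (simp add: mult_nonneg_nonpos)
      then show "Im w < 0 \<and> cmod (w - Complex 0 (-e)) = real n"
        using x(2) n0 e by (simp add: norm_mult)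
    qed
    have lin: "path_image (linepath a b) \<subseteq> {z. Im z < 0}"
      using e unfolding path_image_linepath
      by (intro closed_segment_subset convex_halfspace_Im_lt) (auto simp: a_def b_def)
    have pcs: "path_image pc \<subseteq> {z. Im z < 0}" using pcin by auto
    have "(g has_contour_integral 0) (linepath a b +++ pc)"
    proof (rule Cauchy_theorem_convex_simple[OF holo])
      show "convex {z. Im z < 0}" by (rule convex_halfspace_Im_lt)
      show "valid_path (linepath a b +++ pc)"
        by (rule valid_path_join) (auto simp: pf pc_def[symmetric], simp add: pc_def)
      show "path_image (linepath a b +++ pc) \<subseteq> {z. Im z < 0}"
        using lin pcs by (intro subset_path_image_join)
      show "pathfinish (linepath a b +++ pc) = pathstart (linepath a b +++ pc)" by (simp add: pf)
    qed
    moreover have i1: "g contour_integrable_on linepath a b"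
      using lin by (intro contour_integrable_continuous_linepath continuous_on_subset[OF cont_g]) auto
    moreover have i2: "g contour_integrable_on pc"
      using pcs unfolding pc_def by (intro contour_integrable_continuous_part_circlepath continuous_on_subset[OF cont_g]) auto
    ultimately have sum0: "contour_integral (linepath a b) g + contour_integral pc g = 0"
      by (metis contour_integral_join contour_integral_unique pc_def valid_path_linepath valid_path_part_circlepath)
    have "norm (contour_integral pc g) \<le> C / (real n - e)\<^sup>2 * real n * \<bar>-pi - 0\<bar>"
      unfolding pc_def
    proof (rule contour_integral_bound_part_circlepath)
      fix w assume "w \<in> path_image (part_circlepath (Complex 0 (- e)) (real n) 0 (- pi))"
      then have w: "Im w < 0" "cmod (w - Complex 0 (-e)) = real n" using pcin by (auto simp: pc_def)
      have "real n \<le> cmod w + cmod (Complex 0 (-e))" using w(2) norm_triangle_ineq4 by metis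
      then have nw: "cmod w \<ge> real n - e" using e by (simp add: cmod_def)
      have "norm (g w) \<le> C / (cmod w)\<^sup>2" by (rule bnd) (use w nw n r in auto)
      also have "\<dots> \<le> C / (real n - e)\<^sup>2"
        using C0 nw n r by (intro divide_left_mono power_mono mult_pos_pos) (auto intro!: zero_less_power)
      finally show "norm (g w) \<le> C / (real n - e)\<^sup>2" .
    qed (use i2 C0 in \<open>auto simp: pc_def\<close>)
    moreover have "contour_integral (linepath a b) g = (\<integral>t\<in>{-real n..real n}. g (Complex t (-e)) \<partial>lborel)"
    proof -
      have "((\<lambda>t. g (Complex t (-e))) has_integral contour_integral (linepath a b) g) {-real n..real n}"
        using has_contour_integral_horizontal_line[of "-real n" "real n" g _ "-e"]
          has_contour_integral_integral[OF i1] n0 by (auto simp: a_def b_def)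
      moreover have "set_integrable lborel {-real n..real n} (\<lambda>t. g (Complex t (-e)))"
        unfolding set_integrable_def using integrable_mult_indicator[OF _ int, of "{-real n..real n}"] by auto
      ultimately show ?thesis
        using set_borel_integral_eq_integral(2) integral_unique by metis
    qed
    ultimately show ?thesis using sum0 by (metis abs_minus_cancel abs_of_pos diff_zero eq_neg_iff_add_eq_0 norm_minus_cancel pi_gt_zero)
  qed
  have "(\<lambda>n. \<integral>t\<in>{-real n..real n}. g (Complex t (-e)) \<partial>lborel) \<longlonglongrightarrow> 0"
  proof (rule Lim_null_comparison)
    show "eventually (\<lambda>n. norm (\<integral>t\<in>{-real n..real n}. g (Complex t (-e)) \<partial>lborel) \<le> C / (real n - e)\<^sup>2 * real n * pi) sequentially"
      using eventually_gt_at_top[of "nat \<lceil>r + e\<rceil>"]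
      by eventually_elim (rule bound, linarith)
    show "(\<lambda>n. C / (real n - e)\<^sup>2 * real n * pi) \<longlonglongrightarrow> 0" by real_asymp
  qed
  then show "(\<integral>t. g (Complex t (-e)) \<partial>lborel) = 0"
    using lborel_integral_limit_symmetric[OF int] LIMSEQ_unique by blast
qed

section \<open>Recovering a function on the half plane from its imaginary part on a line\<close>

lemma poisson_kernel_integral:
  fixes x \<eta> :: real
  assumes "\<eta> > 0"
  shows "integrable lborel (\<lambda>t. \<eta> / ((t - x)\<^sup>2 + \<eta>\<^sup>2))"
    and "(\<integral>t. \<eta> / ((t - x)\<^sup>2 + \<eta>\<^sup>2) \<partial>lborel) = pi"
proof -
  have eq: "1 / (1 + (- x / \<eta> + 1 / \<eta> * t)\<^sup>2) = \<eta> * (\<eta> / ((t - x)\<^sup>2 + \<eta>\<^sup>2))" for t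
  proof -
    have "1 + (- x / \<eta> + 1 / \<eta> * t)\<^sup>2 = ((t - x)\<^sup>2 + \<eta>\<^sup>2) / \<eta>\<^sup>2"
      using assms by (simp add: field_simps power2_eq_square)
    then show ?thesis by (simp add: power2_eq_square)
  qed
  have "integrable lborel (\<lambda>t. \<eta> * (\<eta> / ((t - x)\<^sup>2 + \<eta>\<^sup>2)))"
    using lborel_integrable_real_affine[OF integrable_inverse_one_plus_square, of "1 / \<eta>" "- x / \<eta>"] assms
    by (simp only: eq) simp
  from integrable_mult_right[OF this, of "1 / \<eta>"]
  show "integrable lborel (\<lambda>t. \<eta> / ((t - x)\<^sup>2 + \<eta>\<^sup>2))"
    by (rule Bochner_Integration.integrable_cong[THEN iffD1, rotated 2]) (use assms in auto)
  show "(\<integral>t. \<eta> / ((t - x)\<^sup>2 + \<eta>\<^sup>2) \<partial>lborel) = pi"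
    using lborel_integral_real_affine[of "1 / \<eta>" "\<lambda>t. 1 / (1 + t\<^sup>2)" "- x / \<eta>"] assms
    by (simp only: eq integral_inverse_one_plus_square integral_mult_right_zero) (simp add: field_simps)
qed

lemma tendsto_norm_bound_at_infinity:
  fixes F :: "complex \<Rightarrow> complex"
  assumes "((\<lambda>z. z * F z) \<longlongrightarrow> l) (inf at_infinity (principal A))"
  obtains R K where "R \<ge> 1" "K > 0" "\<And>z. z \<in> A \<Longrightarrow> norm z \<ge> R \<Longrightarrow> norm (F z) \<le> K / norm z"
proof -
  have "eventually (\<lambda>z. dist (z * F z) l < 1) (inf at_infinity (principal A))"
    using assms by (rule tendstoD) simp
  then obtain b where b: "\<And>z. norm z \<ge> b \<Longrightarrow> z \<in> A \<Longrightarrow> dist (z * F z) l < 1"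
    by (auto simp: eventually_inf_principal eventually_at_infinity)
  show thesis
  proof (rule that[of "max b 1" "norm l + 1"])
    fix z assume z: "z \<in> A" "norm z \<ge> max b 1"
    have "norm (z * F z) \<le> norm l + 1"
      using b[of z] z norm_triangle_ineq2[of "z * F z" l] by (auto simp: dist_norm)
    then show "norm (F z) \<le> (norm l + 1) / norm z"
      using z by (subst pos_le_divide_eq) (auto simp: norm_mult mult.commute)
  qed (auto intro: add_nonneg_pos)
qed

text \<open>The integrals of \<open>F \<zeta> / (\<zeta> - z)\<close> and \<open>cnj (F \<zeta>) / (\<zeta> - z)\<close> over the line are \<open>- 2 \<pi> \<i> F z\<close> and \<open>0\<close>, the
  latter because it is conjugate to that of \<open>F \<zeta> / (\<zeta> - a)\<close>, where \<open>a\<close> is the mirror image of \<open>z\<close> in the line.\<close>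
lemma half_plane_cauchy_im:
  fixes F :: "complex \<Rightarrow> complex"
  assumes holo: "F holomorphic_on {z. Im z < 0}"
    and bnd: "\<And>z. Im z < 0 \<Longrightarrow> R \<le> norm z \<Longrightarrow> norm (F z) \<le> K / norm z"
    and R: "R \<ge> 1" and K: "K > 0"
    and e: "e > 0" and z: "Im z < -2 * e"
  shows "(\<integral>t. of_real (Im (F (Complex t (-e)))) / (z - Complex t (-e)) \<partial>lborel) = of_real pi * F z"
proof -
  define a where "a = cnj z - Complex 0 (2 * e)"
  define \<eta> where "\<eta> = - Im z - e"
  have \<eta>: "\<eta> > 0" using e z by (simp add: \<eta>_def)
  have a: "Im a > 0" using z by (simp add: a_def)
  \<comment> \<open>The quotient F / (\<zeta> - z) has a pole at z. Subtracting the constant F z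
    from F would remove it but destroy the quadratic decay. The term subtracted here agrees with F z
    at z, decays at infinity, has its pole \<open>a\<close> above the real axis, and contributes
    exactly a multiple of the Poisson kernel.\<close>
  define f where "f = (\<lambda>\<zeta>. F \<zeta> - F z * (z - a) / (\<zeta> - a))"
  define g1 where "g1 = (\<lambda>\<zeta>. if \<zeta> = z then deriv f z else (f \<zeta> - f z) / (\<zeta> - z))"
  define g2 where "g2 = (\<lambda>\<zeta>. F \<zeta> / (\<zeta> - a))"
  define R1 where "R1 = max R (2 * norm z + 2 * norm a + 1)"
  have za: "z \<noteq> a" using a z e by auto
  have fz: "f z = 0" using za by (simp add: f_def)
  have na: "\<zeta> \<noteq> a" if "Im \<zeta> < 0" for \<zeta> using a that by auto
  have fholo: "f holomorphic_on {z. Im z < 0}"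
    unfolding f_def by (intro holomorphic_intros holo) (use na in auto)
  have oH: "open {z::complex. Im z < 0}" by (simp add: open_halfspace_Im_lt)
  have g1holo: "g1 holomorphic_on {z. Im z < 0}"
    unfolding g1_def by (rule pole_lemma[OF fholo]) (use z e oH in \<open>simp add: interior_open\<close>)
  have g2holo: "g2 holomorphic_on {z. Im z < 0}"
    unfolding g2_def by (intro holomorphic_intros holo) (use na in auto)
  have far: "norm \<zeta> / 2 \<le> norm (\<zeta> - w)" if "R1 \<le> norm \<zeta>" "w = z \<or> w = a" for \<zeta> w
  proof -
    have "2 * norm w \<le> norm \<zeta>" 
    proof -
      have "norm w = norm z \<or> norm w = norm a" "2 * norm z + 2 * norm a + 1 \<le> norm \<zeta>"
        using that by (auto simp: R1_def)
      then show ?thesis using norm_ge_zero[of z] norm_ge_zero[of a] by linarith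
    qed
    then show ?thesis using norm_triangle_ineq2[of \<zeta> w] by simp
  qed
  have posn: "norm \<zeta> > 0" if "R1 \<le> norm \<zeta>" for \<zeta> :: complex using that R by (auto simp: R1_def)
  have g2b: "norm (g2 \<zeta>) \<le> (2 * K) / (norm \<zeta>)\<^sup>2" if "Im \<zeta> < 0" "R1 \<le> norm \<zeta>" for \<zeta>
  proof -
    have "norm (g2 \<zeta>) \<le> (K / norm \<zeta>) / (norm \<zeta> / 2)"
      unfolding g2_def norm_divide
      by (rule frac_le) (use that far[of \<zeta> a] bnd[of \<zeta>] K posn[of \<zeta>] in \<open>auto simp: R1_def\<close>)
    then show ?thesis by (simp add: power2_eq_square field_simps)
  qed
  define M where "M = 2 * (K + 2 * norm (F z * (z - a)))"
  have g1b: "norm (g1 \<zeta>) \<le> M / (norm \<zeta>)\<^sup>2" if \<zeta>: "Im \<zeta> < 0" "R1 \<le> norm \<zeta>" for \<zeta>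
  proof -
    have "2 * norm z + 2 * norm a + 1 \<le> norm \<zeta>" using \<zeta> by (simp add: R1_def)
    then have "norm \<zeta> > norm z" using norm_ge_zero[of z] norm_ge_zero[of a] by linarith
    then have nz: "\<zeta> \<noteq> z" by auto
    have "norm (F z * (z - a) / (\<zeta> - a)) \<le> norm (F z * (z - a)) / (norm \<zeta> / 2)"
      unfolding norm_divide by (rule frac_le) (use \<zeta> far[of \<zeta> a] posn[of \<zeta>] in auto)
    moreover have "norm (F \<zeta>) \<le> K / norm \<zeta>" using bnd[of \<zeta>] \<zeta> by (auto simp: R1_def)
    moreover have "norm (f \<zeta>) \<le> norm (F \<zeta>) + norm (F z * (z - a) / (\<zeta> - a))"
      unfolding f_def by (rule norm_triangle_ineq4)
    ultimately have "norm (f \<zeta>) \<le> K / norm \<zeta> + norm (F z * (z - a)) / (norm \<zeta> / 2)" by linarith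
    also have "\<dots> = (K + 2 * norm (F z * (z - a))) / norm \<zeta>" by (simp add: add_divide_distrib)
    finally have fb: "norm (f \<zeta>) \<le> (K + 2 * norm (F z * (z - a))) / norm \<zeta>" .
    have "norm (g1 \<zeta>) \<le> ((K + 2 * norm (F z * (z - a))) / norm \<zeta>) / (norm \<zeta> / 2)"
    proof -
      have "norm (g1 \<zeta>) = norm (f \<zeta>) / norm (\<zeta> - z)" using nz fz by (simp add: g1_def norm_divide)
      also have "\<dots> \<le> ((K + 2 * norm (F z * (z - a))) / norm \<zeta>) / (norm \<zeta> / 2)"
        by (rule frac_le[OF _ fb]) (use far[of \<zeta> z] \<zeta> posn[of \<zeta>] K in \<open>auto intro!: divide_nonneg_nonneg add_nonneg_nonneg\<close>)
      finally show ?thesis .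
    qed
    then show ?thesis by (simp add: M_def power2_eq_square field_simps)
  qed
  define \<zeta> where "\<zeta> t = Complex t (-e)" for t
  note G1 = lower_half_plane_line_integral[OF g1holo g1b e, folded \<zeta>_def]
  note G2 = lower_half_plane_line_integral[OF g2holo g2b e, folded \<zeta>_def]
  have dz: "\<zeta> t - z = Complex (t - Re z) \<eta>" "\<zeta> t - a = Complex (t - Re z) (-\<eta>)" for t
    by (simp_all add: \<zeta>_def a_def \<eta>_def complex_eq_iff)
  have nz: "\<zeta> t \<noteq> z" "\<zeta> t - z \<noteq> 0" "\<zeta> t - a \<noteq> 0" for t using z e a by (auto simp: \<zeta>_def complex_eq_iff a_def)
  define P where "P = (\<lambda>t. \<eta> / ((t - Re z)\<^sup>2 + \<eta>\<^sup>2))"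
  have P: "integrable lborel P" "integral\<^sup>L lborel P = pi"
    using poisson_kernel_integral[OF \<eta>] by (simp_all add: P_def)
  have kern: "(z - a) / ((\<zeta> t - a) * (\<zeta> t - z)) = - 2 * \<i> * of_real (P t)" for t
  proof -
    have "(\<zeta> t - a) * (\<zeta> t - z) = of_real ((t - Re z)\<^sup>2 + \<eta>\<^sup>2)"
      unfolding dz by (simp add: complex_eq_iff power2_eq_square algebra_simps)
    moreover have "z - a = - 2 * \<i> * of_real \<eta>" by (simp add: a_def \<eta>_def complex_eq_iff)
    ultimately show ?thesis by (simp add: P_def)
  qed
  have g1eq: "F (\<zeta> t) / (\<zeta> t - z) = g1 (\<zeta> t) - 2 * \<i> * F z * of_real (P t)" for t
  proof -
    have "g1 (\<zeta> t) = F (\<zeta> t) / (\<zeta> t - z) - F z * ((z - a) / ((\<zeta> t - a) * (\<zeta> t - z)))"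
      using nz fz diff_divide_distrib[of "F (\<zeta> t)" "F z * (z - a) / (\<zeta> t - a)" "\<zeta> t - z"]
      by (simp add: g1_def f_def)
    then show ?thesis unfolding kern by simp
  qed
  have iP: "integrable lborel (\<lambda>t. 2 * \<i> * F z * of_real (P t))" using P(1) by (intro integrable_mult_right integrable_of_real)
  have i1: "integrable lborel (\<lambda>t. F (\<zeta> t) / (\<zeta> t - z))"
    unfolding g1eq by (intro Bochner_Integration.integrable_diff G1(1) iP)
  have s1: "(\<integral>t. F (\<zeta> t) / (\<zeta> t - z) \<partial>lborel) = - (2 * \<i> * F z * of_real pi)"
  proof -
    have "(\<integral>t. 2 * \<i> * F z * of_real (P t) \<partial>lborel) = 2 * \<i> * F z * of_real pi"
      using P by (subst integral_mult_right_zero) simp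
    moreover have "(\<integral>t. F (\<zeta> t) / (\<zeta> t - z) \<partial>lborel)
        = (\<integral>t. g1 (\<zeta> t) \<partial>lborel) - (\<integral>t. 2 * \<i> * F z * of_real (P t) \<partial>lborel)"
      unfolding g1eq by (rule Bochner_Integration.integral_diff[OF G1(1) iP])
    ultimately show ?thesis using G1(2) by (simp only: diff_0)
  qed
  have cg: "cnj (g2 (\<zeta> t)) = cnj (F (\<zeta> t)) / (\<zeta> t - z)" for t
    unfolding g2_def dz by (simp add: complex_cnj)
  have i2: "integrable lborel (\<lambda>t. cnj (F (\<zeta> t)) / (\<zeta> t - z))"
    using integrable_bounded_linear[OF bounded_linear_cnj G2(1)] by (simp add: cg)
  have s2: "(\<integral>t. cnj (F (\<zeta> t)) / (\<zeta> t - z) \<partial>lborel) = 0"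
    using integral_bounded_linear[OF bounded_linear_cnj G2(1)] G2(2) by (simp add: cg)
  have "(\<integral>t. of_real (Im (F (\<zeta> t))) / (z - \<zeta> t) \<partial>lborel)
      = (\<integral>t. \<i> / 2 * (F (\<zeta> t) / (\<zeta> t - z) - cnj (F (\<zeta> t)) / (\<zeta> t - z)) \<partial>lborel)"
  proof (rule Bochner_Integration.integral_cong[OF refl])
    fix t
    have "\<i> / 2 * (F (\<zeta> t) / (\<zeta> t - z) - cnj (F (\<zeta> t)) / (\<zeta> t - z)) = \<i> / 2 * (F (\<zeta> t) - cnj (F (\<zeta> t))) / (\<zeta> t - z)"
      by (simp add: diff_divide_distrib right_diff_distrib)
    also have "\<i> / 2 * (F (\<zeta> t) - cnj (F (\<zeta> t))) = - of_real (Im (F (\<zeta> t)))"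
      by (simp add: complex_eq_iff)
    finally show "of_real (Im (F (\<zeta> t))) / (z - \<zeta> t) = \<i> / 2 * (F (\<zeta> t) / (\<zeta> t - z) - cnj (F (\<zeta> t)) / (\<zeta> t - z))"
      by (metis minus_diff_eq minus_divide_left minus_divide_right)
  qed
  also have "\<dots> = \<i> / 2 * (- (2 * \<i> * F z * of_real pi) - 0)"
    using s1 s2 by (simp add: Bochner_Integration.integral_diff[OF i1 i2])
  also have "\<dots> = of_real pi * F z" by (simp add: field_simps)
  finally show ?thesis by (simp add: \<zeta>_def)
qed

text \<open>The formula on the lines Im = - 1 / (n + 1) passes to the real axis by dominated
  convergence, so F is the Cauchy transform of its boundary imaginary part divided by pi. The bound
  Im F <= pi becomes density at most 1, which is the origin of the constraint by Lebesgue measure,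
  and the coefficient of 1/z at infinity becomes the total mass.\<close>

lemma stieltjes_representation:
  fixes F :: "complex \<Rightarrow> complex" and \<rho> :: "real \<Rightarrow> real" and m :: real
  assumes holo: "F holomorphic_on {z. Im z < 0}"
    and im: "\<And>z. Im z < 0 \<Longrightarrow> 0 \<le> Im (F z) \<and> Im (F z) \<le> pi"
    and inf: "((\<lambda>z. z * F z) \<longlongrightarrow> of_real m) (inf at_infinity (principal {z. Im z < 0}))"
    and lim: "\<And>x. (\<lambda>n. Im (F (Complex x (- (1 / Suc n))))) \<longlonglongrightarrow> pi * \<rho> x"
  shows "\<rho> \<in> borel_measurable borel" and "\<And>x. 0 \<le> \<rho> x" and "\<And>x. \<rho> x \<le> 1"
    and "integrable lborel \<rho>" and "integral\<^sup>L lborel \<rho> = m"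
    and "\<And>z. Im z < 0 \<Longrightarrow> F z = (\<integral>t. of_real (\<rho> t) / (z - of_real t) \<partial>lborel)"
proof -
  have cont: "continuous_on UNIV (\<lambda>t. Im (F (Complex t (- (1 / Suc n)))))" for n
    by (intro continuous_intros continuous_on_compose2[OF holomorphic_on_imp_continuous_on[OF holo]])
      (auto simp: Complex_eq intro!: continuous_intros)
  have mI: "(\<lambda>t. Im (F (Complex t (- (1 / Suc n))))) \<in> borel_measurable borel" for n
    by (rule borel_measurable_continuous_onI[OF cont])
  have "(\<lambda>x. pi * \<rho> x) \<in> borel_measurable borel"
    by (rule borel_measurable_LIMSEQ_real[OF lim mI])
  from borel_measurable_times[OF borel_measurable_const[of "1 / pi"] this]
  show m\<rho>: "\<rho> \<in> borel_measurable borel" by simp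
  have "0 \<le> pi * \<rho> x" for x
    by (rule LIMSEQ_le_const[OF lim]) (use im in auto)
  then show \<rho>0: "0 \<le> \<rho> x" for x by (metis pi_gt_zero zero_le_mult_iff not_le)
  have "pi * \<rho> x \<le> pi" for x
    by (rule LIMSEQ_le_const2[OF lim]) (use im in auto)
  then show \<rho>1: "\<rho> x \<le> 1" for x by simp
  obtain R K where R: "R \<ge> 1" and K: "K > 0"
    and bnd: "\<And>z. Im z < 0 \<Longrightarrow> R \<le> norm z \<Longrightarrow> norm (F z) \<le> K / norm z"
    using tendsto_norm_bound_at_infinity[OF inf] by (metis mem_Collect_eq)
  \<comment> \<open>The bound pi serves for |t| <= R and the decay of F beyond, where 1 + |t| <= 2
    |t|. Both are uniform in the height of the line.\<close>
  define K1 where "K1 = pi * (1 + R) + 2 * K"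
  have K1: "\<bar>Im (F (Complex t (- (1 / Suc n))))\<bar> \<le> K1 / (1 + \<bar>t\<bar>)" for t n
  proof (cases "\<bar>t\<bar> \<le> R")
    case True
    have "\<bar>Im (F (Complex t (- (1 / Suc n))))\<bar> * (1 + \<bar>t\<bar>) \<le> pi * (1 + R)"
      using True im[of "Complex t (- (1 / Suc n))"] by (intro mult_mono) auto
    also have "\<dots> \<le> K1" using K by (simp add: K1_def)
    finally show ?thesis by (subst pos_le_divide_eq) auto
  next
    case False
    have n: "norm (Complex t (- (1 / Suc n))) \<ge> \<bar>t\<bar>" using abs_Re_le_cmod[of "Complex t (- (1 / Suc n))"] by simp
    have t: "\<bar>t\<bar> > 0" "1 + \<bar>t\<bar> \<le> 2 * \<bar>t\<bar>" using False R by auto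
    have "\<bar>Im (F (Complex t (- (1 / Suc n))))\<bar> \<le> K / norm (Complex t (- (1 / Suc n)))"
      by (rule order.trans[OF abs_Im_le_cmod bnd]) (use n False in auto)
    also have "\<dots> \<le> K / \<bar>t\<bar>" using n t K by (intro divide_left_mono mult_pos_pos) auto
    also have "\<dots> = 2 * K / (2 * \<bar>t\<bar>)" by simp
    also have "\<dots> \<le> 2 * K / (1 + \<bar>t\<bar>)" using t K by (intro divide_left_mono mult_pos_pos) auto
    also have "\<dots> \<le> K1 / (1 + \<bar>t\<bar>)" using R by (intro divide_right_mono) (auto simp: K1_def)
    finally show ?thesis .
  qed
  have K10: "K1 > 0" using R K by (auto simp: K1_def intro!: add_pos_pos mult_pos_pos)
  have rep: "integrable lborel (\<lambda>t. of_real (\<rho> t) / (z - of_real t)) \<and>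
      F z = (\<integral>t. of_real (\<rho> t) / (z - of_real t) \<partial>lborel)" if z: "Im z < 0" for z
  proof -
    define Y where "Y = - Im z"
    have Y: "Y > 0" using z by (simp add: Y_def)
    define K2 where "K2 = 1 + 2 * (1 + \<bar>Re z\<bar>) / Y"
    have K2: "1 + \<bar>t\<bar> \<le> K2 * norm (z - Complex t (-e))" if "0 \<le> e" "e \<le> Y / 2" for t e
    proof -
      have 1: "\<bar>Re z - t\<bar> \<le> norm (z - Complex t (-e))" using abs_Re_le_cmod[of "z - Complex t (-e)"] by simp
      have 2: "Y / 2 \<le> norm (z - Complex t (-e))"
        using abs_Im_le_cmod[of "z - Complex t (-e)"] that Y by (simp add: Y_def)
      have "1 + \<bar>Re z\<bar> = 2 * (1 + \<bar>Re z\<bar>) / Y * (Y / 2)" using Y by simp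
      also have "\<dots> \<le> 2 * (1 + \<bar>Re z\<bar>) / Y * norm (z - Complex t (-e))"
        by (rule mult_left_mono[OF 2]) (use Y in auto)
      finally show ?thesis using 1 by (simp add: K2_def distrib_right)
    qed
    obtain N where N: "1 / Suc N < Y / 2" using nat_approx_posE[of "Y / 2"] Y by auto
    \<comment> \<open>The shift by \<open>N\<close> keeps the lines within Y / 2 of the real axis,
      hence at distance more than Y / 2 from z.\<close>
    define s where "s = (\<lambda>n t. complex_of_real (Im (F (Complex t (- (1 / Suc (n + N)))))) / (z - Complex t (- (1 / Suc (n + N)))))"
    have le: "1 / real (Suc (n + N)) < Y / 2" for n
    proof -
      have "1 / real (Suc (n + N)) \<le> 1 / real (Suc N)" by (intro divide_left_mono) auto
      then show ?thesis using N by linarith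
    qed
    have sint: "integral\<^sup>L lborel (s n) = of_real pi * F z" for n
      unfolding s_def
      by (rule half_plane_cauchy_im[OF holo bnd R K]) (use le[of n] in \<open>auto simp: Y_def\<close>)
    have dom: "integrable lborel (\<lambda>t. K1 * K2 * (1 / (1 + t\<^sup>2)) :: real)"
        by (intro integrable_mult_right integrable_inverse_one_plus_square)
    have conv: "AE t in lborel. (\<lambda>n. s n t) \<longlonglongrightarrow> of_real (pi * \<rho> t) / (z - of_real t)"
      proof (rule AE_I2)
        fix t
        have 1: "(\<lambda>n. Im (F (Complex t (- (1 / Suc (n + N)))))) \<longlonglongrightarrow> pi * \<rho> t"
          using LIMSEQ_ignore_initial_segment[OF lim[of t], of N] .
        have 2: "(\<lambda>n. Complex t (- (1 / Suc (n + N)))) \<longlonglongrightarrow> Complex t (- 0)"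
          by (intro tendsto_Complex tendsto_const tendsto_minus LIMSEQ_ignore_initial_segment[OF LIMSEQ_Suc[OF lim_1_over_n]])
        show "(\<lambda>n. s n t) \<longlonglongrightarrow> of_real (pi * \<rho> t) / (z - of_real t)"
          unfolding s_def
          by (intro tendsto_divide tendsto_of_real 1 tendsto_diff tendsto_const)
            (use 2 z in \<open>auto simp: complex_of_real_def complex_eq_iff\<close>)
      qed
    have bound: "AE t in lborel. norm (s n t) \<le> K1 * K2 * (1 / (1 + t\<^sup>2))" for n
      proof (rule AE_I2)
        fix t
        define d where "d = norm (z - Complex t (- (1 / Suc (n + N))))"
        have d1: "1 + \<bar>t\<bar> \<le> K2 * d" unfolding d_def by (rule K2) (use le[of n] in auto)
        have d0: "d > 0" using le[of n] Y by (auto simp: d_def complex_eq_iff Y_def)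
        have K20: "K2 > 0" using Y by (auto simp: K2_def intro!: add_pos_nonneg)
        have "norm (s n t) = \<bar>Im (F (Complex t (- (1 / Suc (n + N)))))\<bar> / d"
          by (simp add: s_def d_def norm_divide)
        also have "\<dots> \<le> (K1 / (1 + \<bar>t\<bar>)) / ((1 + \<bar>t\<bar>) / K2)"
          by (rule frac_le) (use K1[of t "n + N"] K10 K20 d1 in \<open>auto simp: pos_divide_le_eq mult.commute\<close>)
        also have "\<dots> = K1 * K2 / (1 + \<bar>t\<bar>)\<^sup>2" by (simp add: power2_eq_square)
        also have "\<dots> \<le> K1 * K2 / (1 + t\<^sup>2)"
        proof (rule divide_left_mono)
          show "1 + t\<^sup>2 \<le> (1 + \<bar>t\<bar>)\<^sup>2" by (simp add: power2_sum)
        qed (use K10 K20 in \<open>auto intro!: mult_pos_pos add_pos_nonneg\<close>)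
        finally show "norm (s n t) \<le> K1 * K2 * (1 / (1 + t\<^sup>2))" by simp
      qed
    have mf: "(\<lambda>t. of_real (pi * \<rho> t) / (z - of_real t)) \<in> borel_measurable lborel" using m\<rho> by measurable
    have ms: "s n \<in> borel_measurable lborel" for n
    proof -
      have "s n \<in> borel_measurable borel"
        unfolding s_def
      proof (rule borel_measurable_divide)
        show "(\<lambda>t. complex_of_real (Im (F (Complex t (- (1 / Suc (n + N))))))) \<in> borel_measurable borel"
          by (rule measurable_compose[OF mI borel_measurable_of_real])
        show "(\<lambda>t. z - Complex t (- (1 / Suc (n + N)))) \<in> borel_measurable borel"
          by (rule borel_measurable_continuous_onI) (auto simp: Complex_eq intro!: continuous_intros)
      qed
      then show ?thesis by simp
    qed
    note dct = integrable_dominated_convergence[OF mf ms dom conv bound]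
      integral_dominated_convergence[OF mf ms dom conv bound]
    have "integrable lborel (\<lambda>t. (1 / of_real pi) * (complex_of_real (pi * \<rho> t) / (z - of_real t)))"
      by (rule integrable_mult_right) (rule dct(1))
    then have int: "integrable lborel (\<lambda>t. of_real (\<rho> t) / (z - of_real t))" by simp
    from dct(2) have "of_real pi * F z = (\<integral>t. of_real pi * (of_real (\<rho> t) / (z - of_real t)) \<partial>lborel)"
      unfolding sint by (simp add: LIMSEQ_const_iff)
    also have "\<dots> = of_real pi * (\<integral>t. of_real (\<rho> t) / (z - of_real t) \<partial>lborel)"
      by (rule integral_mult_right_zero)
    finally show ?thesis using int by simp
  qed
  \<comment> \<open>Integrability of the density is not yet known, so dominated convergence cannot
    give the mass. At w = - i (n + 1) the real part of w F(w) is the integral of a nonnegative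
    function increasing to the density, and monotone convergence gives integrability and mass
    together.\<close>
  define u where "u = (\<lambda>n t. \<rho> t * ((real (Suc n))\<^sup>2 / (t\<^sup>2 + (real (Suc n))\<^sup>2)))"
  define w where "w = (\<lambda>n. - \<i> * of_real (real (Suc n)))"
  have kern: "Re (w n * (of_real (\<rho> t) / (w n - of_real t))) = u n t" for n t
  proof -
    have "w n * (of_real (\<rho> t) / (w n - of_real t)) = of_real (\<rho> t) * (w n / (w n - of_real t))" by simp
    moreover have "Re (w n / (w n - of_real t)) = (real (Suc n))\<^sup>2 / (t\<^sup>2 + (real (Suc n))\<^sup>2)"
    proof -
      have "w n - of_real t = Complex (- t) (- real (Suc n))" "w n = Complex 0 (- real (Suc n))"
        by (simp_all add: w_def complex_eq_iff)
      moreover have "(- x) * (- x) = x * x" for x :: real by simp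
      ultimately show ?thesis by (simp only: Re_divide complex.sel power2_eq_square) simp
    qed
    moreover have "Re (of_real (\<rho> t) * x) = \<rho> t * Re x" for x by simp
    ultimately show ?thesis by (simp only: u_def)
  qed
  have uint: "integrable lborel (u n)" for n
  proof (rule Bochner_Integration.integrable_bound)
    show "integrable lborel (\<lambda>t. (real (Suc n))\<^sup>2 * (1 / (1 + t\<^sup>2)) :: real)"
      by (intro integrable_mult_right integrable_inverse_one_plus_square)
    show "u n \<in> borel_measurable lborel" unfolding u_def using m\<rho> by measurable
    show "AE t in lborel. norm (u n t) \<le> norm ((real (Suc n))\<^sup>2 * (1 / (1 + t\<^sup>2)))"
    proof (rule AE_I2)
      fix t
      have "norm (u n t) = \<rho> t * ((real (Suc n))\<^sup>2 / (t\<^sup>2 + (real (Suc n))\<^sup>2))"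
        using \<rho>0[of t] by (simp add: u_def abs_mult)
      also have "\<dots> \<le> 1 * ((real (Suc n))\<^sup>2 / (1 + t\<^sup>2))"
      proof (rule mult_mono[OF \<rho>1 divide_left_mono])
        have "(real (Suc n))\<^sup>2 \<ge> 1" by simp
        then show "1 + t\<^sup>2 \<le> t\<^sup>2 + (real (Suc n))\<^sup>2" by linarith
        show "0 < (t\<^sup>2 + (real (Suc n))\<^sup>2) * (1 + t\<^sup>2)"
          by (intro mult_pos_pos add_nonneg_pos add_pos_nonneg) auto
      qed auto
      finally show "norm (u n t) \<le> norm ((real (Suc n))\<^sup>2 * (1 / (1 + t\<^sup>2)))" by (auto simp: abs_mult)
    qed
  qed
  have uI: "integral\<^sup>L lborel (u n) = Re (w n * F (w n))" for n
  proof -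
    have z: "Im (w n) < 0" by (simp add: w_def)
    have int: "integrable lborel (\<lambda>t. w n * (of_real (\<rho> t) / (w n - of_real t)))"
      using rep[OF z] by (intro integrable_mult_right) blast
    have "w n * F (w n) = (\<integral>t. w n * (of_real (\<rho> t) / (w n - of_real t)) \<partial>lborel)"
      using rep[OF z] by (simp only: integral_mult_right_zero)
    also have "Re \<dots> = (\<integral>t. Re (w n * (of_real (\<rho> t) / (w n - of_real t))) \<partial>lborel)"
      by (rule integral_Re[symmetric, OF int])
    finally show ?thesis unfolding kern by simp
  qed
  have w: "filterlim w at_infinity sequentially"
  proof (rule filterlim_norm_at_top_imp_at_infinity)
    have "norm (w n) = real (Suc n)" for n by (simp add: w_def norm_mult del: of_nat_Suc)
    then show "filterlim (\<lambda>n. norm (w n)) at_top sequentially" by simp real_asymp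
  qed
  have w': "filterlim w (inf at_infinity (principal {z. Im z < 0})) sequentially"
    by (intro filterlim_inf[THEN iffD2] conjI w) (auto simp: filterlim_principal w_def)
  have "(\<lambda>n. Re (w n * F (w n))) \<longlonglongrightarrow> Re (of_real m)"
    by (intro tendsto_Re filterlim_compose[OF inf w'])
  then have ulim: "(\<lambda>n. integral\<^sup>L lborel (u n)) \<longlonglongrightarrow> m" by (simp add: uI)
  have mono: "mono (\<lambda>n. u n t)" for t
  proof (rule monoI)
    fix i j :: nat assume ij: "i \<le> j"
    have "(real (Suc i))\<^sup>2 / (t\<^sup>2 + (real (Suc i))\<^sup>2) \<le> (real (Suc j))\<^sup>2 / (t\<^sup>2 + (real (Suc j))\<^sup>2)"
    proof -
      have "(real (Suc i))\<^sup>2 \<le> (real (Suc j))\<^sup>2" using ij by (intro power_mono) auto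
      then have "t\<^sup>2 * (real (Suc i))\<^sup>2 \<le> t\<^sup>2 * (real (Suc j))\<^sup>2" by (intro mult_left_mono) auto
      moreover have "t\<^sup>2 + (real (Suc i))\<^sup>2 > 0" "t\<^sup>2 + (real (Suc j))\<^sup>2 > 0" by (auto intro!: add_nonneg_pos)
      ultimately show ?thesis by (simp only: pos_divide_le_eq times_divide_eq_left pos_le_divide_eq) (simp only: algebra_simps)
    qed
    then show "u i t \<le> u j t" unfolding u_def by (intro mult_left_mono \<rho>0)
  qed
  have conv: "(\<lambda>n. u n t) \<longlonglongrightarrow> \<rho> t" for t
  proof -
    have "(\<lambda>n. (real (Suc n))\<^sup>2 / (t\<^sup>2 + (real (Suc n))\<^sup>2)) \<longlonglongrightarrow> 1" by real_asymp
    from tendsto_mult[OF tendsto_const[of "\<rho> t"] this] show ?thesis by (simp add: u_def)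
  qed
  show "integrable lborel \<rho>"
    by (rule integral_monotone_convergence_nonneg(1)[of lborel u, OF uint _ _ _ ulim])
      (use mono conv m\<rho> \<rho>0 in \<open>auto simp: u_def intro!: mult_nonneg_nonneg\<close>)
  show "integral\<^sup>L lborel \<rho> = m"
    by (rule integral_monotone_convergence_nonneg(2)[of lborel u, OF uint _ _ _ ulim])
      (use mono conv m\<rho> \<rho>0 in \<open>auto simp: u_def intro!: mult_nonneg_nonneg\<close>)
  show "F z = (\<integral>t. of_real (\<rho> t) / (z - of_real t) \<partial>lborel)" if "Im z < 0" for z
    using rep[OF that] by blast
qed

section \<open>Logarithmic potentials\<close>

text \<open>The expansion ln |1 + u| = Re u + O(|u|^2) with u = h / (z - t) is uniform in t, because
  |u| is at most |h| over the distance of z from the real axis. Integration leaves an error of order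
  |h|^2.\<close>

lemma logarithmic_potential_has_derivative:
  fixes \<rho> :: "real \<Rightarrow> real"
  assumes \<rho>: "\<And>t. 0 \<le> \<rho> t" "integrable lborel \<rho>"
    and li: "\<And>z. integrable lborel (\<lambda>t. \<rho> t * ln (cmod (z - of_real t)))"
    and z: "Im z < 0"
  shows "((\<lambda>z. \<integral>t. \<rho> t * ln (cmod (z - of_real t)) \<partial>lborel) has_derivative
    (\<lambda>h. Re (h * (\<integral>t. of_real (\<rho> t) / (z - of_real t) \<partial>lborel)))) (at z)"
    (is "(?L has_derivative ?D) _")
proof -
  define Y where "Y = - Im z"
  have Y: "Y > 0" using z by (simp add: Y_def)
  have nY: "Y \<le> cmod (z - of_real t)" for t
    using abs_Im_le_cmod[of "z - of_real t"] z by (simp add: Y_def)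
  have m\<rho>: "\<rho> \<in> borel_measurable borel" using \<rho>(2) by auto
  have ci: "integrable lborel (\<lambda>t. complex_of_real (\<rho> t) / (z - of_real t))"
  proof (rule Bochner_Integration.integrable_bound)
    show "integrable lborel (\<lambda>t. 1 / Y * \<rho> t)" by (intro integrable_mult_right \<rho>)
    show "(\<lambda>t. complex_of_real (\<rho> t) / (z - of_real t)) \<in> borel_measurable lborel" using m\<rho> by measurable
    show "AE t in lborel. norm (complex_of_real (\<rho> t) / (z - of_real t)) \<le> norm (1 / Y * \<rho> t)"
    proof (rule AE_I2)
      fix t
      have "\<bar>\<rho> t\<bar> / cmod (z - of_real t) \<le> \<bar>\<rho> t\<bar> / Y"
        using nY[of t] Y by (intro divide_left_mono mult_pos_pos) auto
      then show "norm (complex_of_real (\<rho> t) / (z - of_real t)) \<le> norm (1 / Y * \<rho> t)"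
        using Y by (simp add: norm_divide abs_mult)
    qed
  qed
  define m where "m = integral\<^sup>L lborel \<rho>"
  have m0: "m \<ge> 0" unfolding m_def by (rule Bochner_Integration.integral_nonneg) (use \<rho> in auto)
  have est: "\<bar>?L (z + h) - ?L z - ?D h\<bar> \<le> 2 * m / Y\<^sup>2 * (norm h)\<^sup>2" if h: "norm h \<le> Y / 2" for h
  proof -
    have hi: "integrable lborel (\<lambda>t. h * (of_real (\<rho> t) / (z - of_real t)))" by (intro integrable_mult_right ci)
    have "?D h = Re (\<integral>t. h * (of_real (\<rho> t) / (z - of_real t)) \<partial>lborel)"
      by (simp only: integral_mult_right_zero)
    also have "\<dots> = (\<integral>t. Re (h * (of_real (\<rho> t) / (z - of_real t))) \<partial>lborel)"
      by (rule integral_Re[symmetric, OF hi])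
    finally have D: "?D h = (\<integral>t. Re (h * (of_real (\<rho> t) / (z - of_real t))) \<partial>lborel)" .
    have i3: "integrable lborel (\<lambda>t. Re (h * (of_real (\<rho> t) / (z - of_real t))))" by (rule integrable_Re[OF hi])
    define E where "E = (\<lambda>t. \<rho> t * ln (cmod (z + h - of_real t)) - \<rho> t * ln (cmod (z - of_real t)) - Re (h * (of_real (\<rho> t) / (z - of_real t))))"
    have iE: "integrable lborel E" unfolding E_def by (intro Bochner_Integration.integrable_diff li i3)
    have "?L (z + h) - ?L z - ?D h = integral\<^sup>L lborel E"
      unfolding D E_def
      by (simp only: Bochner_Integration.integral_diff[OF Bochner_Integration.integrable_diff[OF li li] i3]
          Bochner_Integration.integral_diff[OF li li])
    also have "\<bar>\<dots>\<bar> \<le> (\<integral>t. 2 * (norm h)\<^sup>2 / Y\<^sup>2 * \<rho> t \<partial>lborel)"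
      unfolding real_norm_def[symmetric]
    proof (rule Bochner_Integration.integral_norm_bound_integral[OF iE])
      show "integrable lborel (\<lambda>t. 2 * (norm h)\<^sup>2 / Y\<^sup>2 * \<rho> t)" by (intro integrable_mult_right \<rho>)
      fix t
      define u where "u = h / (z - of_real t)"
      have zt: "z - of_real t \<noteq> 0" "cmod (z - of_real t) > 0" using z nY[of t] Y by auto
      have un: "norm u \<le> norm h / Y"
        unfolding u_def norm_divide using nY[of t] Y zt by (intro divide_left_mono mult_pos_pos) auto
      have "norm h / Y \<le> 1 / 2" using h Y by (simp add: field_simps)
      with un have u2: "norm u \<le> 1 / 2" by linarith
      then have u1: "norm u < 1" by simp
      have nz: "1 + u \<noteq> 0" using u1 by (metis add_eq_0_iff2 add.commute norm_minus_cancel norm_one order_less_irrefl)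
      have "(z - of_real t) * (1 + u) = z + h - of_real t" using zt by (simp add: u_def field_simps)
      then have "cmod (z + h - of_real t) = cmod (z - of_real t) * cmod (1 + u)" by (metis norm_mult)
      then have ln1: "ln (cmod (z + h - of_real t)) = ln (cmod (z - of_real t)) + Re (Ln (1 + u))"
        using zt nz by (simp add: ln_mult Re_Ln)
      have "h * (of_real (\<rho> t) / (z - of_real t)) = of_real (\<rho> t) * u" by (simp add: u_def)
      then have "Re (h * (of_real (\<rho> t) / (z - of_real t))) = \<rho> t * Re u" by simp
      then have "E t = \<rho> t * Re (Ln (1 + u) - u)"
        unfolding E_def ln1 by (simp add: algebra_simps)
      then have "\<bar>E t\<bar> = \<rho> t * \<bar>Re (Ln (1 + u) - u)\<bar>" using \<rho>(1)[of t] by (simp add: abs_mult)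
      also have "\<dots> \<le> \<rho> t * (2 * (norm h)\<^sup>2 / Y\<^sup>2)"
      proof (rule mult_left_mono[OF _ \<rho>(1)])
        have "\<bar>Re (Ln (1 + u) - u)\<bar> \<le> (norm u)\<^sup>2 / (1 - norm u)"
          using order.trans[OF abs_Re_le_cmod Ln_approx_linear[OF u1]] .
        also have "\<dots> \<le> (norm u)\<^sup>2 / (1 / 2)" using u2 by (intro divide_left_mono) auto
        also have "\<dots> = 2 * (norm u)\<^sup>2" by simp
        also have "\<dots> \<le> 2 * (norm h / Y)\<^sup>2" using un by (intro mult_left_mono power_mono) auto
        finally show "\<bar>Re (Ln (1 + u) - u)\<bar> \<le> 2 * (norm h)\<^sup>2 / Y\<^sup>2" by (simp add: power_divide)
      qed
      finally show "norm (E t) \<le> 2 * (norm h)\<^sup>2 / Y\<^sup>2 * \<rho> t" by (simp add: mult.commute)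
    qed
    also have "\<dots> = 2 * m / Y\<^sup>2 * (norm h)\<^sup>2" by (simp add: m_def)
    finally show ?thesis .
  qed
  show ?thesis
    unfolding has_derivative_at_alt
  proof (intro conjI allI impI)
    show "bounded_linear ?D"
      by (rule bounded_linear_compose[OF bounded_linear_Re bounded_linear_mult_left])
    fix e :: real assume e: "e > 0"
    define A where "A = 2 * m / Y\<^sup>2"
    have A: "A \<ge> 0" using m0 Y by (simp add: A_def)
    define d where "d = min (Y / 2) (e / (A + 1))"
    have d: "d > 0" "d \<le> Y / 2" using Y e A by (simp_all only: d_def min.cobounded1) auto
    have Ad: "A * d \<le> e"
    proof -
      have "A * d \<le> A * (e / (A + 1))" using A by (intro mult_left_mono) (auto simp: d_def)
      also have "\<dots> \<le> e" using A e by (simp add: field_simps)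
      finally show ?thesis .
    qed
    show "\<exists>d>0. \<forall>y. norm (y - z) < d \<longrightarrow> norm (?L y - ?L z - ?D (y - z)) \<le> e * norm (y - z)"
    proof (intro exI[of _ d] conjI allI impI d(1))
      fix y assume y: "norm (y - z) < d"
      have "\<bar>?L (z + (y - z)) - ?L z - ?D (y - z)\<bar> \<le> A * (norm (y - z))\<^sup>2"
        unfolding A_def by (rule est) (use y d in auto)
      also have "\<dots> \<le> A * (d * norm (y - z))"
        unfolding power2_eq_square using y A by (intro mult_left_mono mult_right_mono) auto
      also have "\<dots> \<le> e * norm (y - z)" using mult_right_mono[OF Ad norm_ge_zero[of "y - z"]] by (simp add: mult_ac)
      finally show "norm (?L y - ?L z - ?D (y - z)) \<le> e * norm (y - z)" by simp
    qed
  qed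
qed

text \<open>Potential and Re G have the same differential, h to Re (h F z), and the half plane is
  convex.\<close>

lemma logarithmic_potential_eq_Re_primitive:
  fixes \<rho> :: "real \<Rightarrow> real" and F G :: "complex \<Rightarrow> complex"
  assumes \<rho>: "\<And>t. 0 \<le> \<rho> t" "integrable lborel \<rho>"
    and li: "\<And>z. integrable lborel (\<lambda>t. \<rho> t * ln (cmod (z - of_real t)))"
    and F: "\<And>z. Im z < 0 \<Longrightarrow> F z = (\<integral>t. of_real (\<rho> t) / (z - of_real t) \<partial>lborel)"
    and G: "\<And>z. Im z < 0 \<Longrightarrow> (G has_field_derivative F z) (at z)"
  obtains C where "\<And>z. Im z < 0 \<Longrightarrow> (\<integral>t. \<rho> t * ln (cmod (z - of_real t)) \<partial>lborel) = Re (G z) + C"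
proof -
  define D where "D = (\<lambda>z. (\<integral>t. \<rho> t * ln (cmod (z - of_real t)) \<partial>lborel) - Re (G z))"
  have "(D has_derivative (\<lambda>h. 0)) (at z within {z. Im z < 0})" if z: "z \<in> {z. Im z < 0}" for z
  proof -
    have "((\<lambda>z. Re (G z)) has_derivative (\<lambda>h. Re (h * F z))) (at z)"
      using bounded_linear.has_derivative[OF bounded_linear_Re G[unfolded has_field_derivative_def]] z
      by (simp add: mult.commute)
    from has_derivative_diff[OF logarithmic_potential_has_derivative[OF \<rho> li] this] z
    have "(D has_derivative (\<lambda>h. 0)) (at z)" by (simp add: D_def F)
    then show ?thesis by (rule has_derivative_at_withinI)
  qed
  from has_derivative_zero_constant[OF convex_halfspace_Im_lt this]
  obtain C where "\<And>z. Im z < 0 \<Longrightarrow> D z = C" by auto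
  then show thesis by (intro that[of C]) (auto simp: D_def algebra_simps)
qed

text \<open>For real x the distance |x + i y - t| grows with |y|, so the logarithm at height 1 / (n
  + 1) lies between those at heights 0 and 1, and the sum of their absolute values dominates. The
  point t = x is a null set.\<close>

lemma logarithmic_potential_boundary_limit:
  fixes \<rho> :: "real \<Rightarrow> real"
  assumes \<rho>: "\<And>t. 0 \<le> \<rho> t" "integrable lborel \<rho>"
    and li: "\<And>z. integrable lborel (\<lambda>t. \<rho> t * ln (cmod (z - of_real t)))"
  shows "(\<lambda>n. \<integral>t. \<rho> t * ln (cmod (Complex x (- (1 / Suc n)) - of_real t)) \<partial>lborel)
    \<longlonglongrightarrow> (\<integral>t. \<rho> t * ln (cmod (of_real x - of_real t)) \<partial>lborel)"
proof (rule integral_dominated_convergence)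
  show "integrable lborel (\<lambda>t. \<bar>\<rho> t * ln (cmod (of_real x - of_real t))\<bar> + \<bar>\<rho> t * ln (cmod (Complex x (-1) - of_real t))\<bar>)"
    by (intro Bochner_Integration.integrable_add integrable_abs li)
  show "(\<lambda>t. \<rho> t * ln (cmod (of_real x - of_real t))) \<in> borel_measurable lborel" using li by auto
  show "(\<lambda>t. \<rho> t * ln (cmod (Complex x (- (1 / Suc n)) - of_real t))) \<in> borel_measurable lborel" for n using li by auto
  show "AE t in lborel. (\<lambda>n. \<rho> t * ln (cmod (Complex x (- (1 / Suc n)) - of_real t))) \<longlonglongrightarrow> \<rho> t * ln (cmod (of_real x - of_real t))"
    using AE_lborel_singleton[of x]
  proof eventually_elim
    case (elim t)
    have "(\<lambda>n. Complex x (- (1 / Suc n))) \<longlonglongrightarrow> Complex x (- 0)"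
      by (intro tendsto_Complex tendsto_const tendsto_minus LIMSEQ_Suc[OF lim_1_over_n])
    then have "(\<lambda>n. Complex x (- (1 / Suc n))) \<longlonglongrightarrow> of_real x" by (simp add: complex_of_real_def)
    then show ?case using elim by (intro tendsto_intros) auto
  qed
  show "AE t in lborel. norm (\<rho> t * ln (cmod (Complex x (- (1 / Suc n)) - of_real t)))
      \<le> \<bar>\<rho> t * ln (cmod (of_real x - of_real t))\<bar> + \<bar>\<rho> t * ln (cmod (Complex x (-1) - of_real t))\<bar>" for n
    using AE_lborel_singleton[of x]
  proof eventually_elim
    case (elim t)
    have c: "cmod (Complex x y - of_real t) = sqrt ((x - t)\<^sup>2 + y\<^sup>2)" for y by (simp add: cmod_def)
    have c0: "cmod (of_real x - of_real t) = sqrt ((x - t)\<^sup>2 + 0\<^sup>2)" using c[of 0] by (simp add: complex_of_real_def)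
    have p: "(x - t)\<^sup>2 > 0" using elim by auto
    have "(1 / real (Suc n))\<^sup>2 \<le> 1\<^sup>2" by (intro power_mono) auto
    then have "ln (cmod (of_real x - of_real t)) \<le> ln (cmod (Complex x (- (1 / Suc n)) - of_real t))"
        "ln (cmod (Complex x (- (1 / Suc n)) - of_real t)) \<le> ln (cmod (Complex x (-1) - of_real t))"
      unfolding c c0 using p by (auto intro!: ln_mono add_pos_nonneg)
    then have "\<bar>ln (cmod (Complex x (- (1 / Suc n)) - of_real t))\<bar>
        \<le> \<bar>ln (cmod (of_real x - of_real t))\<bar> + \<bar>ln (cmod (Complex x (-1) - of_real t))\<bar>" by linarith
    from mult_left_mono[OF this \<rho>(1)[of t]] show ?case
      using \<rho>(1)[of t] by (simp add: abs_mult distrib_left)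
  qed
qed

section \<open>Integrability of the logarithmic kernel against a density\<close>

lemma integrable_truncated_powr_neg_half:
  "integrable lborel (\<lambda>t::real. indicator {0..1} t * t powr (- 1 / 2))"
proof -
  have "(\<lambda>t::real. t powr (- 1 / 2)) absolutely_integrable_on {0..1}"
  proof (rule nonnegative_absolutely_integrable_1)
    show "(\<lambda>t::real. t powr (- 1 / 2)) integrable_on {0..1}"
      using has_integral_powr_from_0[of "- 1 / 2" 1] by (auto simp: integrable_on_def)
  qed auto
  then have "integrable lebesgue (\<lambda>t::real. indicator {0..1} t * t powr (- 1 / 2))"
    by (simp add: set_integrable_def)
  then show ?thesis
    by (subst (asm) integrable_completion) auto
qed

lemma integrable_local_powr_neg_half:
  "integrable lborel (\<lambda>t::real. indicator {x - 1..x + 1} t * \<bar>t - x\<bar> powr (- 1 / 2))"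
proof -
  note i = integrable_truncated_powr_neg_half
  have "integrable lborel (\<lambda>t::real. indicator {0..1} (- x + 1 * t) * (- x + 1 * t) powr (- 1 / 2) +
      indicator {0..1} (x + (-1) * t) * (x + (-1) * t) powr (- 1 / 2))"
    by (intro Bochner_Integration.integrable_add lborel_integrable_real_affine[OF i]) auto
  then show ?thesis
  proof (rule Bochner_Integration.integrable_cong[THEN iffD1, rotated 2])
    fix t :: real
    show "indicator {0..1} (- x + 1 * t) * (- x + 1 * t) powr (- 1 / 2) +
      indicator {0..1} (x + (-1) * t) * (x + (-1) * t) powr (- 1 / 2)
      = indicator {x - 1..x + 1} t * \<bar>t - x\<bar> powr (- 1 / 2)"
      by (cases "t > x"; cases "t = x") (auto simp: indicator_def)
  qed auto
qed

text \<open>For r = |z - t| < 1 the density is at most 1 and |ln r| <= 2 s^(-1/2) with s = |t - Re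
  z| <= r, which is locally integrable. For r >= 1 one has ln r <= ln (1 + |z|) + ln (1 + |t|). So
  what remains to be verified for each measure is a condition on its tail, independent of z.\<close>

lemma integrable_log_kernel:
  fixes \<rho> :: "real \<Rightarrow> real"
  assumes \<rho>: "\<And>t. 0 \<le> \<rho> t" "\<And>t. \<rho> t \<le> 1" "integrable lborel \<rho>"
    and li: "integrable lborel (\<lambda>t. \<rho> t * ln (1 + \<bar>t\<bar>))"
  shows "integrable lborel (\<lambda>t. \<rho> t * ln (cmod (z - of_real t)))"
proof (rule Bochner_Integration.integrable_bound)
  show "integrable lborel (\<lambda>t. ln (1 + norm z) * \<rho> t + \<rho> t * ln (1 + \<bar>t\<bar>)
      + 2 * (indicator {Re z - 1..Re z + 1} t * \<bar>t - Re z\<bar> powr (- 1 / 2)))"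
    by (intro Bochner_Integration.integrable_add integrable_mult_right \<rho> li integrable_local_powr_neg_half)
  have m\<rho>: "\<rho> \<in> borel_measurable borel" using \<rho>(3) by auto
  show "(\<lambda>t. \<rho> t * ln (cmod (z - of_real t))) \<in> borel_measurable lborel" using m\<rho> by measurable
  show "AE t in lborel. norm (\<rho> t * ln (cmod (z - of_real t))) \<le> norm (ln (1 + norm z) * \<rho> t + \<rho> t * ln (1 + \<bar>t\<bar>)
      + 2 * (indicator {Re z - 1..Re z + 1} t * \<bar>t - Re z\<bar> powr (- 1 / 2)))"
    using AE_lborel_singleton[of "Re z"]
  proof eventually_elim
    case (elim t)
    define r where "r = cmod (z - of_real t)"
    have d: "\<bar>t - Re z\<bar> \<le> r" using abs_Re_le_cmod[of "z - of_real t"] by (simp add: r_def)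
    have r0: "r > 0" using d elim by auto
    define S where "S = ln (1 + norm z) * \<rho> t + \<rho> t * ln (1 + \<bar>t\<bar>)"
    define T where "T = 2 * (indicator {Re z - 1..Re z + 1} t * \<bar>t - Re z\<bar> powr (- 1 / 2))"
    have S0: "S \<ge> 0" using \<rho>(1)[of t] by (simp add: S_def)
    have T0: "T \<ge> 0" by (simp add: T_def)
    have "\<rho> t * \<bar>ln r\<bar> \<le> S + T"
    proof (cases "r \<ge> 1")
      case True
      have "r \<le> norm z + \<bar>t\<bar>" using norm_triangle_ineq4[of z "of_real t"] by (simp add: r_def)
      also have "\<dots> \<le> (1 + norm z) * (1 + \<bar>t\<bar>)" by (simp add: algebra_simps)
      finally have "ln r \<le> ln ((1 + norm z) * (1 + \<bar>t\<bar>))" using r0 by (intro ln_mono) auto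
      also have "\<dots> = ln (1 + norm z) + ln (1 + \<bar>t\<bar>)" by (rule ln_mult_pos) (auto intro: add_pos_nonneg)
      finally have "\<rho> t * \<bar>ln r\<bar> \<le> \<rho> t * (ln (1 + norm z) + ln (1 + \<bar>t\<bar>))"
        using True by (intro mult_left_mono \<rho>(1)) auto
      also have "\<dots> = S" by (simp add: S_def algebra_simps)
      finally show ?thesis using T0 by simp
    next
      case False
      define s where "s = \<bar>t - Re z\<bar>"
      have s: "s > 0" "s \<le> r" "s \<le> 1" using elim d False by (auto simp: s_def)
      have "\<bar>ln r\<bar> = - ln r" using False r0 by simp
      also have "\<dots> \<le> - ln s" using s by (simp add: ln_mono)
      also have "\<dots> = 2 * ln (s powr (- 1 / 2))" using s by (simp add: ln_powr)
      also have "\<dots> \<le> 2 * s powr (- 1 / 2)" using s ln_le_minus_one[of "s powr (- 1 / 2)"] by simp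
      also have "\<dots> = T" using s by (simp add: T_def s_def indicator_def abs_le_iff)
      finally have "\<bar>ln r\<bar> \<le> T" .
      have "\<rho> t * \<bar>ln r\<bar> \<le> 1 * \<bar>ln r\<bar>" by (intro mult_right_mono \<rho>) auto
      then show ?thesis using \<open>\<bar>ln r\<bar> \<le> T\<close> S0 by linarith
    qed
    then have "norm (\<rho> t * ln r) \<le> S + T" using \<rho>(1)[of t] by (simp add: abs_mult)
    also have "\<dots> \<le> norm (S + T)" by simp
    finally show ?case unfolding S_def T_def r_def .
  qed
qed

lemma integrable_density_log_of_compact_support:
  fixes \<rho> :: "real \<Rightarrow> real"
  assumes "\<And>t. 0 \<le> \<rho> t" "integrable lborel \<rho>" "\<And>t. \<bar>t\<bar> > R \<Longrightarrow> \<rho> t = 0"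
  shows "integrable lborel (\<lambda>t. \<rho> t * ln (1 + \<bar>t\<bar>))"
proof (rule Bochner_Integration.integrable_bound)
  show "integrable lborel (\<lambda>t. ln (1 + \<bar>R\<bar>) * \<rho> t)" by (intro integrable_mult_right assms)
  have "\<rho> \<in> borel_measurable borel" using assms(2) by auto
  then show "(\<lambda>t. \<rho> t * ln (1 + \<bar>t\<bar>)) \<in> borel_measurable lborel" by measurable
  show "AE t in lborel. norm (\<rho> t * ln (1 + \<bar>t\<bar>)) \<le> norm (ln (1 + \<bar>R\<bar>) * \<rho> t)"
  proof (rule AE_I2)
    fix t
    show "norm (\<rho> t * ln (1 + \<bar>t\<bar>)) \<le> norm (ln (1 + \<bar>R\<bar>) * \<rho> t)"
    proof (cases "\<bar>t\<bar> > R")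
      case False
      then have "ln (1 + \<bar>t\<bar>) \<le> ln (1 + \<bar>R\<bar>)" by (intro ln_mono) auto
      from mult_left_mono[OF this assms(1)[of t]] show ?thesis
        using assms(1)[of t] by (simp add: abs_mult mult.commute)
    qed (simp add: assms(3))
  qed
qed

lemma integrable_powr_tail:
  assumes "p < -1"
  shows "integrable lborel (\<lambda>t::real. (1 + \<bar>t\<bar>) powr p)"
proof -
  have "(\<lambda>t::real. t powr p) absolutely_integrable_on {1..}"
  proof (rule nonnegative_absolutely_integrable_1)
    show "(\<lambda>t::real. t powr p) integrable_on {1..}"
      using has_integral_powr_to_inf[of p 1] assms by (auto simp: integrable_on_def)
  qed auto
  then have "integrable lebesgue (\<lambda>t::real. indicator {1..} t * t powr p)"
    by (simp add: set_integrable_def)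
  then have i: "integrable lborel (\<lambda>t::real. indicator {1..} t * t powr p)"
    by (subst (asm) integrable_completion) auto
  have "integrable lborel (\<lambda>t::real. indicator {1..} (1 + 1 * t) * (1 + 1 * t) powr p +
      indicator {1..} (1 + (-1) * t) * (1 + (-1) * t) powr p)"
    by (intro Bochner_Integration.integrable_add lborel_integrable_real_affine[OF i]) auto
  then show ?thesis
  proof (rule Bochner_Integration.integrable_bound)
    show "AE t in lborel. norm ((1 + \<bar>t\<bar>) powr p) \<le> norm (indicator {1..} (1 + 1 * t) * (1 + 1 * t) powr p +
      indicator {1..} (1 + (-1) * t) * (1 + (-1) * t) powr p)"
      by (rule AE_I2) (auto simp: indicator_def abs_if)
  qed auto
qed

text \<open>The exponent -3/2 is the decay of the density of mu. With s = 1 + |t| one has ln s <= 4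
  s^(1/4), and the remaining power s^(-5/4) is integrable.\<close>

lemma integrable_density_log_of_powr_bound:
  fixes \<rho> :: "real \<Rightarrow> real"
  assumes \<rho>: "\<And>t. 0 \<le> \<rho> t" "\<rho> \<in> borel_measurable borel" "\<And>t. \<rho> t \<le> K * (1 + \<bar>t\<bar>) powr (- 3 / 2)"
  shows "integrable lborel (\<lambda>t. \<rho> t * ln (1 + \<bar>t\<bar>))"
proof (rule Bochner_Integration.integrable_bound)
  show "integrable lborel (\<lambda>t::real. K * 4 * (1 + \<bar>t\<bar>) powr (- 5 / 4))"
    by (intro integrable_mult_right integrable_powr_tail) auto
  show "(\<lambda>t. \<rho> t * ln (1 + \<bar>t\<bar>)) \<in> borel_measurable lborel" using \<rho>(2) by measurable
  show "AE t in lborel. norm (\<rho> t * ln (1 + \<bar>t\<bar>)) \<le> norm (K * 4 * (1 + \<bar>t\<bar>) powr (- 5 / 4))"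
  proof (rule AE_I2)
    fix t :: real
    define s where "s = 1 + \<bar>t\<bar>"
    have s: "s \<ge> 1" by (simp add: s_def)
    have "\<rho> t * ln s \<le> (K * s powr (- 3 / 2)) * (s powr (1 / 4) / (1 / 4))"
      using \<rho>(1,3)[of t] s ln_powr_bound[of s "1 / 4"] order.trans[OF \<rho>(1)[of t] \<rho>(3)[of t]]
      by (intro mult_mono) (auto simp: s_def)
    also have "\<dots> = K * 4 * (s powr (- 3 / 2) * s powr (1 / 4))" by simp
    also have "s powr (- 3 / 2) * s powr (1 / 4) = s powr (- 5 / 4)" by (simp add: powr_add[symmetric])
    finally have "\<rho> t * ln s \<le> K * 4 * s powr (- 5 / 4)" .
    also have "\<dots> \<le> norm (K * 4 * s powr (- 5 / 4))" by simp
    finally show "norm (\<rho> t * ln (1 + \<bar>t\<bar>)) \<le> norm (K * 4 * (1 + \<bar>t\<bar>) powr (- 5 / 4))"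
      using \<rho>(1)[of t] s by (simp add: abs_mult s_def[symmetric])
  qed
qed

section \<open>The parametrized curve\<close>

definition curve_cubic :: "real \<Rightarrow> complex \<Rightarrow> complex \<Rightarrow> complex" where
  "curve_cubic k z q = q ^ 3 - of_real k * (1 + z) * q + of_real k * z"

definition curve_phi :: "real \<Rightarrow> complex \<Rightarrow> complex" where
  "curve_phi k q = (q\<^sup>2 - of_real k) / (of_real (1 - k) * q\<^sup>2)"

definition curve_z :: "real \<Rightarrow> complex \<Rightarrow> complex" where
  "curve_z k q = q * (of_real k - q\<^sup>2) / (of_real k * (1 - q))"

text \<open>Put w = z (phi - sigma). Multiplied by z^2, the equation becomes sigma w^2 - (sigma - 1)
  (w + phi)^2 = phi w^2. Division by w^2 makes phi a function of q = w / (w + phi) alone, phi =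
  sigma (1 - k / q^2); this is the origin of the parameter q.\<close>

lemma curve_parameter:
  assumes k: "0 < k" "k < 1" and \<sigma>: "\<sigma> = 1 / (1 - k)"
    and root: "poly (phi_poly \<sigma> z) \<phi> = 0" and z: "z \<noteq> 0"
    and q: "q = z * (\<phi> - of_real \<sigma>) / (z * (\<phi> - of_real \<sigma>) + \<phi>)"
  shows "z * (\<phi> - of_real \<sigma>) + \<phi> \<noteq> 0" "q \<noteq> 0" "q \<noteq> 1" "curve_cubic k z q = 0" "curve_phi k q = \<phi>"
proof -
  define s where "s = complex_of_real \<sigma>"
  have s1: "s \<noteq> 0" "s \<noteq> 1" "(1 - of_real k) * s = 1" "s - 1 = of_real k * s"
    using k by (auto simp: s_def \<sigma> complex_eq_iff field_simps)
  have eq: "(\<phi> - 1) * (z * (\<phi> - s))\<^sup>2 + 2 * (s - 1) * \<phi> * (z * (\<phi> - s)) + (s - 1) * \<phi>\<^sup>2 = 0"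
  proof -
    have "z\<^sup>2 * poly (phi_poly \<sigma> z) \<phi> = (\<phi> - 1) * (z * (\<phi> - s))\<^sup>2 + 2 * (s - 1) * \<phi> * (z * (\<phi> - s)) + (s - 1) * \<phi>\<^sup>2"
      using z unfolding phi_poly_def Let_def s_def[symmetric]
      by (simp add: field_simps) algebra
    then show ?thesis using root by simp
  qed
  have \<phi>0: "\<phi> \<noteq> 0"
  proof
    assume "\<phi> = 0"
    then show False using root s1 by (simp add: phi_poly_def Let_def s_def)
  qed
  have \<phi>s: "\<phi> \<noteq> s" using eq \<phi>0 s1 by auto
  define w where "w = z * (\<phi> - s)"
  have eqw: "(\<phi> - 1) * w\<^sup>2 + 2 * (s - 1) * \<phi> * w + (s - 1) * \<phi>\<^sup>2 = 0"
    using eq by (simp add: w_def)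
  have w0: "w \<noteq> 0" using z \<phi>s by (simp add: w_def)
  show d: "z * (\<phi> - of_real \<sigma>) + \<phi> \<noteq> 0"
  proof
    assume "z * (\<phi> - of_real \<sigma>) + \<phi> = 0"
    then have "w = - \<phi>" by (simp add: w_def s_def eq_neg_iff_add_eq_0)
    then have "\<phi>\<^sup>2 * (\<phi> - s) = 0" using eqw by (simp add: power2_eq_square algebra_simps)
    then show False using \<phi>0 \<phi>s by auto
  qed
  have qw: "q = w / (w + \<phi>)" using q by (simp add: w_def s_def)
  have d': "w + \<phi> \<noteq> 0" using d by (simp add: w_def s_def)
  show q0: "q \<noteq> 0" using w0 d' by (simp add: qw)
  show "q \<noteq> 1" using \<phi>0 d' by (simp add: qw)
  have ks: "of_real k * s = s - 1" using s1 by simp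
  have "(q\<^sup>2 - of_real k) = of_real (1 - k) * q\<^sup>2 * \<phi>"
  proof -
    have "s * (w\<^sup>2 - of_real k * (w + \<phi>)\<^sup>2) = s * w\<^sup>2 - (s - 1) * (w + \<phi>)\<^sup>2"
      by (simp add: right_diff_distrib ks[symmetric] mult_ac)
    also have "\<dots> = w\<^sup>2 * \<phi>" using eqw by (simp add: power2_eq_square) algebra
    finally have "s * (w\<^sup>2 - of_real k * (w + \<phi>)\<^sup>2) = w\<^sup>2 * \<phi>" .
    then have "(1 - of_real k) * s * (w\<^sup>2 - of_real k * (w + \<phi>)\<^sup>2) = (1 - of_real k) * (w\<^sup>2 * \<phi>)" by (simp add: mult.assoc)
    then have "w\<^sup>2 - of_real k * (w + \<phi>)\<^sup>2 = (1 - of_real k) * (w\<^sup>2 * \<phi>)" using s1 by simp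
    then show ?thesis using d' by (simp add: qw power_divide field_simps)
  qed
  then show "curve_phi k q = \<phi>" using q0 k by (simp add: curve_phi_def)
  have "z = w / (\<phi> - s)" using \<phi>s by (simp add: w_def)
  \<comment> \<open>The relations q (w + phi) = w and z (phi - s) = w clear all denominators, and
    what remains is w s times the left side of \<open>eqw\<close>.\<close>
  have ez: "(w + \<phi>) ^ 3 * (\<phi> - s) * s * curve_cubic k z q = 0"
  proof -
    have "(w + \<phi>) ^ 3 * curve_cubic k z q = w ^ 3 - of_real k * (1 + z) * w * (w + \<phi>)\<^sup>2 + of_real k * z * (w + \<phi>) ^ 3"
    proof -
      have qv: "q * (w + \<phi>) = w" using d' by (simp add: qw)
      have "(w + \<phi>) ^ 3 * curve_cubic k z q = (q * (w + \<phi>)) ^ 3 - of_real k * (1 + z) * (q * (w + \<phi>)) * (w + \<phi>)\<^sup>2 + of_real k * z * (w + \<phi>) ^ 3"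
        unfolding curve_cubic_def by algebra
      then show ?thesis by (simp only: qv)
    qed
    then have "(w + \<phi>) ^ 3 * (\<phi> - s) * s * curve_cubic k z q
      = s * (\<phi> - s) * w ^ 3 - (of_real k * s) * ((\<phi> - s) + z * (\<phi> - s)) * w * (w + \<phi>)\<^sup>2 + (of_real k * s) * (z * (\<phi> - s)) * (w + \<phi>) ^ 3"
      by algebra
    also have "\<dots> = s * (\<phi> - s) * w ^ 3 - (s - 1) * ((\<phi> - s) + w) * w * (w + \<phi>)\<^sup>2 + (s - 1) * w * (w + \<phi>) ^ 3"
      by (simp only: ks w_def[symmetric])
    also have "\<dots> = w * s * ((\<phi> - 1) * w\<^sup>2 + 2 * (s - 1) * \<phi> * w + (s - 1) * \<phi>\<^sup>2)"
      by algebra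
    also have "\<dots> = 0" by (simp only: eqw mult_zero_right)
    finally show ?thesis .
  qed
  then show "curve_cubic k z q = 0" using d' \<phi>s s1 by simp
qed

lemma curve_cubic_conj: "curve_cubic k (of_real x) (cnj q) = cnj (curve_cubic k (of_real x) q)"
  by (simp add: curve_cubic_def)

text \<open>The cubic has no quadratic term, so the third root is - p - q. Dividing the difference
  of the two equations by p - q gives the other coefficients.\<close>

lemma curve_cubic_factor:
  assumes "curve_cubic k z p = 0" "curve_cubic k z q = 0" "p \<noteq> q"
  shows "curve_cubic k z w = (w - p) * (w - q) * (w + p + q)"
proof -
  have "(p - q) * (p\<^sup>2 + p * q + q\<^sup>2 - of_real k * (1 + z)) = 0"
    using assms(1,2) unfolding curve_cubic_def by algebra
  then have 1: "of_real k * (1 + z) = p\<^sup>2 + p * q + q\<^sup>2" using assms(3) by simp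
  have 2: "of_real k * z = p * q * (p + q)"
    using assms(1) 1 unfolding curve_cubic_def by algebra
  show ?thesis unfolding curve_cubic_def 1 2 by algebra
qed

text \<open>The value at 1 is free of z. Hence 1 is never a root, and the factored cubic evaluated
  at 1 relates the three roots without involving z.\<close>

lemma curve_cubic_one: "curve_cubic k z 1 = 1 - of_real k"
  by (simp add: curve_cubic_def algebra_simps)

lemma curve_cubic_iff:
  assumes "k \<noteq> 0" "q \<noteq> 1"
  shows "curve_cubic k z q = 0 \<longleftrightarrow> curve_z k q = z"
proof -
  have "of_real k * (1 - q) * (curve_z k q - z) = - curve_cubic k z q"
  proof -
    have "of_real k * (1 - q) * curve_z k q = q * (of_real k - q\<^sup>2)" using assms by (simp add: curve_z_def)
    then show ?thesis unfolding curve_cubic_def by algebra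
  qed
  then show ?thesis using assms by (metis eq_iff_diff_eq_0 mult_eq_0_iff neg_equal_0_iff_equal of_real_eq_0_iff)
qed

text \<open>For larger |q| the cubic term dominates. A crude bound suffices, since it only has to
  keep the roots bounded while z converges to a real point.\<close>

lemma curve_cubic_root_bound:
  assumes k: "0 < k" "k < 1" and "curve_cubic k z q = 0"
  shows "norm q \<le> 1 + 2 * norm z"
proof (rule ccontr)
  assume "\<not> ?thesis"
  then have q: "norm q > 1 + 2 * norm z" by simp
  have q1: "norm q > 1" using q norm_ge_zero[of z] by linarith
  have "q ^ 3 = of_real k * (1 + z) * q - of_real k * z"
    using assms(3) by (simp add: curve_cubic_def algebra_simps)
  then have "norm q ^ 3 = norm (of_real k * (1 + z) * q - of_real k * z)" by (metis norm_power)
  also have "\<dots> \<le> norm (of_real k * (1 + z) * q) + norm (of_real k * z)" by (rule norm_triangle_ineq4)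
  also have "\<dots> = k * (norm (1 + z) * norm q + norm z)" 
  proof -
    have "norm (of_real k * (1 + z) * q) = k * norm (1 + z) * norm q" "norm (of_real k * z) = k * norm z"
      using k by (simp_all only: norm_mult norm_of_real abs_of_pos)
    then show ?thesis by (simp add: algebra_simps)
  qed
  also have "\<dots> \<le> 1 * ((1 + norm z) * norm q + norm z * norm q)"
  proof (rule mult_mono)
    have "norm (1 + z) \<le> 1 + norm z" using norm_triangle_ineq[of 1 z] by simp
    then show "norm (1 + z) * norm q + norm z \<le> (1 + norm z) * norm q + norm z * norm q"
      using q1 by (intro add_mono mult_right_mono) (auto simp: mult_le_cancel_left1)
  qed (use k in auto)
  also have "\<dots> = (1 + 2 * norm z) * norm q" by (simp add: algebra_simps)
  also have "\<dots> < norm q * norm q" using q q1 by (intro mult_strict_right_mono) auto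
  also have "\<dots> \<le> norm q ^ 3" using q1 power_increasing[of 2 3 "norm q"] by (simp add: power2_eq_square)
  finally show False by simp
qed

lemma Im_curve_z:
  assumes k: "0 < k" and q: "q \<noteq> 1"
  shows "Im (curve_z k q) = Im q * ((2 * Re q + 1) * (cmod (1 - q))\<^sup>2 - (1 - k)) / (k * (cmod (1 - q))\<^sup>2)"
proof -
  obtain x y where xy: "q = Complex x y" by (cases q)
  have n: "(cmod (1 - q))\<^sup>2 = (1 - x)\<^sup>2 + y\<^sup>2" by (simp add: xy cmod_power2)
  have nz: "(1 - x)\<^sup>2 + y\<^sup>2 \<noteq> 0" using q by (auto simp: xy complex_eq_iff add_nonneg_eq_0_iff)
  have "curve_z k q = (q * (of_real k - q\<^sup>2) * cnj (1 - q)) / (of_real k * of_real ((cmod (1 - q))\<^sup>2))"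
  proof -
    have "of_real ((cmod (1 - q))\<^sup>2) = (1 - q) * cnj (1 - q)" by (rule complex_norm_square)
    then have *: "of_real k * of_real ((cmod (1 - q))\<^sup>2) = (of_real k * (1 - q)) * cnj (1 - q)" by (simp only: mult.assoc)
    have nz: "cnj (1 - q) \<noteq> 0" using q by (metis complex_cnj_zero_iff right_minus_eq)
    show ?thesis unfolding curve_z_def * by (rule mult_divide_mult_cancel_right[OF nz, symmetric])
  qed
  then have "curve_z k q = (q * (of_real k - q\<^sup>2) * cnj (1 - q)) / of_real (k * (cmod (1 - q))\<^sup>2)" by simp
  then have "Im (curve_z k q) = Im (q * (of_real k - q\<^sup>2) * cnj (1 - q)) / (k * (cmod (1 - q))\<^sup>2)"
    by (simp only: Im_divide_of_real)
  also have "Im (q * (of_real k - q\<^sup>2) * cnj (1 - q)) = y * ((2 * x + 1) * ((1 - x)\<^sup>2 + y\<^sup>2) - (1 - k))"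
    by (simp add: xy power2_eq_square algebra_simps)
  finally show ?thesis unfolding n by (simp add: xy)
qed

section \<open>Critical points of z on the real axis\<close>

definition curve_zr :: "real \<Rightarrow> real \<Rightarrow> real" where
  "curve_zr k x = x * (k - x\<^sup>2) / (k * (1 - x))"

lemma curve_z_of_real: "curve_z k (of_real x) = of_real (curve_zr k x)"
  by (simp add: curve_z_def curve_zr_def)

text \<open>The polynomial (2 x + 1) (1 - x)^2 takes the values 0, 1, 0, 5 at -1/2, 0, 1, 2, so it
  attains c three times. Its difference from c is, up to a positive factor, the derivative of z on
  the real axis, see \<open>curve_zr_deriv\<close>; the three points are thus the critical points of
  z. Divided differences of the three equations give the factorization.\<close>

lemma critical_points_exist:
  fixes c :: real
  assumes "0 < c" "c < 1"
  obtains Xa Xb Xc where "-1/2 < Xa" "Xa < 0" "0 < Xb" "Xb < 1" "1 < Xc"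
    "\<And>x. (2 * x + 1) * (1 - x)\<^sup>2 - c = 2 * ((x - Xa) * ((x - Xb) * (x - Xc)))"
proof -
  define m :: "real \<Rightarrow> real" where "m = (\<lambda>x. (2 * x + 1) * (1 - x)\<^sup>2)"
  have cont: "continuous_on A m" for A unfolding m_def by (intro continuous_intros)
  obtain a where a: "-1/2 \<le> a" "a \<le> 0" "m a = c"
    using IVT'[of m "-1/2" c 0] cont assms by (auto simp: m_def)
  obtain b where b: "0 \<le> b" "b \<le> 1" "m b = c"
    using IVT2'[of m 1 c 0] cont assms by (auto simp: m_def)
  obtain d where d: "1 \<le> d" "d \<le> 2" "m d = c"
    using IVT'[of m 1 c 2] cont assms by (auto simp: m_def)
  have ne: "a \<noteq> -1/2" "a \<noteq> 0" "b \<noteq> 0" "b \<noteq> 1" "d \<noteq> 1" using a(3) b(3) d(3) assms by (auto simp: m_def)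
  have st: "-1/2 < a" "a < 0" "0 < b" "b < 1" "1 < d" using a b d ne by auto
  have "(a - b) * (2 * (a\<^sup>2 + a * b + b\<^sup>2) - 3 * (a + b)) = 0"
  proof -
    have "(2 * a + 1) * (1 - a)\<^sup>2 = (2 * b + 1) * (1 - b)\<^sup>2" using a(3) b(3) by (simp add: m_def)
    then show ?thesis by algebra
  qed
  moreover have "(a - d) * (2 * (a\<^sup>2 + a * d + d\<^sup>2) - 3 * (a + d)) = 0"
  proof -
    have "(2 * a + 1) * (1 - a)\<^sup>2 = (2 * d + 1) * (1 - d)\<^sup>2" using a(3) d(3) by (simp add: m_def)
    then show ?thesis by algebra
  qed
  ultimately have e1: "2 * (a\<^sup>2 + a * b + b\<^sup>2) - 3 * (a + b) = 0" and e2: "2 * (a\<^sup>2 + a * d + d\<^sup>2) - 3 * (a + d) = 0"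
    using st by auto
  have "(b - d) * (2 * (a + b + d) - 3) = 0" using e1 e2 by algebra
  then have s: "2 * (a + b + d) = 3" using st by auto
  have "(2 * x + 1) * (1 - x)\<^sup>2 - c = 2 * ((x - a) * ((x - b) * (x - d)))" for x
  proof -
    have "(2 * x + 1) * (1 - x)\<^sup>2 - (2 * a + 1) * (1 - a)\<^sup>2 = (x - a) * ((x - b) * (2 * x - (3 - 2 * a - 2 * b)))"
      using e1 by algebra
    moreover have "2 * x - (3 - 2 * a - 2 * b) = 2 * (x - d)" using s by simp
    ultimately show ?thesis using a(3) by (simp add: m_def)
  qed
  then show thesis using that st by blast
qed

text \<open>A sequence of values staying away from L has, by boundedness, a convergent subsequence,
  and its limit would have to be L. The intended f is a branch of roots approaching a point where
  roots may collide.\<close>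

lemma compact_limit_unique:
  fixes f :: "'a::metric_space \<Rightarrow> 'b::heine_borel"
  assumes cl: "\<And>X l. (\<And>n. X n \<in> A) \<Longrightarrow> X \<longlonglongrightarrow> a \<Longrightarrow> (\<lambda>n. f (X n)) \<longlonglongrightarrow> l \<Longrightarrow> l = L"
    and bd: "\<And>X. (\<And>n. X n \<in> A) \<Longrightarrow> X \<longlonglongrightarrow> a \<Longrightarrow> bounded (range (\<lambda>n. f (X n)))"
  shows "(f \<longlongrightarrow> L) (at a within A)"
  unfolding tendsto_at_iff_sequentially
proof (intro allI impI)
  fix X assume X: "\<forall>i. X i \<in> A - {a}" "X \<longlonglongrightarrow> a"
  show "(f \<circ> X) \<longlonglongrightarrow> L"
  proof (rule ccontr)
    assume "\<not> (f \<circ> X) \<longlonglongrightarrow> L"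
    then obtain e where e: "e > 0" "\<not> eventually (\<lambda>n. dist ((f \<circ> X) n) L < e) sequentially"
      unfolding tendsto_iff by blast
    from not_eventually_sequentiallyD[OF e(2)] obtain r :: "nat \<Rightarrow> nat" where r: "strict_mono r" "\<forall>n. \<not> dist ((f \<circ> X) (r n)) L < e" by auto
    have Xr: "\<And>n. X (r n) \<in> A" "(\<lambda>n. X (r n)) \<longlonglongrightarrow> a"
      using X LIMSEQ_subseq_LIMSEQ[OF X(2) r(1)] by (auto simp: o_def)
    from bounded_imp_convergent_subsequence[OF bd[OF Xr]]
    obtain l s where s: "strict_mono s" "((\<lambda>n. f (X (r n))) \<circ> s) \<longlonglongrightarrow> l" by blast
    have "l = L"
      by (rule cl[of "\<lambda>n. X (r (s n))"])
        (use Xr s LIMSEQ_subseq_LIMSEQ[OF Xr(2) s(1)] in \<open>auto simp: o_def\<close>)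
    then have "eventually (\<lambda>n. dist (((\<lambda>n. f (X (r n))) \<circ> s) n) L < e) sequentially"
      using s(2) e(1) by (simp add: tendsto_iff)
    then show False using r(2) by (auto simp: eventually_sequentially)
  qed
qed

lemma curve_zr_deriv:
  assumes "k \<noteq> 0" "x \<noteq> 1"
  shows "(curve_zr k has_real_derivative ((2 * x + 1) * (1 - x)\<^sup>2 - (1 - k)) / (k * (1 - x)\<^sup>2)) (at x)"
proof -
  have "((\<lambda>x. x * (k - x\<^sup>2) / (k * (1 - x))) has_real_derivative
      ((k - 3 * x\<^sup>2) * (k * (1 - x)) - x * (k - x\<^sup>2) * (- k)) / (k * (1 - x))\<^sup>2) (at x)"
    using assms by (auto intro!: derivative_eq_intros simp: power2_eq_square algebra_simps)
  moreover have "((k - 3 * x\<^sup>2) * (k * (1 - x)) - x * (k - x\<^sup>2) * (- k)) / (k * (1 - x))\<^sup>2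
      = ((2 * x + 1) * (1 - x)\<^sup>2 - (1 - k)) / (k * (1 - x)\<^sup>2)"
  proof -
    have "(k - 3 * x\<^sup>2) * (k * (1 - x)) - x * (k - x\<^sup>2) * (- k) = k * ((2 * x + 1) * (1 - x)\<^sup>2 - (1 - k))"
      by algebra
    moreover have "(k * (1 - x))\<^sup>2 = k * (k * (1 - x)\<^sup>2)" by algebra
    ultimately show ?thesis using assms by simp
  qed
  ultimately show ?thesis unfolding curve_zr_def[abs_def] by simp
qed

text \<open>The critical points are never computed: what enters is their position relative to -1/2,
  0 and 1 and the factorization of the derivative of z, with k = 1 - c.\<close>

locale spectral_curve =
  fixes k Xa Xb Xc :: real
  assumes k: "0 < k" "k < 1"
    and crit: "-1/2 < Xa" "Xa < 0" "0 < Xb" "Xb < 1" "1 < Xc"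
    and crit_poly: "\<And>x. (2 * x + 1) * (1 - x)\<^sup>2 - (1 - k) = 2 * ((x - Xa) * ((x - Xb) * (x - Xc)))"
begin

text \<open>By \<open>Im_curve_z\<close>, for Im q > 0 the condition says that Im z <= 0, and for
  real q other than 1 it says that the derivative of z at q is at most 0. The inequality is not
  strict so that it survives limits.\<close>

definition region :: "complex \<Rightarrow> bool" where
  "region q \<longleftrightarrow> (2 * Re q + 1) * (cmod (1 - q))\<^sup>2 \<le> 1 - k"

text \<open>\<open>K0\<close> and \<open>K2\<close> contain the closures of the images of the lower half plane under the branches \<open>q\<^sub>0\<close>
  and \<open>q\<^sub>2\<close>. A real \<open>z\<close> has at most one root in each of them, so that it is the boundary value of the
  branch.\<close>
definition K0 :: "complex set" where "K0 = {q. 0 \<le> Im q \<and> 0 \<le> Re q \<and> region q}"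
definition K2 :: "complex set" where "K2 = {q. 0 \<le> Im q \<and> Re q \<le> 0 \<and> region q}"

text \<open>On the imaginary axis |1 - q|^2 >= 1 > 1 - k. The axis therefore separates
  \<open>K0\<close> from \<open>K2\<close>, and a branch cannot pass from one to the other.\<close>

lemma region_Re_nonzero: "region q \<Longrightarrow> Re q \<noteq> 0"
proof
  assume r: "region q" and 0: "Re q = 0"
  have "(cmod (1 - q))\<^sup>2 = 1 + (Im q)\<^sup>2" using 0 by (simp add: cmod_power2)
  then have "1 + (Im q)\<^sup>2 \<le> 1 - k" using r 0 by (simp add: region_def)
  then show False using k zero_le_power2[of "Im q"] by linarith
qed

lemma closed_K: "closed K0" "closed K2"
proof -
  have "K0 = {q. 0 \<le> Im q} \<inter> {q. 0 \<le> Re q} \<inter> {q. (2 * Re q + 1) * (cmod (1 - q))\<^sup>2 \<le> 1 - k}"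
    by (auto simp: K0_def region_def)
  then show "closed K0" by (auto intro!: closed_Int closed_Collect_le continuous_intros)
  have "K2 = {q. 0 \<le> Im q} \<inter> {q. Re q \<le> 0} \<inter> {q. (2 * Re q + 1) * (cmod (1 - q))\<^sup>2 \<le> 1 - k}"
    by (auto simp: K2_def region_def)
  then show "closed K2" by (auto intro!: closed_Int closed_Collect_le continuous_intros)
qed

lemma region_real_iff: "region (of_real x) \<longleftrightarrow> (x - Xa) * ((x - Xb) * (x - Xc)) \<le> 0"
proof -
  have "(cmod (1 - of_real x))\<^sup>2 = (1 - x)\<^sup>2" by (simp add: cmod_power2)
  then have "region (of_real x) \<longleftrightarrow> (2 * x + 1) * (1 - x)\<^sup>2 - (1 - k) \<le> 0" by (simp add: region_def)
  then show ?thesis by (simp add: crit_poly)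
qed

lemma K0_real: "of_real x \<in> K0 \<longleftrightarrow> Xb \<le> x \<and> x \<le> Xc"
proof
  assume "of_real x \<in> K0"
  then have x: "0 \<le> x" "(x - Xa) * ((x - Xb) * (x - Xc)) \<le> 0" by (auto simp: K0_def region_real_iff)
  have "x - Xa > 0" using x crit by simp
  then have "(x - Xb) * (x - Xc) \<le> 0" using x(2) by (metis mult_pos_pos not_le)
  then show "Xb \<le> x \<and> x \<le> Xc" using crit by (auto simp: mult_le_0_iff)
next
  assume x: "Xb \<le> x \<and> x \<le> Xc"
  then have "(x - Xa) * ((x - Xb) * (x - Xc)) \<le> 0" using crit by (intro mult_nonneg_nonpos) auto
  then show "of_real x \<in> K0" using x crit by (auto simp: K0_def region_real_iff)
qed

lemma K2_real: "of_real x \<in> K2 \<longleftrightarrow> x \<le> Xa"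
proof
  assume "of_real x \<in> K2"
  then have x: "x \<le> 0" "(x - Xa) * ((x - Xb) * (x - Xc)) \<le> 0" by (auto simp: K2_def region_real_iff)
  have "(x - Xb) * (x - Xc) > 0" using x crit by (intro mult_neg_neg) auto
  then show "x \<le> Xa" using x(2) by (metis mult_pos_pos not_le diff_gt_0_iff_gt)
next
  assume x: "x \<le> Xa"
  then have "(x - Xa) * ((x - Xb) * (x - Xc)) \<le> 0"
    using crit by (intro mult_nonpos_nonneg mult_nonpos_nonpos) auto
  then show "of_real x \<in> K2" using x crit by (auto simp: K2_def region_real_iff)
qed

lemma curve_zr_strict_decreasing:
  assumes ab: "a < b" and sgn: "\<And>x. a < x \<Longrightarrow> x < b \<Longrightarrow> x < Xa \<or> (Xb < x \<and> x < Xc)" and one: "1 \<notin> {a..b}"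
  shows "curve_zr k b < curve_zr k a"
proof (rule DERIV_neg_imp_decreasing_open[OF ab])
  fix x assume x: "a < x" "x < b"
  then have x1: "x \<noteq> 1" using one by auto
  have "(x - Xa) * ((x - Xb) * (x - Xc)) < 0"
    using sgn[OF x]
  proof
    assume "x < Xa" then show ?thesis using crit by (intro mult_neg_pos mult_neg_neg) auto
  next
    assume "Xb < x \<and> x < Xc" then show ?thesis using crit by (intro mult_pos_neg) auto
  qed
  moreover have "k * (1 - x)\<^sup>2 > 0" using x1 k by simp
  ultimately have "((2 * x + 1) * (1 - x)\<^sup>2 - (1 - k)) / (k * (1 - x)\<^sup>2) < 0"
    unfolding crit_poly by (intro divide_neg_pos) auto
  then show "\<exists>y. (curve_zr k has_real_derivative y) (at x) \<and> y < 0"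
    using curve_zr_deriv[of k x] x1 k by auto
next
  show "continuous_on {a..b} (curve_zr k)"
    unfolding curve_zr_def using one k by (intro continuous_intros) auto
qed

lemma curve_zr_strict_increasing:
  assumes ab: "a < b" and sgn: "\<And>x. a < x \<Longrightarrow> x < b \<Longrightarrow> (Xa < x \<and> x < Xb) \<or> Xc < x" and one: "1 \<notin> {a..b}"
  shows "curve_zr k a < curve_zr k b"
proof (rule DERIV_pos_imp_increasing_open[OF ab])
  fix x assume x: "a < x" "x < b"
  then have x1: "x \<noteq> 1" using one by auto
  have "(x - Xa) * ((x - Xb) * (x - Xc)) > 0"
    using sgn[OF x]
  proof
    assume "Xa < x \<and> x < Xb" then show ?thesis using crit by (intro mult_pos_pos mult_neg_neg) auto
  next
    assume "Xc < x" then show ?thesis using crit by (intro mult_pos_pos) auto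
  qed
  moreover have "k * (1 - x)\<^sup>2 > 0" using x1 k by simp
  ultimately have "((2 * x + 1) * (1 - x)\<^sup>2 - (1 - k)) / (k * (1 - x)\<^sup>2) > 0"
    unfolding crit_poly by (intro divide_pos_pos) auto
  then show "\<exists>y. (curve_zr k has_real_derivative y) (at x) \<and> 0 < y"
    using curve_zr_deriv[of k x] x1 k by auto
next
  show "continuous_on {a..b} (curve_zr k)"
    unfolding curve_zr_def using one k by (intro continuous_intros) auto
qed

section \<open>Roots of the cubic over real points\<close>

lemma cubic_real_iff:
  assumes "x \<noteq> 1"
  shows "curve_cubic k (of_real z) (of_real x) = 0 \<longleftrightarrow> curve_zr k x = z"
  using curve_cubic_iff[of k "of_real x" "of_real z"] k assms
  by (metis curve_z_of_real of_real_eq_1_iff of_real_eq_iff order_less_irrefl)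

lemma cubic_root_ne_1: "curve_cubic k z q = 0 \<Longrightarrow> q \<noteq> 1"
  using curve_cubic_one[of k z] k by (metis eq_iff_diff_eq_0 of_real_1 of_real_eq_iff order_less_irrefl)

lemma cubic_nonreal_roots:
  assumes "curve_cubic k (of_real x) q = 0" "Im q \<noteq> 0" "curve_cubic k (of_real x) p = 0"
  shows "p = q \<or> p = cnj q \<or> p = - (2 * of_real (Re q))"
proof -
  have c: "curve_cubic k (of_real x) (cnj q) = 0" using assms(1) by (simp add: curve_cubic_conj)
  have "q \<noteq> cnj q" using assms(2) by (auto simp: complex_eq_iff)
  from curve_cubic_factor[OF assms(1) c this, of p] assms(3)
  have "(p - q) * (p - cnj q) * (p + q + cnj q) = 0" by simp
  moreover have "p + q + cnj q = p + 2 * of_real (Re q)" by (simp add: complex_eq_iff)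
  ultimately show ?thesis by (auto simp: eq_neg_iff_add_eq_0)
qed

lemma cubic_two_real_roots:
  assumes "curve_cubic k (of_real x) (of_real p) = 0" "curve_cubic k (of_real x) (of_real q) = 0" "p \<noteq> q"
  shows "(1 - p) * (1 - q) * (1 + p + q) = 1 - k"
proof -
  have "complex_of_real ((1 - p) * (1 - q) * (1 + p + q)) = of_real (1 - k)"
    using curve_cubic_factor[OF assms(1,2), of 1] assms(3) by (simp add: curve_cubic_one)
  then show ?thesis by (simp only: of_real_eq_iff)
qed

text \<open>The three alternatives are intervals on which z strictly decreases: the real points of
  \<open>K2\<close>, and those of \<open>K0\<close> cut at the pole 1.\<close>

lemma curve_zr_inj:
  assumes eq: "curve_zr k a = curve_zr k b"
    and ab: "a \<le> Xa \<and> b \<le> Xa \<or> Xb \<le> a \<and> a < 1 \<and> Xb \<le> b \<and> b < 1 \<or> 1 < a \<and> a \<le> Xc \<and> 1 < b \<and> b \<le> Xc"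
  shows "a = b"
proof -
  have key: "curve_zr k v < curve_zr k u" if uv: "u < v" and d: "v \<le> Xa \<or> Xb \<le> u \<and> v < 1 \<or> 1 < u \<and> v \<le> Xc" for u v
  proof (rule curve_zr_strict_decreasing[OF uv])
    show "x < Xa \<or> Xb < x \<and> x < Xc" if "u < x" "x < v" for x using d that crit by argo
    show "1 \<notin> {u..v}" unfolding atLeastAtMost_iff using d crit uv by argo
  qed
  have "\<not> a < b" using key[of a b] eq ab by argo
  moreover have "\<not> b < a" using key[of b a] eq ab by argo
  ultimately show ?thesis by argo
qed

text \<open>The roots of the cubic sum to \<open>0\<close>. If one of them is not real, the others are its conjugate and a
  real root whose sign is opposite to its real part.\<close>
lemma root_unique:
  assumes K: "\<And>q. q \<in> K \<Longrightarrow> 0 \<le> Im q \<and> region q" "\<And>p q. p \<in> K \<Longrightarrow> q \<in> K \<Longrightarrow> 0 \<le> Re p * Re q"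
    and real: "\<And>a b. of_real a \<in> K \<Longrightarrow> of_real b \<in> K \<Longrightarrow> curve_cubic k (of_real x) (of_real a) = 0 \<Longrightarrow>
      curve_cubic k (of_real x) (of_real b) = 0 \<Longrightarrow> a = b"
    and pq: "p \<in> K" "q \<in> K" "curve_cubic k (of_real x) p = 0" "curve_cubic k (of_real x) q = 0"
  shows "p = q"
proof -
  have nonreal: "p' = q'" if "p' \<in> K" "q' \<in> K" "curve_cubic k (of_real x) p' = 0" "curve_cubic k (of_real x) q' = 0" "Im q' \<noteq> 0" for p' q'
    using cubic_nonreal_roots[OF that(4,5,3)]
  proof (elim disjE)
    assume "p' = cnj q'"
    then have "Im p' = - Im q'" by simp
    then show ?thesis using that(5) K(1)[OF that(1)] K(1)[OF that(2)] by linarith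
  next
    assume "p' = - (2 * of_real (Re q'))"
    then have "0 \<le> - (2 * (Re q' * Re q'))" using K(2)[OF that(1,2)] by simp
    then have "Re q' * Re q' = 0" using zero_le_square[of "Re q'"] by linarith
    then have "Re q' = 0" by simp
    then show ?thesis using region_Re_nonzero[of q'] K(1)[OF that(2)] by simp
  qed auto
  show ?thesis
  proof (cases "Im p = 0 \<and> Im q = 0")
    case False
    then show ?thesis using nonreal pq by metis
  next
    case True
    then obtain a b where "p = of_real a" "q = of_real b" by (metis complex_is_Real_iff Reals_cases)
    then show ?thesis using real[of a b] pq by simp
  qed
qed

text \<open>Monotonicity of z does not compare the two sides of the pole 1. There the relation (1 -
  a) (1 - b) (1 + a + b) = 1 - k > 0 helps: its last factor is positive, so two distinct real roots
  in \<open>K0\<close> would lie on the same side of the pole.\<close>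

lemma K0_unique:
  assumes "p \<in> K0" "q \<in> K0" "curve_cubic k (of_real x) p = 0" "curve_cubic k (of_real x) q = 0"
  shows "p = q"
proof (rule root_unique[OF _ _ _ assms])
  show "0 \<le> Im q \<and> region q" if "q \<in> K0" for q using that by (simp add: K0_def)
  show "0 \<le> Re p * Re q" if "p \<in> K0" "q \<in> K0" for p q using that by (simp add: K0_def)
next
  fix a b :: real
  assume a: "of_real a \<in> K0" "curve_cubic k (of_real x) (of_real a) = 0"
    and b: "of_real b \<in> K0" "curve_cubic k (of_real x) (of_real b) = 0"
  have r: "Xb \<le> a" "a \<le> Xc" "Xb \<le> b" "b \<le> Xc" using a b K0_real by auto
  have 1: "a \<noteq> 1" "b \<noteq> 1" using a b cubic_root_ne_1 by (metis of_real_1)+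
  have z: "curve_zr k a = curve_zr k b" using a b 1 by (simp add: cubic_real_iff)
  show "a = b"
  proof (rule ccontr)
    assume ne: "a \<noteq> b"
    have two: "(1 - a) * (1 - b) * (1 + a + b) = 1 - k" by (rule cubic_two_real_roots[OF a(2) b(2) ne])
    have "0 < 1 + a + b" using r crit by linarith
    moreover have "0 < (1 - a) * (1 - b) * (1 + a + b)" unfolding two using k by simp
    ultimately have pos: "0 < (1 - a) * (1 - b)" by (rule zero_less_mult_pos2[rotated])
    have "a < 1 \<longleftrightarrow> b < 1" using pos by (auto simp: zero_less_mult_iff)
    then have "Xb \<le> a \<and> a < 1 \<and> Xb \<le> b \<and> b < 1 \<or> 1 < a \<and> a \<le> Xc \<and> 1 < b \<and> b \<le> Xc"
      using r 1 by (cases "a < 1") simp_all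
    then show False using curve_zr_inj[OF z] ne by blast
  qed
qed

lemma K2_unique:
  assumes "p \<in> K2" "q \<in> K2" "curve_cubic k (of_real x) p = 0" "curve_cubic k (of_real x) q = 0"
  shows "p = q"
proof (rule root_unique[OF _ _ _ assms])
  show "0 \<le> Im q \<and> region q" if "q \<in> K2" for q using that by (simp add: K2_def)
  show "0 \<le> Re p * Re q" if "p \<in> K2" "q \<in> K2" for p q using that by (simp add: K2_def mult_nonpos_nonpos)
next
  fix a b :: real
  assume a: "of_real a \<in> K2" "curve_cubic k (of_real x) (of_real a) = 0"
    and b: "of_real b \<in> K2" "curve_cubic k (of_real x) (of_real b) = 0"
  have r: "a \<le> Xa" "b \<le> Xa" using a b K2_real by auto
  then have "a \<noteq> 1" "b \<noteq> 1" using crit by linarith+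
  then have "curve_zr k a = curve_zr k b" using a b by (simp add: cubic_real_iff)
  then show "a = b" by (rule curve_zr_inj) (use r in blast)
qed

text \<open>Along any approach to x the root stays bounded, and each limit point lies in K and
  solves the cubic over x; uniqueness leaves one candidate. The argument covers the critical values
  as well, where two roots collide.\<close>

lemma boundary_root_limit:
  assumes K: "closed K"
    and uniq: "\<And>p q. p \<in> K \<Longrightarrow> q \<in> K \<Longrightarrow> curve_cubic k (of_real x) p = 0 \<Longrightarrow> curve_cubic k (of_real x) q = 0 \<Longrightarrow> p = q"
    and f: "\<And>z. Im z < 0 \<Longrightarrow> f z \<in> K \<and> curve_cubic k z (f z) = 0"
  obtains L where "L \<in> K" "curve_cubic k (of_real x) L = 0" "(f \<longlongrightarrow> L) (at (of_real x) within {z. Im z < 0})"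
proof -
  have bd: "bounded (range (\<lambda>n. f (X n)))" if X: "\<And>n. Im (X n) < 0" "X \<longlonglongrightarrow> of_real x" for X :: "nat \<Rightarrow> complex"
  proof -
    obtain B where B: "\<And>n. norm (X n) \<le> B"
      using convergent_imp_bounded[OF X(2)] by (auto simp: bounded_iff)
    have "norm (f (X n)) \<le> 1 + 2 * B" for n
      using curve_cubic_root_bound[OF k, of "X n" "f (X n)"] f[OF X(1)[of n]] B[of n] by auto
    then show ?thesis by (auto simp: bounded_iff)
  qed
  have lim: "l \<in> K \<and> curve_cubic k (of_real x) l = 0"
    if X: "\<And>n. Im (X n) < 0" "X \<longlonglongrightarrow> of_real x" "(\<lambda>n. f (X n)) \<longlonglongrightarrow> l" for X :: "nat \<Rightarrow> complex" and l
  proof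
    show "l \<in> K" by (rule closed_sequentially[OF K _ X(3)]) (use f X(1) in blast)
    have "(\<lambda>n. curve_cubic k (X n) (f (X n))) \<longlonglongrightarrow> curve_cubic k (of_real x) l"
      unfolding curve_cubic_def by (intro tendsto_intros X)
    then show "curve_cubic k (of_real x) l = 0" using f X(1) by (simp add: LIMSEQ_const_iff)
  qed
  define X where "X = (\<lambda>n. Complex x (- (1 / Suc n)))"
  have X: "\<And>n. Im (X n) < 0" by (simp add: X_def)
  have "(\<lambda>n. Complex x (- (1 / Suc n))) \<longlonglongrightarrow> Complex x (- 0)"
    by (intro tendsto_Complex tendsto_const tendsto_minus LIMSEQ_Suc[OF lim_1_over_n])
  then have Xl: "X \<longlonglongrightarrow> of_real x" by (simp add: complex_of_real_def X_def)
  obtain l s where s: "strict_mono s" "((\<lambda>n. f (X n)) \<circ> s) \<longlonglongrightarrow> l"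
    using bounded_imp_convergent_subsequence[OF bd[OF X Xl]] by blast
  have l: "l \<in> K \<and> curve_cubic k (of_real x) l = 0"
    by (rule lim[of "X \<circ> s"]) (use X s LIMSEQ_subseq_LIMSEQ[OF Xl s(1)] in \<open>auto simp: o_def\<close>)
  have "(f \<longlongrightarrow> l) (at (of_real x) within {z. Im z < 0})"
  proof (rule compact_limit_unique)
    fix Y l' assume "\<And>n. Y n \<in> {z. Im z < 0}" "Y \<longlonglongrightarrow> complex_of_real x" "(\<lambda>n. f (Y n)) \<longlonglongrightarrow> l'"
    then show "l' = l" using lim[of Y l'] l uniq by auto
  next
    fix Y assume "\<And>n. Y n \<in> {z. Im z < 0}" "Y \<longlonglongrightarrow> complex_of_real x"
    then show "bounded (range (\<lambda>n. f (Y n)))" using bd[of Y] by auto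
  qed
  then show thesis using that l by blast
qed

end

section \<open>The sheets over the real axis\<close>

text \<open>The factor t removes the singularity. This is what makes \<open>potr\<close> continuous
  across the zeros and the pole of phi.\<close>

lemma isCont_mult_ln_abs: "isCont (\<lambda>t::real. t * ln \<bar>t\<bar>) x"
proof (cases "x = 0")
  case True
  have r: "((\<lambda>t::real. t * ln \<bar>t\<bar>) \<longlongrightarrow> 0) (at_right 0)" by real_asymp
  have l: "((\<lambda>t::real. t * ln \<bar>t\<bar>) \<longlongrightarrow> 0) (at_left 0)" by real_asymp
  show ?thesis using filterlim_split_at[OF l r] True by (simp add: isCont_def)
qed (auto intro!: continuous_intros)

context spectral_curve
begin

definition phir :: "real \<Rightarrow> real" where "phir x = (x\<^sup>2 - k) / ((1 - k) * x\<^sup>2)"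

definition potr :: "real \<Rightarrow> real" where
  "potr x = curve_zr k x * ln \<bar>phir x\<bar> - 2 * ln \<bar>1 - x\<bar>"

text \<open>This is the function called B in the overview; \<open>potr\<close> is its restriction to
  real q.\<close>

definition pot :: "complex \<Rightarrow> real" where
  "pot q = Re (curve_z k q) * ln (cmod (curve_phi k q)) - 2 * ln (cmod (1 - q))"

lemma curve_phi_of_real: "curve_phi k (of_real x) = of_real (phir x)"
  by (simp add: curve_phi_def phir_def)

lemma pot_of_real: "pot (of_real x) = potr x"
proof -
  have "cmod (1 - of_real x) = \<bar>1 - x\<bar>" by (metis norm_of_real of_real_1 of_real_diff)
  then show ?thesis by (simp add: pot_def potr_def curve_z_of_real curve_phi_of_real)
qed

lemma pot_cnj: "pot (cnj q) = pot q"
proof -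
  have "curve_z k (cnj q) = cnj (curve_z k q)" "curve_phi k (cnj q) = cnj (curve_phi k q)" "cmod (1 - cnj q) = cmod (1 - q)"
    by (simp_all add: curve_z_def curve_phi_def) (metis complex_cnj_diff complex_cnj_one complex_mod_cnj)
  then show ?thesis by (simp add: pot_def)
qed

text \<open>ln |phi| is singular at q = 0 and at q^2 = k, and these are exactly the zeros of z. The
  formula can therefore be rearranged so that the singular logarithms occur only in x ln |x| and (k
  - x^2) ln |k - x^2|. At the exceptional points themselves both forms reduce to the last
  term.\<close>

lemma continuous_on_potr:
  assumes "1 \<notin> S"
  shows "continuous_on S potr"
proof -
  have eq: "potr x = x / (k * (1 - x)) * ((k - x\<^sup>2) * ln \<bar>k - x\<^sup>2\<bar>) - curve_zr k x * ln (1 - k)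
      - 2 * (k - x\<^sup>2) / (k * (1 - x)) * (x * ln \<bar>x\<bar>) - 2 * ln \<bar>1 - x\<bar>" if "x \<in> S" for x
  proof (cases "x = 0 \<or> k - x\<^sup>2 = 0")
    case True then show ?thesis by (auto simp: potr_def curve_zr_def)
  next
    case False
    then have p: "\<bar>x\<bar> > 0" "\<bar>k - x\<^sup>2\<bar> > 0" by auto
    have "\<bar>phir x\<bar> = \<bar>k - x\<^sup>2\<bar> / ((1 - k) * \<bar>x\<bar>\<^sup>2)"
    proof -
      have "\<bar>x\<^sup>2 - k\<bar> = \<bar>k - x\<^sup>2\<bar>" by (rule abs_minus_commute)
      moreover have "\<bar>(1 - k) * x\<^sup>2\<bar> = (1 - k) * \<bar>x\<bar>\<^sup>2" using k by (simp add: abs_mult)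
      ultimately show ?thesis unfolding phir_def abs_divide by (simp only:)
    qed
    also have "ln \<dots> = ln \<bar>k - x\<^sup>2\<bar> - (ln (1 - k) + ln (\<bar>x\<bar>\<^sup>2))"
    proof -
      have q: "1 - k > 0" "\<bar>x\<bar>\<^sup>2 > 0" using p(1) k by (simp_all only: zero_less_power diff_gt_0_iff_gt)
      show ?thesis by (simp only: ln_divide_pos[OF p(2) mult_pos_pos[OF q]] ln_mult_pos[OF q])
    qed
    also have "ln (\<bar>x\<bar>\<^sup>2) = 2 * ln \<bar>x\<bar>" using ln_realpow[of "\<bar>x\<bar>" 2] by simp
    finally have L: "ln \<bar>phir x\<bar> = ln \<bar>k - x\<^sup>2\<bar> - (ln (1 - k) + 2 * ln \<bar>x\<bar>)" .
    have "x * w * i * (A - (B + 2 * C)) = x * i * (w * A) - x * w * i * B - 2 * w * i * (x * C)" for w A B C i :: real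
      by (simp add: algebra_simps)
    note ident = this
    show ?thesis unfolding potr_def curve_zr_def L divide_inverse by (simp only: ident)
  qed
  have 1: "continuous_on S (\<lambda>x::real. x * ln \<bar>x\<bar>)"
    by (intro continuous_at_imp_continuous_on ballI isCont_mult_ln_abs)
  have 2: "continuous_on S (\<lambda>x::real. (k - x\<^sup>2) * ln \<bar>k - x\<^sup>2\<bar>)"
  proof (intro continuous_at_imp_continuous_on ballI)
    fix x
    have "isCont (\<lambda>x. k - x\<^sup>2) x" by (intro continuous_intros)
    then show "isCont (\<lambda>x. (k - x\<^sup>2) * ln \<bar>k - x\<^sup>2\<bar>) x" by (rule isCont_o2[OF _ isCont_mult_ln_abs])
  qed
  have nz: "k * (1 - x) \<noteq> 0" "\<bar>1 - x\<bar> \<noteq> 0" if "x \<in> S" for x using that assms k by auto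
  have 3: "continuous_on S (curve_zr k)" "continuous_on S (\<lambda>x. x / (k * (1 - x)))"
      "continuous_on S (\<lambda>x. 2 * (k - x\<^sup>2) / (k * (1 - x)))" "continuous_on S (\<lambda>x. 2 * ln \<bar>1 - x\<bar>)"
      "continuous_on S (\<lambda>x. ln (1 - k))"
    unfolding curve_zr_def by (intro continuous_intros ballI nz; assumption)+
  show ?thesis
    by (subst continuous_on_cong[OF refl eq], assumption)
      (intro continuous_on_diff continuous_on_mult[OF 3(2) 2] continuous_on_mult[OF 3(1) 3(5)]
        continuous_on_mult[OF 3(3) 1] 3(4))
qed

text \<open>On the curve \<open>z d\<phi>/\<phi> = 2 d(ln (1 - q))\<close>, hence \<open>d(z ln \<phi> - 2 ln (1 - q)) = ln \<phi> dz\<close>.\<close>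
lemma potr_deriv:
  assumes x: "x \<noteq> 0" "x \<noteq> 1" "x\<^sup>2 \<noteq> k"
  shows "(potr has_real_derivative
    2 * ((x - Xa) * ((x - Xb) * (x - Xc))) / (k * (1 - x)\<^sup>2) * ln \<bar>phir x\<bar>) (at x)"
proof -
  have p0: "phir x \<noteq> 0" using x k by (simp add: phir_def)
  have dphi: "(phir has_real_derivative (2 * k / ((1 - k) * x ^ 3))) (at x)"
  proof -
    have 1: "((\<lambda>x. x\<^sup>2 - k) has_real_derivative 2 * x) (at x)"
      by (auto intro!: derivative_eq_intros)
    have 2: "((\<lambda>x. (1 - k) * x\<^sup>2) has_real_derivative (1 - k) * (2 * x)) (at x)"
      by (auto intro!: derivative_eq_intros)
    have nz: "(1 - k) * x\<^sup>2 \<noteq> 0" "(1 - k) * x \<noteq> 0" using x k by auto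
    note DERIV_divide[OF 1 2 nz(1)]
    also have "(2 * x * ((1 - k) * x\<^sup>2) - (x\<^sup>2 - k) * ((1 - k) * (2 * x))) / ((1 - k) * x\<^sup>2 * ((1 - k) * x\<^sup>2)) = 2 * k / ((1 - k) * x ^ 3)"
    proof -
      have a: "2 * x * ((1 - k) * x\<^sup>2) - (x\<^sup>2 - k) * ((1 - k) * (2 * x)) = (2 * k) * ((1 - k) * x)"
        by (simp add: algebra_simps power2_eq_square)
      have b: "(1 - k) * x\<^sup>2 * ((1 - k) * x\<^sup>2) = ((1 - k) * x ^ 3) * ((1 - k) * x)"
        by (simp add: power2_eq_square power3_eq_cube mult_ac)
      show ?thesis unfolding a b by (rule mult_divide_mult_cancel_right[OF nz(2)])
    qed
    finally show ?thesis unfolding phir_def[abs_def] .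
  qed
  have cphi: "(phir \<longlongrightarrow> phir x) (nhds x)"
    using DERIV_isCont[OF dphi] unfolding isCont_def tendsto_at_iff_tendsto_nhds .
  have dln: "((\<lambda>x. ln \<bar>phir x\<bar>) has_real_derivative (2 * k / ((1 - k) * x ^ 3) / phir x)) (at x)"
  proof (cases "phir x > 0")
    case True
    have d: "((\<lambda>x. ln (phir x)) has_real_derivative (2 * k / ((1 - k) * x ^ 3) / phir x)) (at x)"
      by (rule DERIV_cong[OF DERIV_chain2[OF DERIV_ln[OF True] dphi]]) (simp only: divide_inverse mult.commute)
    have "eventually (\<lambda>y. phir y > 0) (nhds x)"
      by (rule order_tendstoD(1)[OF cphi True])
    then have ev: "eventually (\<lambda>y. ln (phir y) = ln \<bar>phir y\<bar>) (nhds x)" by eventually_elim auto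
    show ?thesis by (rule DERIV_cong_ev[OF refl ev refl, THEN iffD1, OF d])
  next
    case False
    then have f: "phir x < 0" using p0 by simp
    have d: "((\<lambda>x. ln (- phir x)) has_real_derivative (2 * k / ((1 - k) * x ^ 3) / phir x)) (at x)"
    proof -
      have "0 < - phir x" using f by simp
      from DERIV_chain2[OF DERIV_ln[OF this] DERIV_minus[OF dphi]] show ?thesis
        by (rule DERIV_cong) (simp only: divide_inverse inverse_minus_eq minus_mult_minus mult.commute)
    qed
    have "eventually (\<lambda>y. phir y < 0) (nhds x)"
      by (rule order_tendstoD(2)[OF cphi f])
    then have ev: "eventually (\<lambda>y. ln (- phir y) = ln \<bar>phir y\<bar>) (nhds x)" by eventually_elim auto
    show ?thesis by (rule DERIV_cong_ev[OF refl ev refl, THEN iffD1, OF d])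
  qed
  have dl1: "((\<lambda>x. ln \<bar>1 - x\<bar>) has_real_derivative (- 1 / (1 - x))) (at x)"
  proof (cases "x < 1")
    case True
    have d: "((\<lambda>x. ln (1 - x)) has_real_derivative (- 1 / (1 - x))) (at x)"
      using True by (auto intro!: derivative_eq_intros)
    have "eventually (\<lambda>y. y < 1) (nhds x)" using True eventually_nhds_in_open[of "{..<1}" x] by auto
    then have ev: "eventually (\<lambda>y. ln (1 - y) = ln \<bar>1 - y\<bar>) (nhds x)" by eventually_elim auto
    show ?thesis by (rule DERIV_cong_ev[OF refl ev refl, THEN iffD1, OF d])
  next
    case False
    then have g: "x > 1" using x by simp
    have d: "((\<lambda>x. ln (x - 1)) has_real_derivative (- 1 / (1 - x))) (at x)"
      using g by (auto intro!: derivative_eq_intros simp: field_simps)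
    have "eventually (\<lambda>y. y > 1) (nhds x)" using g eventually_nhds_in_open[of "{1<..}" x] by auto
    then have ev: "eventually (\<lambda>y. ln (y - 1) = ln \<bar>1 - y\<bar>) (nhds x)" by eventually_elim auto
    show ?thesis by (rule DERIV_cong_ev[OF refl ev refl, THEN iffD1, OF d])
  qed
  have z0: "curve_zr k x * (2 * k / ((1 - k) * x ^ 3) / phir x) - 2 * (- 1 / (1 - x)) = 0"
  proof -
    have n: "k \<noteq> 0" "1 - k \<noteq> 0" "1 - x \<noteq> 0" "x\<^sup>2 - k \<noteq> 0" "x \<noteq> 0" using x k by auto
    have "2 * k / ((1 - k) * x ^ 3) / phir x = 2 * k / (x * (x\<^sup>2 - k))"
    proof -
      have "2 * k / ((1 - k) * x ^ 3) / phir x = (2 * k * ((1 - k) * x\<^sup>2)) / ((1 - k) * x ^ 3 * (x\<^sup>2 - k))"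
        unfolding phir_def by simp
      also have "(1 - k) * x ^ 3 * (x\<^sup>2 - k) = (x * (x\<^sup>2 - k)) * ((1 - k) * x\<^sup>2)" by algebra
      finally show ?thesis using n by simp
    qed
    also have "curve_zr k x * \<dots> = - 2 / (1 - x)"
    proof -
      have "curve_zr k x * (2 * k / (x * (x\<^sup>2 - k))) = (x * (k - x\<^sup>2) * (2 * k)) / (k * (1 - x) * (x * (x\<^sup>2 - k)))"
        unfolding curve_zr_def by (simp only: times_divide_times_eq)
      also have "x * (k - x\<^sup>2) * (2 * k) = (- 2) * (k * x * (x\<^sup>2 - k))" by algebra
      also have "k * (1 - x) * (x * (x\<^sup>2 - k)) = (1 - x) * (k * x * (x\<^sup>2 - k))" by algebra
      finally show ?thesis using n by (subst (asm) mult_divide_mult_cancel_right) auto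
    qed
    finally show ?thesis by simp
  qed
  have "(potr has_real_derivative
      (((2 * x + 1) * (1 - x)\<^sup>2 - (1 - k)) / (k * (1 - x)\<^sup>2) * ln \<bar>phir x\<bar>
        + 2 * k / ((1 - k) * x ^ 3) / phir x * curve_zr k x - 2 * (- 1 / (1 - x)))) (at x)"
    unfolding potr_def[abs_def]
    by (intro DERIV_diff DERIV_mult DERIV_cmult curve_zr_deriv dln dl1) (use x k in auto)
  then show ?thesis
    by (rule DERIV_cong)
      (unfold crit_poly mult.commute[of "2 * k / ((1 - k) * x ^ 3) / phir x"], use z0 in linarith)
qed

text \<open>Applied with \<open>L\<close> the value of \<open>ln \<bar>phir\<bar>\<close> at a critical point between \<open>a\<close> and \<open>b\<close>, where both factors
  in \<open>sgn\<close> change their sign.\<close>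
lemma potr_shift_mono:
  assumes ab: "a \<le> b" "1 \<notin> {a..b}"
    and x: "\<And>x. a < x \<Longrightarrow> x < b \<Longrightarrow> x \<noteq> 0 \<and> x\<^sup>2 \<noteq> k"
    and sgn: "\<And>x. a < x \<Longrightarrow> x < b \<Longrightarrow> 0 \<le> ((x - Xa) * ((x - Xb) * (x - Xc))) * (ln \<bar>phir x\<bar> - L)"
    and eq: "curve_zr k a = curve_zr k b"
  shows "potr a \<le> potr b"
proof -
  have "potr a - L * curve_zr k a \<le> potr b - L * curve_zr k b"
  proof (rule DERIV_nonneg_imp_increasing_open[OF ab(1)])
    fix t assume t: "a < t" "t < b"
    then have t': "t \<noteq> 0" "t \<noteq> 1" "t\<^sup>2 \<noteq> k" using x ab by auto
    let ?P = "(t - Xa) * ((t - Xb) * (t - Xc))"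
    have "((\<lambda>x. potr x - L * curve_zr k x) has_real_derivative
        2 * ?P / (k * (1 - t)\<^sup>2) * ln \<bar>phir t\<bar> - L * (((2 * t + 1) * (1 - t)\<^sup>2 - (1 - k)) / (k * (1 - t)\<^sup>2))) (at t)"
      by (intro DERIV_diff DERIV_cmult potr_deriv curve_zr_deriv t') (use k in auto)
    moreover have "2 * ?P / (k * (1 - t)\<^sup>2) * ln \<bar>phir t\<bar> - L * (((2 * t + 1) * (1 - t)\<^sup>2 - (1 - k)) / (k * (1 - t)\<^sup>2))
        = 2 * (?P * (ln \<bar>phir t\<bar> - L)) / (k * (1 - t)\<^sup>2)"
      unfolding crit_poly by (simp add: diff_divide_distrib right_diff_distrib mult_ac)
    moreover have "\<dots> \<ge> 0" using k by (intro divide_nonneg_nonneg mult_nonneg_nonneg[of 2, OF _ sgn[OF t]]) auto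
    ultimately show "\<exists>y. ((\<lambda>x. potr x - L * curve_zr k x) has_real_derivative y) (at t) \<and> 0 \<le> y" by auto
  next
    show "continuous_on {a..b} (\<lambda>x. potr x - L * curve_zr k x)"
      unfolding curve_zr_def using ab k by (intro continuous_intros continuous_on_potr) auto
  qed
  then show ?thesis using eq by simp
qed

section \<open>Comparison of \<open>potr\<close> across the critical points\<close>

lemma abs_phir_small:
  assumes "x \<noteq> 0" "x\<^sup>2 < k" 
  shows "\<bar>phir x\<bar> = (k / x\<^sup>2 - 1) / (1 - k)"
proof -
  have "phir x = - ((k / x\<^sup>2 - 1) / (1 - k))" using assms k by (simp add: phir_def field_simps)
  moreover have "(k / x\<^sup>2 - 1) / (1 - k) \<ge> 0" using assms k by (intro divide_nonneg_pos) (auto simp: field_simps)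
  ultimately show ?thesis by (simp only: abs_minus_cancel abs_of_nonneg)
qed

lemma ln_abs_phir_small_mono:
  assumes "x \<noteq> 0" "x\<^sup>2 \<le> y\<^sup>2" "y\<^sup>2 < k"
  shows "ln \<bar>phir y\<bar> \<le> ln \<bar>phir x\<bar>"
proof -
  have y: "y \<noteq> 0" using assms by auto
  have "k / y\<^sup>2 \<le> k / x\<^sup>2" using assms k y by (intro divide_left_mono) auto
  then have "(k / y\<^sup>2 - 1) / (1 - k) \<le> (k / x\<^sup>2 - 1) / (1 - k)" using k by (intro divide_right_mono) auto
  moreover have "0 < (k / y\<^sup>2 - 1) / (1 - k)" using assms k y by (intro divide_pos_pos) (auto simp: field_simps)
  ultimately show ?thesis using assms y by (subst (1 2) abs_phir_small) (auto intro!: ln_mono)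
qed

lemma ln_abs_phir_large_mono:
  assumes "1 < x" "x \<le> y"
  shows "ln \<bar>phir x\<bar> \<le> ln \<bar>phir y\<bar>"
proof -
  have e: "\<bar>phir x\<bar> = (1 - k / x\<^sup>2) / (1 - k)" and p: "0 < (1 - k / x\<^sup>2) / (1 - k)" if "x > 1" for x
  proof -
    have x2: "x\<^sup>2 > 1" using that by (simp add: one_less_power)
    have "k / x\<^sup>2 < 1" by (subst divide_less_eq_1_pos) (use x2 k in linarith)+
    then show p: "0 < (1 - k / x\<^sup>2) / (1 - k)" using k by simp
    have "phir x = (1 - k / x\<^sup>2) / (1 - k)" using that k by (simp add: phir_def field_simps)
    then show "\<bar>phir x\<bar> = (1 - k / x\<^sup>2) / (1 - k)" using p by (simp only: abs_of_pos)
  qed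
  have "x\<^sup>2 \<le> y\<^sup>2" using assms by (intro power_mono) auto
  then have "k / y\<^sup>2 \<le> k / x\<^sup>2" using assms k by (intro divide_left_mono) auto
  then have "(1 - k / x\<^sup>2) / (1 - k) \<le> (1 - k / y\<^sup>2) / (1 - k)" using k by (intro divide_right_mono) auto
  then show ?thesis using assms p[of x] by (subst (1 2) e) (auto intro!: ln_mono)
qed

text \<open>Between \<open>Xa\<close> and \<open>Xb\<close> the function z increases through z(0) =
  0, so it is positive at \<open>Xb\<close> and negative at \<open>Xa\<close>. Either way the factor
  k - x^2 has to be positive.\<close>

lemma Xb_sq: "Xb\<^sup>2 < k" and Xa_sq: "Xa\<^sup>2 < k"
proof -
  have "curve_zr k 0 < curve_zr k Xb" by (rule curve_zr_strict_increasing) (use crit in auto)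
  then have "0 < Xb * (k - Xb\<^sup>2) / (k * (1 - Xb))" by (simp add: curve_zr_def)
  moreover have "0 < k * (1 - Xb)" using crit k by simp
  ultimately have "0 < Xb * (k - Xb\<^sup>2)" by (metis zero_less_divide_iff less_asym)
  then have "0 < k - Xb\<^sup>2" using crit by (metis zero_less_mult_pos)
  then show "Xb\<^sup>2 < k" by simp
  have "curve_zr k Xa < curve_zr k 0" by (rule curve_zr_strict_increasing) (use crit in auto)
  then have "Xa * (k - Xa\<^sup>2) / (k * (1 - Xa)) < 0" by (simp add: curve_zr_def)
  moreover have "0 < k * (1 - Xa)" using crit k by simp
  ultimately have "Xa * (k - Xa\<^sup>2) < 0" by (metis divide_less_0_iff less_asym)
  then have "\<not> k - Xa\<^sup>2 \<le> 0" using crit by (metis mult_nonpos_nonpos less_imp_le not_le)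
  then show "Xa\<^sup>2 < k" by simp
qed

text \<open>Between p and q the modulus of phi decreases, so ln |phi(x)| - ln |phi(Xb)| has the sign
  of Xb - x, and so has the derivative of z.\<close>

lemma potr_across_Xb:
  assumes "0 \<le> p" "p \<le> Xb" "Xb \<le> q" "q\<^sup>2 \<le> k" "curve_zr k p = curve_zr k q"
  shows "potr p \<le> potr q"
proof (rule potr_shift_mono[where L = "ln \<bar>phir Xb\<bar>"])
  have q1: "q < 1"
  proof (rule ccontr)
    assume "\<not> q < 1" then have "1\<^sup>2 \<le> q\<^sup>2" by (intro power_mono) auto
    then show False using assms k by simp
  qed
  show "p \<le> q" "1 \<notin> {p..q}" "curve_zr k p = curve_zr k q" using assms q1 by auto
  fix x assume x: "p < x" "x < q"
  have x2: "x\<^sup>2 < q\<^sup>2" using x assms by (intro power_strict_mono) auto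
  show "x \<noteq> 0 \<and> x\<^sup>2 \<noteq> k" using x x2 assms by auto
  show "0 \<le> ((x - Xa) * ((x - Xb) * (x - Xc))) * (ln \<bar>phir x\<bar> - ln \<bar>phir Xb\<bar>)"
  proof (cases "x \<le> Xb")
    case True
    have "x\<^sup>2 \<le> Xb\<^sup>2" using True x assms by (intro power_mono) auto
    then have "ln \<bar>phir Xb\<bar> \<le> ln \<bar>phir x\<bar>" using x assms Xb_sq by (intro ln_abs_phir_small_mono) auto
    then show ?thesis using True x assms crit by (intro mult_nonneg_nonneg mult_nonpos_nonpos) auto
  next
    case False
    have "Xb\<^sup>2 \<le> x\<^sup>2" using False crit by (intro power_mono) auto
    then have "ln \<bar>phir x\<bar> \<le> ln \<bar>phir Xb\<bar>" using x x2 assms crit by (intro ln_abs_phir_small_mono) auto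
    then show ?thesis using False x q1 assms crit by (intro mult_nonpos_nonpos mult_nonneg_nonpos) auto
  qed
qed

text \<open>Beyond the pole |phi| increases, and both factors have the sign of x - Xc.\<close>

lemma potr_across_Xc:
  assumes "1 < p" "p \<le> Xc" "Xc \<le> q" "curve_zr k p = curve_zr k q"
  shows "potr p \<le> potr q"
proof (rule potr_shift_mono[where L = "ln \<bar>phir Xc\<bar>"])
  show "p \<le> q" "1 \<notin> {p..q}" "curve_zr k p = curve_zr k q" using assms by auto
  fix x assume x: "p < x" "x < q"
  have x2: "x\<^sup>2 > 1" using x assms by (simp add: one_less_power)
  have "x\<^sup>2 \<noteq> k" using x2 k by linarith
  then show "x \<noteq> 0 \<and> x\<^sup>2 \<noteq> k" using x assms by simp
  show "0 \<le> ((x - Xa) * ((x - Xb) * (x - Xc))) * (ln \<bar>phir x\<bar> - ln \<bar>phir Xc\<bar>)"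
  proof (cases "x \<le> Xc")
    case True
    have "ln \<bar>phir x\<bar> \<le> ln \<bar>phir Xc\<bar>" using True x assms by (intro ln_abs_phir_large_mono) auto
    then show ?thesis using True x assms crit by (intro mult_nonpos_nonpos mult_nonneg_nonpos) auto
  next
    case False
    have "ln \<bar>phir Xc\<bar> \<le> ln \<bar>phir x\<bar>" using False crit by (intro ln_abs_phir_large_mono) auto
    then show ?thesis using False x assms crit by (intro mult_nonneg_nonneg) auto
  qed
qed

text \<open>On the negative side |phi| increases towards its pole at 0, and both factors have the
  sign of x - Xa.\<close>

lemma potr_across_Xa:
  assumes "p \<le> Xa" "Xa \<le> q" "q \<le> 0" "p\<^sup>2 \<le> k" "curve_zr k p = curve_zr k q"
  shows "potr p \<le> potr q"
proof (rule potr_shift_mono[where L = "ln \<bar>phir Xa\<bar>"])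
  show "p \<le> q" "1 \<notin> {p..q}" "curve_zr k p = curve_zr k q" using assms by auto
  fix x assume x: "p < x" "x < q"
  have x2: "x\<^sup>2 < p\<^sup>2" using power_strict_mono[of "-x" "-p" 2] x assms by auto
  show "x \<noteq> 0 \<and> x\<^sup>2 \<noteq> k" using x x2 assms by auto
  show "0 \<le> ((x - Xa) * ((x - Xb) * (x - Xc))) * (ln \<bar>phir x\<bar> - ln \<bar>phir Xa\<bar>)"
  proof (cases "x \<le> Xa")
    case True
    have "Xa\<^sup>2 \<le> x\<^sup>2" using power_mono[of "-Xa" "-x" 2] True crit by auto
    then have "ln \<bar>phir x\<bar> \<le> ln \<bar>phir Xa\<bar>" using x x2 assms crit by (intro ln_abs_phir_small_mono) auto
    then show ?thesis using True x assms crit by (intro mult_nonpos_nonpos mult_nonpos_nonneg) auto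
  next
    case False
    have "x\<^sup>2 \<le> Xa\<^sup>2" using power_mono[of "-x" "-Xa" 2] False x assms by auto
    then have "ln \<bar>phir Xa\<bar> \<le> ln \<bar>phir x\<bar>" using x assms Xa_sq by (intro ln_abs_phir_small_mono) auto
    then show ?thesis using False x assms crit by (intro mult_nonneg_nonneg mult_nonpos_nonpos) auto
  qed
qed

end

section \<open>The three sheets over a real point\<close>

context spectral_curve
begin

lemma third_root:
  assumes "curve_cubic k z p = 0" "curve_cubic k z q = 0" "p \<noteq> q"
  shows "curve_cubic k z (- p - q) = 0"
    and "of_real k * (1 + z) = p\<^sup>2 + p * q + q\<^sup>2"
    and "of_real k * z = p * q * (p + q)"
    and "(1 - p) * (1 - q) * (1 + p + q) = 1 - of_real k"
proof -
  note f = curve_cubic_factor[OF assms]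
  show "curve_cubic k z (- p - q) = 0" unfolding f by simp
  show 3: "of_real k * z = p * q * (p + q)" using f[of 0] by (simp add: curve_cubic_def)
  show 4: "(1 - p) * (1 - q) * (1 + p + q) = 1 - of_real k" using f[of 1] by (simp add: curve_cubic_one)
  show "of_real k * (1 + z) = p\<^sup>2 + p * q + q\<^sup>2" using 3 4 by algebra
qed

lemma curve_phi_nonzero:
  assumes "curve_cubic k z q = 0" "z \<noteq> 0"
  shows "curve_phi k q \<noteq> 0" "q \<noteq> 0"
proof -
  show q0: "q \<noteq> 0" using assms k by (auto simp: curve_cubic_def)
  have "q\<^sup>2 - of_real k \<noteq> 0"
  proof
    assume "q\<^sup>2 - of_real k = 0"
    then have "of_real k * z * (1 - q) = 0" using assms(1) unfolding curve_cubic_def by algebra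
    then show False using assms k cubic_root_ne_1[OF assms(1)] by auto
  qed
  then show "curve_phi k q \<noteq> 0" using q0 k by (simp add: curve_phi_def)
qed

lemma pot_eq_at_root:
  assumes "curve_cubic k (of_real x) q = 0"
  shows "pot q = x * ln (cmod (curve_phi k q)) - 2 * ln (cmod (1 - q))"
  using curve_cubic_iff[of k q "of_real x"] k assms cubic_root_ne_1[OF assms] by (simp add: pot_def)

text \<open>Products over the three sheets are constant: that of 1 - q is 1 - k, the value of the
  cubic at 1, and that of phi is sigma^2, up to sign the constant term of the original equation.
  Over x = 0 phi vanishes or has a pole on every sheet, but there its logarithm carries the factor x
  = 0.\<close>

lemma pot_sum:
  assumes pq: "curve_cubic k (of_real x) p = 0" "curve_cubic k (of_real x) q = 0" "p \<noteq> q"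
  shows "pot p + pot q + pot (- p - q) = - 2 * (x + 1) * ln (1 - k)"
proof -
  note t = third_root[OF pq]
  let ?r = "- p - q"
  have one: "p \<noteq> 1" "q \<noteq> 1" "?r \<noteq> 1" using pq t(1) cubic_root_ne_1 by blast+
  have "ln (cmod (1 - p)) + ln (cmod (1 - q)) + ln (cmod (1 - ?r)) = ln (cmod ((1 - p) * (1 - q) * (1 - ?r)))"
    using one by (simp add: norm_mult ln_mult)
  also have "(1 - p) * (1 - q) * (1 - ?r) = of_real (1 - k)" using t(4) by (simp add: algebra_simps)
  also have "cmod (of_real (1 - k)) = 1 - k" using k by (simp only: norm_of_real)
  finally have L1: "ln (cmod (1 - p)) + ln (cmod (1 - q)) + ln (cmod (1 - ?r)) = ln (1 - k)" .
  have L2: "x * (ln (cmod (curve_phi k p)) + ln (cmod (curve_phi k q)) + ln (cmod (curve_phi k ?r))) = - 2 * x * ln (1 - k)"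
  proof (cases "x = 0")
    case False
    then have x: "complex_of_real x \<noteq> 0" by simp
    note nz = curve_phi_nonzero[OF pq(1) x] curve_phi_nonzero[OF pq(2) x] curve_phi_nonzero[OF t(1) x]
    have c1: "1 - complex_of_real k \<noteq> 0" using k by (metis of_real_1 of_real_eq_iff order_less_irrefl right_minus_eq)
    \<comment> \<open>Expressing k by p and q through the two remaining symmetric functions turns
      this into a polynomial identity.\<close>
    have num: "(p\<^sup>2 - of_real k) * (q\<^sup>2 - of_real k) * (?r\<^sup>2 - of_real k) = (1 - of_real k) * (p * q * ?r)\<^sup>2"
    proof -
      have "of_real k = p\<^sup>2 + p * q + q\<^sup>2 - p * q * (p + q)" using t(2,3) by algebra
      then show ?thesis by algebra
    qed
    have "curve_phi k p * curve_phi k q * curve_phi k ?r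
        = ((p\<^sup>2 - of_real k) * (q\<^sup>2 - of_real k) * (?r\<^sup>2 - of_real k)) / ((1 - of_real k) ^ 3 * (p * q * ?r)\<^sup>2)"
      unfolding curve_phi_def times_divide_times_eq
      by (rule arg_cong2[where f = "(/)"]) (simp_all add: power2_eq_square power3_eq_cube mult_ac)
    also have "\<dots> = 1 / (1 - of_real k)\<^sup>2"
      unfolding num using c1 nz by (simp add: power2_eq_square power3_eq_cube)
    also have "\<dots> = of_real (1 / (1 - k)\<^sup>2)" by simp
    finally have prod: "cmod (curve_phi k p * curve_phi k q * curve_phi k ?r) = 1 / (1 - k)\<^sup>2"
      by (simp only: norm_of_real) simp
    have "ln (cmod (curve_phi k p)) + ln (cmod (curve_phi k q)) + ln (cmod (curve_phi k ?r))
        = ln (cmod (curve_phi k p * curve_phi k q * curve_phi k ?r))"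
      using nz by (simp add: norm_mult ln_mult)
    also have "\<dots> = - 2 * ln (1 - k)" unfolding prod using k by (simp add: ln_div ln_realpow)
    finally show ?thesis by simp
  qed simp
  show ?thesis
    unfolding pot_eq_at_root[OF pq(1)] pot_eq_at_root[OF pq(2)] pot_eq_at_root[OF t(1)]
    using L1 L2 by (simp add: algebra_simps)
qed

text \<open>The roots are u, its conjugate and - 2 Re u. Comparing their product with the constant
  term of the cubic shows that x has the sign of Re u.\<close>

lemma middle_root_cnj:
  assumes u: "curve_cubic k (of_real x) u = 0" "Im u \<noteq> 0" and v: "curve_cubic k (of_real x) v = 0" "v \<noteq> u" "v \<noteq> cnj u"
  shows "- u - v = cnj u" and "k * x = 2 * Re u * (cmod u)\<^sup>2"
proof -
  have v': "v = - (2 * of_real (Re u))" using cubic_nonreal_roots[OF u v(1)] v(2,3) by blast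
  then show m: "- u - v = cnj u" by (simp add: complex_eq_iff)
  have "of_real k * of_real x = u * v * (u + v)" by (rule third_root(3)[OF u(1) v(1) v(2)[symmetric]])
  also have "u + v = - (- u - v)" by simp
  also have "\<dots> = - cnj u" by (simp only: m)
  also have "u * v * (- cnj u) = of_real (2 * Re u * (cmod u)\<^sup>2)"
    unfolding v' complex_norm_square of_real_mult by (simp add: mult_ac)
  finally show "k * x = 2 * Re u * (cmod u)\<^sup>2" by (simp only: of_real_mult[symmetric] of_real_eq_iff)
qed

text \<open>If b = - 2 a, then the third root - a - b is a again, so a is a double root and hence a
  critical point of z.\<close>

lemma double_root_critical:
  assumes "(1 - a) * (1 - b) * (1 + a + b) = 1 - k" "b = - 2 * a"
  shows "a = Xa \<or> a = Xb \<or> a = Xc"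
proof -
  have "(2 * a + 1) * (1 - a)\<^sup>2 - (1 - k) = 0"
    using assms(1) unfolding assms(2) by (simp add: power2_eq_square algebra_simps)
  then show ?thesis unfolding crit_poly by simp
qed

text \<open>Here p and q stand for the boundary values over x of the branches q_0 and q_2, and - p -
  q is the root on the middle sheet.\<close>

context
  fixes x :: real and p q :: complex
  assumes p: "p \<in> K0" "curve_cubic k (of_real x) p = 0"
    and q: "q \<in> K2" "curve_cubic k (of_real x) q = 0"
begin

lemma sheets_signs: "Re p > 0" "Re q < 0" "p \<noteq> q"
  using p(1) q(1) region_Re_nonzero[of p] region_Re_nonzero[of q] by (auto simp: K0_def K2_def)

text \<open>Since Re q < 0 < Re p, the sign of x decides which of the two may be nonreal: p only for
  x > 0, and q only for x < 0.\<close>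

lemma middle_root_cnj_p:
  assumes "Im p \<noteq> 0" shows "- p - q = cnj p" "x > 0"
proof -
  have "Re q \<noteq> Re (cnj p)" using sheets_signs by simp
  then have "q \<noteq> cnj p" by blast
  note m = middle_root_cnj[OF p(2) assms q(2) sheets_signs(3)[symmetric] \<open>q \<noteq> cnj p\<close>]
  show "- p - q = cnj p" by (rule m(1))
  have "2 * Re p * (cmod p)\<^sup>2 > 0" using sheets_signs by (intro mult_pos_pos) auto
  then show "x > 0" using m(2) k by (metis zero_less_mult_pos)
qed

lemma middle_root_cnj_q:
  assumes "Im q \<noteq> 0" shows "- p - q = cnj q" "x < 0"
proof -
  have "Re p \<noteq> Re (cnj q)" using sheets_signs by simp
  then have "p \<noteq> cnj q" by blast
  note m = middle_root_cnj[OF q(2) assms p(2) sheets_signs(3) \<open>p \<noteq> cnj q\<close>]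
  show "- p - q = cnj q" using m(1) by (simp only: minus_diff_commute)
  have "2 * Re q * (cmod q)\<^sup>2 < 0"
    by (rule mult_neg_pos) (use sheets_signs in auto)
  then show "x < 0" using m(2) k by (metis mult_less_0_iff less_asym)
qed

lemma pot_middle_eq_p: "Im p \<noteq> 0 \<Longrightarrow> pot (- p - q) = pot p"
  using middle_root_cnj_p pot_cnj by simp

lemma pot_middle_eq_q: "Im q \<noteq> 0 \<Longrightarrow> pot (- p - q) = pot q"
  using middle_root_cnj_q pot_cnj by simp

lemma real_sheets:
  assumes "Im p = 0" "Im q = 0"
  obtains a b where "p = of_real a" "q = of_real b" "Xb \<le> a" "a \<le> Xc" "b \<le> Xa" "a \<noteq> 1" "- a - b \<noteq> 1"
    "curve_zr k a = x" "curve_zr k b = x" "curve_zr k (- a - b) = x"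
    "k * x = a * b * (a + b)" "(1 - a) * (1 - b) * (1 + a + b) = 1 - k" "pot (- p - q) = potr (- a - b)"
proof -
  define a b where "a = Re p" and "b = Re q"
  have ab: "p = of_real a" "q = of_real b" using assms by (simp_all add: a_def b_def complex_eq_iff)
  have neq: "a \<noteq> b" using sheets_signs by (auto simp: a_def b_def)
  note t = third_root[OF p(2) q(2) sheets_signs(3)]
  have m: "- p - q = of_real (- a - b)" by (simp add: ab)
  have r: "Xb \<le> a" "a \<le> Xc" "b \<le> Xa" using p(1) q(1) K0_real K2_real by (auto simp: ab)
  have one: "a \<noteq> 1" "b \<noteq> 1" "- a - b \<noteq> 1"
    using cubic_root_ne_1[OF p(2)] cubic_root_ne_1[OF q(2)] cubic_root_ne_1[OF t(1)] unfolding m unfolding ab by (metis of_real_1)+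
  have "complex_of_real (k * x) = of_real (a * b * (a + b))" using t(3) by (simp add: ab)
  then have kx: "k * x = a * b * (a + b)" by (simp only: of_real_eq_iff)
  have z: "curve_zr k a = x" "curve_zr k b = x" "curve_zr k (- a - b) = x"
    using p(2) q(2) t(1)[unfolded m] unfolding ab
    using cubic_real_iff[OF one(1)] cubic_real_iff[OF one(2)] cubic_real_iff[OF one(3)] by blast+
  have "pot (- p - q) = potr (- a - b)" unfolding m by (rule pot_of_real)
  then show thesis
    using that[OF ab r one(1,3) z kx cubic_two_real_roots[OF _ _ neq]] p(2) q(2) unfolding ab by blast
qed

text \<open>A nonreal p gives equality. For real p = a, the middle root m = - a - b satisfies 0 <= m
  <= Xb <= a and a^2 <= k, so the comparison across \<open>Xb\<close> applies. If m were beyond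
  \<open>Xb\<close>, injectivity of z between \<open>Xb\<close> and 1 would force m = a, a double
  root, which can only be \<open>Xb\<close> itself.\<close>

lemma pot_middle_le_p:
  assumes "x \<ge> 0" "Re p < 1"
  shows "pot (- p - q) \<le> pot p"
proof (cases "Im p = 0")
  case True
  have "Im q = 0" using middle_root_cnj_q assms by force
  from real_sheets[OF True this] obtain a b where ab: "p = of_real a" "q = of_real b" "Xb \<le> a" "a \<le> Xc" "b \<le> Xa" "a \<noteq> 1" "- a - b \<noteq> 1"
    "curve_zr k a = x" "curve_zr k b = x" "curve_zr k (- a - b) = x"
    "k * x = a * b * (a + b)" "(1 - a) * (1 - b) * (1 + a + b) = 1 - k" "pot (- p - q) = potr (- a - b)" .
  have a1: "a < 1" using assms ab by simp
  have a0: "a > 0" "b < 0" using ab crit by auto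
  have asq: "a\<^sup>2 \<le> k"
  proof -
    have "0 \<le> a * (k - a\<^sup>2) / (k * (1 - a))" using ab(8) assms by (simp add: curve_zr_def)
    moreover have "0 < k * (1 - a)" using a1 k by simp
    ultimately have "0 \<le> a * (k - a\<^sup>2)" by (metis zero_le_divide_iff less_le_not_le)
    then have "0 \<le> k - a\<^sup>2" using a0 by (metis zero_le_mult_iff less_le_not_le)
    then show ?thesis by simp
  qed
  have m0: "0 \<le> - a - b"
  proof -
    have "a * b < 0" using a0 by (simp add: mult_pos_neg)
    moreover have "0 \<le> a * b * (a + b)" using ab(11) assms k by (metis mult_nonneg_nonneg less_imp_le)
    ultimately have "a + b \<le> 0" by (metis mult_neg_pos not_le)
    then show ?thesis by simp
  qed
  have m1: "- a - b \<le> Xb"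
  proof (rule ccontr)
    assume n: "\<not> - a - b \<le> Xb"
    have pos: "(1 - a) * (1 - b) > 0" using a1 a0 by simp
    then have "1 + a + b > 0" using ab(12) k by (metis zero_less_mult_pos diff_gt_0_iff_gt)
    then have m1: "- a - b < 1" by simp
    have "a = - a - b" by (rule curve_zr_inj) (use ab n a1 m1 in auto)
    then have b: "b = - 2 * a" by simp
    have "a = Xb" using double_root_critical[OF ab(12) b] a0 a1 crit by auto
    then show False using n b by simp
  qed
  show ?thesis
    unfolding ab(13) unfolding ab(1) pot_of_real
    by (rule potr_across_Xb) (use m0 m1 ab asq in auto)
qed (simp add: pot_middle_eq_p)

text \<open>The same at \<open>Xc\<close>. Here a > 1 makes 1 - a and 1 - b of opposite sign, so 1 +
  a + b < 0, and the middle root lies beyond the pole as well.\<close>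

lemma pot_middle_ge_p:
  assumes "Re p \<ge> 1 \<or> Im p \<noteq> 0" "x \<ge> 0"
  shows "pot p \<le> pot (- p - q)"
proof (cases "Im p = 0")
  case True
  have "Im q = 0" using middle_root_cnj_q assms by force
  from real_sheets[OF True this] obtain a b where ab: "p = of_real a" "q = of_real b" "Xb \<le> a" "a \<le> Xc" "b \<le> Xa" "a \<noteq> 1" "- a - b \<noteq> 1"
    "curve_zr k a = x" "curve_zr k b = x" "curve_zr k (- a - b) = x"
    "k * x = a * b * (a + b)" "(1 - a) * (1 - b) * (1 + a + b) = 1 - k" "pot (- p - q) = potr (- a - b)" .
  have a1: "a > 1" using assms ab True by simp
  have b0: "b < 0" using ab crit by auto
  have m1: "- a - b > 1"
  proof -
    have "(1 - a) * (1 - b) < 0" using a1 b0 by (intro mult_neg_pos) auto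
    moreover have "(1 - a) * (1 - b) * (1 + a + b) > 0" using ab(12) k by simp
    ultimately have "1 + a + b < 0" by (metis zero_less_mult_iff less_asym)
    then show ?thesis by simp
  qed
  have m2: "- a - b \<ge> Xc"
  proof (rule ccontr)
    assume n: "\<not> - a - b \<ge> Xc"
    have "a = - a - b" by (rule curve_zr_inj) (use ab n a1 m1 in auto)
    then have b: "b = - 2 * a" by simp
    have "a = Xc" using double_root_critical[OF ab(12) b] a1 crit by auto
    then show False using n b by simp
  qed
  show ?thesis
    unfolding ab(13) unfolding ab(1) pot_of_real
    by (rule potr_across_Xc) (use m2 a1 ab in auto)
qed (simp add: pot_middle_eq_p)

text \<open>The same at \<open>Xa\<close> with the roles of p and q exchanged. The sign of x makes p
  real and, if q = b is real too, the middle root nonpositive and b^2 <= k.\<close>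

lemma pot_q_le_middle:
  assumes "x \<le> 0"
  shows "pot q \<le> pot (- p - q)"
proof (cases "Im q = 0")
  case True
  have "Im p = 0" using middle_root_cnj_p assms by force
  from real_sheets[OF this True] obtain a b where ab: "p = of_real a" "q = of_real b" "Xb \<le> a" "a \<le> Xc" "b \<le> Xa" "a \<noteq> 1" "- a - b \<noteq> 1"
    "curve_zr k a = x" "curve_zr k b = x" "curve_zr k (- a - b) = x"
    "k * x = a * b * (a + b)" "(1 - a) * (1 - b) * (1 + a + b) = 1 - k" "pot (- p - q) = potr (- a - b)" .
  have a0: "a > 0" "b < 0" using ab crit by auto
  have bsq: "b\<^sup>2 \<le> k"
  proof -
    have "b * (k - b\<^sup>2) / (k * (1 - b)) \<le> 0" using ab(9) assms by (simp add: curve_zr_def)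
    moreover have "0 < k * (1 - b)" using a0 k by simp
    ultimately have "b * (k - b\<^sup>2) \<le> 0" by (metis divide_le_0_iff less_le_not_le)
    then have "0 \<le> k - b\<^sup>2" using a0 by (metis mult_le_0_iff less_le_not_le)
    then show ?thesis by simp
  qed
  have m0: "- a - b \<le> 0"
  proof -
    have "a * b < 0" using a0 by (simp add: mult_pos_neg)
    moreover have "a * b * (a + b) \<le> 0" using ab(11) assms k by (metis mult_nonneg_nonpos less_imp_le)
    ultimately have "0 \<le> a + b" by (metis mult_neg_neg not_le)
    then show ?thesis by simp
  qed
  have m1: "Xa \<le> - a - b"
  proof (rule ccontr)
    assume n: "\<not> Xa \<le> - a - b"
    have "b = - a - b" by (rule curve_zr_inj) (use ab n in auto)
    then have a: "a = - 2 * b" by simp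
    have "(1 - b) * (1 - a) * (1 + b + a) = 1 - k" using ab(12) by (simp add: mult_ac add_ac)
    from double_root_critical[OF this a] have "b = Xa" using a0 crit by auto
    then show False using n a by simp
  qed
  show ?thesis
    unfolding ab(13) unfolding ab(2) pot_of_real
    by (rule potr_across_Xa) (use m0 m1 ab bsq in auto)
qed (simp add: pot_middle_eq_q)

end

end

section \<open>The sheets over the lower half plane\<close>

text \<open>Ln (1 + w) / w extends continuously by 1. This turns phi_0 = 1 + 2/z + ... into ln phi_0
  ~ 2/z, and serves the second sheet likewise.\<close>

lemma tendsto_mult_Ln_one_plus:
  fixes u :: "complex \<Rightarrow> complex"
  assumes u: "(u \<longlongrightarrow> 0) F" and zu: "((\<lambda>z. z * u z) \<longlongrightarrow> l) F"
  shows "((\<lambda>z. z * Ln (1 + u z)) \<longlongrightarrow> l) F"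
proof -
  define h where "h = (\<lambda>w::complex. if w = 0 then 1 else Ln (1 + w) / w)"
  have "((\<lambda>w. Ln (1 + w)) has_field_derivative 1) (at 0)"
    by (auto intro!: derivative_eq_intros)
  then have "(\<lambda>w. Ln (1 + w) / w) \<midarrow>0\<rightarrow> 1" by (simp add: DERIV_def)
  then have "h \<midarrow>0\<rightarrow> 1" unfolding h_def by (rule Lim_transform_eventually) (auto simp: eventually_at_filter)
  then have "isCont h 0" by (simp add: isCont_def h_def)
  then have "((\<lambda>z. h (u z)) \<longlongrightarrow> h 0) F" by (rule isCont_tendsto_compose[OF _ u])
  from tendsto_mult[OF zu this] have "((\<lambda>z. z * u z * h (u z)) \<longlongrightarrow> l) F" by (simp add: h_def)
  moreover have "z * u z * h (u z) = z * Ln (1 + u z)" for z by (simp add: h_def)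
  ultimately show ?thesis by simp
qed

definition upper_angle :: "complex \<Rightarrow> real" where
  "upper_angle w = pi / 2 + Im (Ln (- \<i> * w))"

text \<open>This agrees with \<open>Im (Ln w)\<close> on the upper half plane, and, unlike \<open>Im (Ln w)\<close>, is continuous at the negative reals.\<close>
lemma upper_angle_eq_Im_Ln:
  assumes "Im w > 0"
  shows "upper_angle w = Im (Ln w)"
proof -
  have "- \<i> * w \<noteq> 0" "0 \<le> Re (- \<i> * w)" using assms by auto
  then have "Ln (\<i> * (- \<i> * w)) = Ln (- \<i> * w) + \<i> * of_real pi / 2"
    by (subst Ln_times_ii) auto
  moreover have "\<i> * (- \<i> * w) = w" by (simp add: mult.assoc[symmetric])
  ultimately show ?thesis by (simp add: upper_angle_def)
qed

lemma upper_angle_real: "r > 0 \<Longrightarrow> upper_angle (of_real r) = 0" "r < 0 \<Longrightarrow> upper_angle (of_real r) = pi"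
proof -
  assume r: "r > 0"
  have "Ln (- \<i> * of_real r) = of_real (ln r) + Ln (- \<i>)"
    using Ln_times_of_real[OF r, of "- \<i>"] r by (simp add: mult.commute Ln_of_real)
  then show "upper_angle (of_real r) = 0" using r by (simp add: upper_angle_def Ln_of_real)
next
  assume r: "r < 0"
  have "Ln (- \<i> * of_real r) = Ln (of_real (- r) * \<i>)" by (simp add: mult.commute)
  also have "\<dots> = of_real (ln (- r)) + Ln \<i>"
    using Ln_times_of_real[of "- r" \<i>] Ln_of_real[of "- r"] r by simp
  finally show "upper_angle (of_real r) = pi" using r by (simp add: upper_angle_def)
qed

lemma upper_angle_imaginary: "r > 0 \<Longrightarrow> upper_angle (\<i> * of_real r) = pi / 2"
  by (simp add: upper_angle_def mult.assoc[symmetric] Ln_of_real)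

text \<open>Multiplication by - i moves the closed upper half plane without 0 off the cut of
  \<open>Ln\<close>, so limits on either real half line are treated alike.\<close>

lemma tendsto_Im_Ln_upper:
  assumes lim: "(\<psi> \<longlongrightarrow> l) F" and pos: "eventually (\<lambda>z. Im (\<psi> z) > 0) F" and F: "F \<noteq> bot" and l: "l \<noteq> 0"
  shows "((\<lambda>z. Im (Ln (\<psi> z))) \<longlongrightarrow> upper_angle l) F" and "Im l \<ge> 0"
proof -
  show iml: "Im l \<ge> 0"
    by (rule tendsto_lowerbound[OF tendsto_Im[OF lim] _ F]) (use pos in eventually_elim, auto)
  have "- \<i> * l \<notin> \<real>\<^sub>\<le>\<^sub>0"
    using iml l by (auto simp: complex_nonpos_Reals_iff complex_eq_iff)
  then have "((\<lambda>z. upper_angle (\<psi> z)) \<longlongrightarrow> upper_angle l) F"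
    unfolding upper_angle_def by (intro tendsto_intros lim)
  then show "((\<lambda>z. Im (Ln (\<psi> z))) \<longlongrightarrow> upper_angle l) F"
    by (rule Lim_transform_eventually) (use pos in eventually_elim, simp add: upper_angle_eq_Im_Ln)
qed

text \<open>A positive factor does not change the argument. It is divided out where the function
  itself tends to 0, so that the rescaled limit is not 0.\<close>

lemma tendsto_Im_Ln_upper_scaled:
  assumes lim: "((\<lambda>z. \<psi> z / of_real (r z)) \<longlongrightarrow> l) F" and pos: "eventually (\<lambda>z. Im (\<psi> z) > 0 \<and> r z > 0) F"
    and F: "F \<noteq> bot" and l: "l \<noteq> 0"
  shows "((\<lambda>z. Im (Ln (\<psi> z))) \<longlongrightarrow> upper_angle l) F" and "Im l \<ge> 0"
proof -
  have p: "eventually (\<lambda>z. Im (\<psi> z / of_real (r z)) > 0) F"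
    using pos by eventually_elim (simp add: Im_divide_of_real)
  note t = tendsto_Im_Ln_upper[OF lim p F l]
  show "Im l \<ge> 0" by (rule t(2))
  show "((\<lambda>z. Im (Ln (\<psi> z))) \<longlongrightarrow> upper_angle l) F"
  proof (rule Lim_transform_eventually[OF t(1)])
    show "eventually (\<lambda>z. Im (Ln (\<psi> z / of_real (r z))) = Im (Ln (\<psi> z))) F"
      using pos
    proof eventually_elim
      case (elim z)
      have "Ln (of_real (1 / r z) * \<psi> z) = of_real (ln (1 / r z)) + Ln (\<psi> z)"
        using Ln_times_of_real[of "1 / r z" "\<psi> z"] Ln_of_real[of "1 / r z"] elim by force
      then show ?case by (simp add: field_simps)
    qed
  qed
qed

lemma filterlim_vertical_at_left:
  "filterlim (\<lambda>y. Complex x y) (at (of_real x) within {z. Im z < 0}) (at_left 0)"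
proof -
  have "((\<lambda>y. Complex x y) \<longlongrightarrow> Complex x 0) (at_left 0)"
    by (intro tendsto_Complex tendsto_const tendsto_ident_at)
  moreover have "eventually (\<lambda>y. Complex x y \<in> {z. Im z < 0} \<and> Complex x y \<noteq> of_real x) (at_left (0::real))"
    unfolding eventually_at_filter by (auto intro!: always_eventually simp: complex_eq_iff)
  ultimately show ?thesis unfolding filterlim_at by (simp only: complex_of_real_def simp_thms)
qed

lemma filterlim_minus_inverse_Suc: "filterlim (\<lambda>n. - (1 / real (Suc n))) (at_left 0) sequentially"
  unfolding filterlim_at
proof
  show "(\<lambda>n. - (1 / real (Suc n))) \<longlonglongrightarrow> 0" using tendsto_minus[OF LIMSEQ_Suc[OF lim_1_over_n]] by simp
qed (auto intro!: always_eventually)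

text \<open>The equation holds at a double root p of the cubic. For nonreal p = a + i b the
  imaginary part gives b^2 = 3 a (a - 1), and then the real part gives k = a (4 a - 3)^2. But b^2 >
  0 means a < 0 or a > 1, hence k <= 0 or k > 1.\<close>

lemma real_of_depressed_double_root:
  fixes p :: complex and k :: real
  assumes k: "0 < k" "k < 1" and eq: "of_real k = 3 * p\<^sup>2 - 2 * p ^ 3"
  shows "Im p = 0"
proof (rule ccontr)
  assume y: "Im p \<noteq> 0"
  obtain a b where p: "p = Complex a b" by (cases p)
  have "Im (3 * p\<^sup>2 - 2 * p ^ 3) = 0" "Re (3 * p\<^sup>2 - 2 * p ^ 3) = k" unfolding eq[symmetric] by simp_all
  then have "b * (6 * a - 6 * a\<^sup>2 + 2 * b\<^sup>2) = 0" and r: "3 * (a\<^sup>2 - b\<^sup>2) - 2 * (a ^ 3 - 3 * a * b\<^sup>2) = k"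
    by (simp_all add: p power2_eq_square power3_eq_cube algebra_simps)
  then have "6 * a - 6 * a\<^sup>2 + 2 * b\<^sup>2 = 0" using y by (simp add: p)
  then have b2: "b\<^sup>2 = 3 * (a * (a - 1))" by (simp add: power2_eq_square algebra_simps)
  have kk: "k = a * (4 * a - 3)\<^sup>2" using r unfolding b2 by (simp add: power2_eq_square power3_eq_cube algebra_simps)
  have "b\<^sup>2 > 0" using y p by simp
  then have "a * (a - 1) > 0" using b2 by simp
  then have "a < 0 \<or> a > 1" by (auto simp: zero_less_mult_iff)
  then show False
  proof
    assume "a < 0"
    then have "a * (4 * a - 3)\<^sup>2 \<le> 0" by (intro mult_nonpos_nonneg) auto
    then show False using kk k by simp
  next
    assume a: "a > 1"
    then have "1\<^sup>2 < (4 * a - 3)\<^sup>2" by (intro power_strict_mono) auto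
    then have "1 * 1 < a * (4 * a - 3)\<^sup>2" using a by (intro mult_strict_mono) auto
    then show False using kk k by simp
  qed
qed

section \<open>Branches of the cubic over the lower half plane\<close>

context spectral_curve
begin

lemma lower_root_cases:
  assumes z: "Im z < 0" and c: "curve_cubic k z q = 0"
  shows "Im q \<noteq> 0" and "Im q > 0 \<Longrightarrow> region q \<and> Re q \<noteq> 0"
    and "Im q < 0 \<Longrightarrow> (2 * Re q + 1) * (cmod (1 - q))\<^sup>2 > 1 - k"
proof -
  have q1: "q \<noteq> 1" using cubic_root_ne_1[OF c] .
  have zq: "curve_z k q = z" using curve_cubic_iff[of k q z] k q1 c by auto
  have im: "Im q * ((2 * Re q + 1) * (cmod (1 - q))\<^sup>2 - (1 - k)) / (k * (cmod (1 - q))\<^sup>2) < 0"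
    using Im_curve_z[OF k(1) q1] zq z by simp
  have "k * (cmod (1 - q))\<^sup>2 > 0" using k q1 by simp
  then have im2: "Im q * ((2 * Re q + 1) * (cmod (1 - q))\<^sup>2 - (1 - k)) < 0"
    using im by (metis divide_less_0_iff less_asym)
  then show "Im q \<noteq> 0" by auto
  show "region q \<and> Re q \<noteq> 0" if "Im q > 0"
  proof -
    have "region q" using im2 that by (auto simp: mult_less_0_iff region_def)
    then show ?thesis using region_Re_nonzero by blast
  qed
  show "(2 * Re q + 1) * (cmod (1 - q))\<^sup>2 > 1 - k" if "Im q < 0"
    using im2 that by (auto simp: mult_less_0_iff)
qed

text \<open>The image of the half plane is connected, and no root over it lies on the real axis or
  on the upper half of the imaginary axis. So a single value decides the quadrant; the sign of s
  selects the right or the left one.\<close>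

lemma lower_branch_quadrant:
  fixes s :: real
  assumes f: "continuous_on {z. Im z < 0} f" "\<And>z. Im z < 0 \<Longrightarrow> curve_cubic k z (f z) = 0"
    and s: "s \<noteq> 0" and z0: "Im z0 < 0" "Im (f z0) > 0" "s * Re (f z0) > 0" and z: "Im z < 0"
  shows "Im (f z) > 0 \<and> s * Re (f z) > 0"
proof -
  let ?S = "f ` {z. Im z < 0}"
  let ?A = "{q. Im q > 0} \<inter> {q. s * Re q > 0}"
  let ?B = "{q. Im q < 0} \<union> ({q. Im q > 0} \<inter> {q. s * Re q < 0})"
  have con: "connected ?S"
    by (intro connected_continuous_image f(1) convex_connected convex_halfspace_Im_lt)
  have oA: "open ?A" by (intro open_Int open_Collect_less continuous_intros)
  have oB: "open ?B" by (intro open_Un open_Int open_Collect_less continuous_intros)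
  have sub: "?S \<subseteq> ?A \<union> ?B"
  proof
    fix q assume "q \<in> ?S"
    then obtain w where w: "Im w < 0" "q = f w" by auto
    show "q \<in> ?A \<union> ?B"
    proof (cases "Im q > 0")
      case True
      then have "s * Re q \<noteq> 0" using lower_root_cases(2)[OF w(1) f(2)[OF w(1)]] w s by simp
      then have "s * Re q > 0 \<or> s * Re q < 0" by linarith
      then show ?thesis using True by auto
    next
      case False
      then show ?thesis using lower_root_cases(1)[OF w(1) f(2)[OF w(1)]] w by auto
    qed
  qed
  have "?A \<inter> ?S = {} \<or> ?B \<inter> ?S = {}"
    by (rule connectedD[OF con oA oB _ sub]) auto
  moreover have "f z0 \<in> ?A \<inter> ?S" using z0 by auto
  ultimately have "?B \<inter> ?S = {}" by blast
  moreover have "f z \<in> ?S" using z by blast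
  ultimately show ?thesis using sub by blast
qed

text \<open>Dividing the cubic by its root f leaves a quadratic with discriminant \<Delta>. At a
  zero of \<Delta> the other two roots would coincide, hence be real, and f would be real as minus
  twice their value. So \<Delta> has a holomorphic square root on the half plane, and one of its
  signs gives the left quadrant.\<close>

lemma second_sheet_exists:
  assumes holo: "f holomorphic_on {z. Im z < 0}" and root: "\<And>z. Im z < 0 \<Longrightarrow> curve_cubic k z (f z) = 0"
    and im: "\<And>z. Im z < 0 \<Longrightarrow> Im (f z) > 0 \<and> Re (f z) > 0"
  obtains g where "g holomorphic_on {z. Im z < 0}" "\<And>z. Im z < 0 \<Longrightarrow> curve_cubic k z (g z) = 0"
    "\<And>z. Im z < 0 \<Longrightarrow> Im (g z) > 0 \<and> Re (g z) < 0"
proof -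
  define \<Delta> where "\<Delta> = (\<lambda>z. 4 * of_real k * (1 + z) - 3 * (f z)\<^sup>2)"
  have \<Delta>h: "\<Delta> holomorphic_on {z. Im z < 0}" unfolding \<Delta>_def by (intro holomorphic_intros holo)
  have \<Delta>0: "\<Delta> z \<noteq> 0" if z: "z \<in> {z. Im z < 0}" for z
  proof
    assume D: "\<Delta> z = 0"
    define p where "p = - f z / 2"
    have fp: "f z = - 2 * p" by (simp add: p_def)
    have "of_real k = 3 * p\<^sup>2 - 2 * p ^ 3"
      using D root[of z] z unfolding \<Delta>_def curve_cubic_def fp mem_Collect_eq
      by (simp add: power2_eq_square power3_eq_cube) algebra
    from real_of_depressed_double_root[OF k this] show False using im[of z] z by (simp add: p_def)
  qed
  have "contractible {z. Im z < 0}" by (intro convex_imp_contractible convex_halfspace_Im_lt)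
  from contractible_imp_holomorphic_sqrt[OF \<Delta>h this \<Delta>0] obtain r
    where r: "r holomorphic_on {z. Im z < 0}" "\<And>z. z \<in> {z. Im z < 0} \<Longrightarrow> \<Delta> z = (r z)\<^sup>2" by blast
  define h where "h = (\<lambda>(e::complex) z. (1 / 2) * (e * r z - f z))"
  have hh: "h e holomorphic_on {z. Im z < 0}" for e unfolding h_def by (intro holomorphic_intros r holo) auto
  have hroot: "curve_cubic k z (h e z) = 0" if z: "Im z < 0" and e: "e\<^sup>2 = 1" for e z
  proof -
    have "2 * h e z + f z = e * r z" unfolding h_def by algebra
    then have "(2 * h e z + f z)\<^sup>2 = e\<^sup>2 * (r z)\<^sup>2" by (simp add: power_mult_distrib)
    then have "(2 * h e z + f z)\<^sup>2 = 4 * of_real k * (1 + z) - 3 * (f z)\<^sup>2"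
      using r(2)[of z] z e by (simp add: \<Delta>_def)
    then have "4 * curve_cubic k z (h e z) = 4 * curve_cubic k z (f z)" unfolding curve_cubic_def by algebra
    then show ?thesis using root[OF z] by simp
  qed
  \<comment> \<open>At Re q = -1/2 the factor 2 Re q + 1 vanishes, so Im z and Im q have opposite
    signs for every k. This point of the left quadrant therefore lies over the lower half plane and
    fixes the sign of the square root.\<close>
  define p0 where "p0 = Complex (-1/2) 1"
  have p01: "p0 \<noteq> 1" by (simp add: p0_def complex_eq_iff)
  define z0 where "z0 = curve_z k p0"
  have z0: "Im z0 < 0"
  proof -
    have "k * (cmod (1 - p0))\<^sup>2 > 0" using k p01 by simp
    moreover have "Im p0 * ((2 * Re p0 + 1) * (cmod (1 - p0))\<^sup>2 - (1 - k)) < 0" using k by (simp add: p0_def)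
    ultimately show ?thesis unfolding z0_def Im_curve_z[OF k(1) p01] by (intro divide_neg_pos)
  qed
  have p0r: "curve_cubic k z0 p0 = 0" using curve_cubic_iff[of k p0 z0] k p01 by (simp add: z0_def)
  have ne: "p0 \<noteq> f z0"
  proof
    assume "p0 = f z0"
    then have "Re p0 > 0" using im[OF z0] by simp
    then show False by (simp add: p0_def)
  qed
  have "(p0 - f z0) * (p0\<^sup>2 + f z0 * p0 + (f z0)\<^sup>2 - of_real k * (1 + z0)) = 0"
    using p0r root[OF z0] unfolding curve_cubic_def by algebra
  then have "p0\<^sup>2 + f z0 * p0 + (f z0)\<^sup>2 - of_real k * (1 + z0) = 0" using ne by simp
  then have "(2 * p0 + f z0)\<^sup>2 = \<Delta> z0" unfolding \<Delta>_def by algebra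
  then have "(2 * p0 + f z0)\<^sup>2 = (r z0)\<^sup>2" using r(2)[of z0] z0 by simp
  then have "2 * p0 + f z0 = r z0 \<or> 2 * p0 + f z0 = - r z0" by (simp add: power2_eq_iff)
  then obtain e :: complex where e: "e\<^sup>2 = 1" "2 * p0 + f z0 = e * r z0"
    by (metis mult_1 mult_minus1 one_power2 power2_minus)
  then have "h e z0 = p0" unfolding h_def by (simp add: field_simps)
  then have "Im (h e z) > 0 \<and> (- 1) * Re (h e z) > 0" if "Im z < 0" for z
    by (intro lower_branch_quadrant[OF holomorphic_on_imp_continuous_on[OF hh] hroot _ z0 _ _ that])
      (use e in \<open>auto simp: p0_def\<close>)
  then show thesis using that[of "h e"] hh hroot e by auto
qed

end

text \<open>For q not 0 this is (1 - k) phi, normalized to tend to 1 as q tends to infinity, as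
  happens on the second sheet near z = infinity. Since sigma (1 - k) = 1, it is the reciprocal of
  sigma / phi.\<close>

definition curve_w :: "real \<Rightarrow> complex \<Rightarrow> complex" where
  "curve_w k q = 1 - of_real k / q\<^sup>2"

section \<open>Boundary behaviour of arguments and primitives\<close>

context spectral_curve
begin

lemma curve_phi_eq_w: "q \<noteq> 0 \<Longrightarrow> curve_phi k q = curve_w k q / of_real (1 - k)"
  using k by (simp add: curve_phi_def curve_w_def field_simps)

lemma Im_curve_w:
  assumes "q \<noteq> 0"
  shows "Im (curve_w k q) = 2 * k * (Re q * Im q) / (cmod q) ^ 4"
proof -
  have "Im (of_real k / q\<^sup>2) = - (k * Im (q\<^sup>2)) / (cmod (q\<^sup>2))\<^sup>2"
    by (simp add: Im_divide cmod_power2)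
  moreover have "Im (q\<^sup>2) = 2 * (Re q * Im q)" by (simp add: power2_eq_square)
  moreover have "(cmod (q\<^sup>2))\<^sup>2 = (cmod q) ^ 4" by (simp add: norm_power)
  ultimately show ?thesis by (simp add: curve_w_def)
qed

lemma Im_curve_w_sign:
  assumes "Im q > 0"
  shows "Re q > 0 \<Longrightarrow> Im (curve_w k q) > 0" "Re q < 0 \<Longrightarrow> Im (curve_w k q) < 0"
proof -
  have q: "q \<noteq> 0" "(cmod q) ^ 4 > 0" using assms by auto
  show "Im (curve_w k q) > 0" if "Re q > 0"
    unfolding Im_curve_w[OF q(1)] using that assms k q by (intro divide_pos_pos mult_pos_pos) auto
  have "Re q * Im q < 0" if "Re q < 0" using that assms by (rule mult_neg_pos)
  then show "Im (curve_w k q) < 0" if "Re q < 0"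
    unfolding Im_curve_w[OF q(1)] by (intro divide_neg_pos[OF mult_pos_neg q(2)]) (use that k in auto)
qed

text \<open>The form with the explicit factor z gives the rate at which phi tends to 0 over z =
  0.\<close>

lemma curve_phi_at_root:
  assumes "curve_cubic k z q = 0" "q \<noteq> 0"
  shows "curve_phi k q = - (of_real k * z * (1 - q)) / (of_real (1 - k) * q ^ 3)"
proof -
  have "q * (q\<^sup>2 - of_real k) = - (of_real k * z * (1 - q))"
    using assms(1) unfolding curve_cubic_def by algebra
  moreover have "curve_phi k q = (q * (q\<^sup>2 - of_real k)) / (of_real (1 - k) * q ^ 3)"
  proof -
    have "of_real (1 - k) * q ^ 3 = q * (of_real (1 - k) * q\<^sup>2)" by (simp add: power2_eq_square power3_eq_cube)
    then show ?thesis unfolding curve_phi_def by (simp only: mult_divide_mult_cancel_left[OF assms(2)])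
  qed
  ultimately show ?thesis by simp
qed

text \<open>Off 0 the argument has a limit by continuity. Over 0 the boundary root satisfies L^2 =
  k, so phi tends to 0; dividing by - y leaves i t or its conjugate, with t real and not 0, and as
  the imaginary part is positive the angle is pi / 2. The map C is conjugation on the second sheet,
  where phi lies in the lower half plane.\<close>

lemma boundary_angle:
  fixes C :: "complex \<Rightarrow> complex"
  assumes C: "C = (\<lambda>w. w) \<or> C = cnj"
    and K: "closed K" "\<And>q. q \<in> K \<Longrightarrow> Re q \<noteq> 0"
    and uniq: "\<And>p q. p \<in> K \<Longrightarrow> q \<in> K \<Longrightarrow> curve_cubic k (of_real x) p = 0 \<Longrightarrow> curve_cubic k (of_real x) q = 0 \<Longrightarrow> p = q"
    and f: "\<And>z. Im z < 0 \<Longrightarrow> f z \<in> K \<and> curve_cubic k z (f z) = 0"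
    and im: "\<And>z. Im z < 0 \<Longrightarrow> Im (C (curve_phi k (f z))) > 0"
  obtains L where "L \<in> K" "curve_cubic k (of_real x) L = 0" "((\<lambda>y. f (Complex x y)) \<longlongrightarrow> L) (at_left 0)"
    "((\<lambda>y. Im (Ln (C (curve_phi k (f (Complex x y)))))) \<longlongrightarrow> (if x = 0 then pi / 2 else upper_angle (C (curve_phi k L)))) (at_left 0)"
proof -
  obtain L where L: "L \<in> K" "curve_cubic k (of_real x) L = 0" "(f \<longlongrightarrow> L) (at (of_real x) within {z. Im z < 0})"
    using boundary_root_limit[OF K(1) uniq f] by blast
  have fl: "((\<lambda>y. f (Complex x y)) \<longlongrightarrow> L) (at_left 0)"
    by (rule filterlim_compose[OF L(3) filterlim_vertical_at_left])
  have L0: "L \<noteq> 0" using K(2)[OF L(1)] by auto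
  have f0: "f z \<noteq> 0" if "Im z < 0" for z using K(2)[of "f z"] f[OF that] by auto
  have Cl: "((\<lambda>y. C (g y)) \<longlongrightarrow> C l) F" if "(g \<longlongrightarrow> l) F" for g l and F :: "real filter"
    using C that by (auto intro: tendsto_cnj)
  have neg: "eventually (\<lambda>y. y < 0) (at_left (0::real))" by (simp add: eventually_at_filter)
  have k1: "complex_of_real (1 - k) \<noteq> 0" using k by (simp only: of_real_eq_0_iff)
  show thesis
  proof (cases "x = 0")
    case False
    have "((\<lambda>y. curve_phi k (f (Complex x y))) \<longlongrightarrow> curve_phi k L) (at_left 0)"
      unfolding curve_phi_def by (intro tendsto_intros fl) (use L0 k1 in auto)
    note lim = Cl[OF this]
    have "curve_phi k L \<noteq> 0" using curve_phi_nonzero(1)[OF L(2)] False by simp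
    then have nz: "C (curve_phi k L) \<noteq> 0" using C by auto
    have ev: "eventually (\<lambda>y. Im (C (curve_phi k (f (Complex x y)))) > 0) (at_left 0)"
      using neg by eventually_elim (rule im, simp)
    show thesis
      by (rule that[OF L(1,2) fl]) (use tendsto_Im_Ln_upper(1)[OF lim ev trivial_limit_at_left_real nz] False in simp)
  next
    case True
    define t where "t = k * (1 - Re L) / ((1 - k) * Re L ^ 3)"
    have "L * (L\<^sup>2 - of_real k) = 0" using L(2) True by (simp add: curve_cubic_def power2_eq_square power3_eq_cube algebra_simps)
    then have L2: "L\<^sup>2 = of_real k" using L0 by simp
    have "Im (L\<^sup>2) = 0" unfolding L2 by simp
    then have "Im L = 0" using K(2)[OF L(1)] by (simp add: power2_eq_square)
    then have Lr: "L = of_real (Re L)" by (simp add: complex_eq_iff)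
    have L1: "Re L \<noteq> 1" using cubic_root_ne_1[OF L(2)] Lr by (metis of_real_1)
    have t0: "t \<noteq> 0" using L1 k K(2)[OF L(1)] by (simp add: t_def)
    have lim0: "((\<lambda>y. \<i> * (of_real k * (1 - f (Complex x y)) / (of_real (1 - k) * f (Complex x y) ^ 3))) \<longlongrightarrow>
        \<i> * (of_real k * (1 - L) / (of_real (1 - k) * L ^ 3))) (at_left 0)"
      by (intro tendsto_intros fl) (use L0 k1 in auto)
    have tl: "of_real k * (1 - L) / (of_real (1 - k) * L ^ 3) = of_real t"
      by (subst (1 2) Lr) (simp add: t_def)
    have ev: "eventually (\<lambda>y. C (curve_phi k (f (Complex x y))) / of_real (- y) =
        C (\<i> * (of_real k * (1 - f (Complex x y)) / (of_real (1 - k) * f (Complex x y) ^ 3)))) (at_left 0)"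
      using neg
    proof eventually_elim
      case (elim y)
      have z: "Im (Complex x y) < 0" using elim by simp
      have zy: "Complex x y = \<i> * of_real y" using True by (simp add: complex_eq_iff)
      have A: "curve_phi k (f (Complex x y)) / of_real (- y)
          = \<i> * (of_real k * (1 - f (Complex x y)) / (of_real (1 - k) * f (Complex x y) ^ 3))"
        using curve_phi_at_root[OF conjunct2[OF f[OF z]] f0[OF z]] elim unfolding zy by simp
      have B: "C (w / of_real (- y)) = C w / of_real (- y)" for w using C by auto
      show ?case by (simp only: A[symmetric] B)
    qed
    have lim: "((\<lambda>y. C (curve_phi k (f (Complex x y))) / of_real (- y)) \<longlongrightarrow> C (\<i> * of_real t)) (at_left 0)"
      by (rule Lim_transform_eventually[OF Cl[OF lim0[unfolded tl]]]) (use ev in eventually_elim, simp)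
    have pos: "eventually (\<lambda>y. Im (C (curve_phi k (f (Complex x y)))) > 0 \<and> - y > 0) (at_left 0)"
      using neg by eventually_elim (use im in auto)
    have nz: "C (\<i> * of_real t) \<noteq> 0" using C t0 by auto
    note u = tendsto_Im_Ln_upper_scaled[OF lim pos trivial_limit_at_left_real nz]
    note u(2)
    moreover have "C (\<i> * of_real t) = \<i> * of_real (Im (C (\<i> * of_real t)))" "Im (C (\<i> * of_real t)) \<noteq> 0"
      using C t0 by (auto simp: complex_eq_iff)
    ultimately have ua: "upper_angle (C (\<i> * of_real t)) = pi / 2"
      using upper_angle_imaginary[of "Im (C (\<i> * of_real t))"] by (metis less_eq_real_def)
    show thesis
      by (rule that[OF L(1,2) fl]) (use u(1)[unfolded ua] True in simp)
  qed
qed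

definition sheet_primitive :: "(complex \<Rightarrow> complex) \<Rightarrow> complex \<Rightarrow> complex" where
  "sheet_primitive f z = z * Ln (curve_w k (f z)) - 2 * Ln (1 - f z)"

text \<open>The complex form of d (z ln phi - 2 ln (1 - q)) = ln phi dz, with \<open>curve_w\<close>
  in place of phi. As Im q > 0, neither 1 - q nor \<open>curve_w\<close> meets the cut of
  \<open>Ln\<close>.\<close>

lemma sheet_primitive_deriv:
  assumes holo: "f holomorphic_on {z. Im z < 0}" and root: "\<And>z. Im z < 0 \<Longrightarrow> curve_cubic k z (f z) = 0"
    and im: "\<And>z. Im z < 0 \<Longrightarrow> Im (f z) > 0" and z: "Im z < 0"
  shows "(sheet_primitive f has_field_derivative Ln (curve_w k (f z))) (at z)"
proof -
  let ?q = "f z"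
  have q: "Im ?q > 0" "?q \<noteq> 0" "?q \<noteq> 1" "curve_cubic k z ?q = 0" using im[OF z] root[OF z] by auto
  have "Re ?q \<noteq> 0" using lower_root_cases(2)[OF z q(4) q(1)] by simp
  then have imw: "Im (curve_w k ?q) \<noteq> 0" using Im_curve_w_sign[OF q(1)] by (cases "Re ?q > 0") auto
  then have w0: "curve_w k ?q \<noteq> 0" "curve_w k ?q \<notin> \<real>\<^sub>\<le>\<^sub>0" by (auto simp: complex_nonpos_Reals_iff)
  have q1: "1 - ?q \<notin> \<real>\<^sub>\<le>\<^sub>0" using q(1) by (auto simp: complex_nonpos_Reals_iff)
  have oH: "open {z::complex. Im z < 0}" by (simp add: open_halfspace_Im_lt)
  obtain f' where f': "(f has_field_derivative f') (at z)"
    using holomorphic_on_imp_differentiable_at[OF holo oH] z by (auto simp: field_differentiable_def)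
  have dw0: "((\<lambda>q. 1 - of_real k / q\<^sup>2) has_field_derivative 2 * of_real k / ?q ^ 3) (at ?q)"
  proof -
    have "((\<lambda>q. of_real k / q\<^sup>2) has_field_derivative (0 * ?q\<^sup>2 - of_real k * (2 * ?q)) / (?q\<^sup>2 * ?q\<^sup>2)) (at ?q)"
      by (rule DERIV_divide) (use q(2) in \<open>auto intro!: derivative_eq_intros\<close>)
    also have "0 * ?q\<^sup>2 - of_real k * (2 * ?q) = (- (2 * of_real k)) * ?q" by simp
    also have "?q\<^sup>2 * ?q\<^sup>2 = ?q ^ 3 * ?q" by (simp add: power2_eq_square power3_eq_cube)
    also have "(- (2 * of_real k)) * ?q / (?q ^ 3 * ?q) = - (2 * of_real k / ?q ^ 3)"
      using mult_divide_mult_cancel_right[OF q(2)] by simp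
    finally show ?thesis by (rule DERIV_cong[OF DERIV_diff[OF DERIV_const]]) simp
  qed
  have dw: "((\<lambda>z. curve_w k (f z)) has_field_derivative 2 * of_real k / ?q ^ 3 * f') (at z)"
    unfolding curve_w_def by (rule DERIV_chain2[OF dw0 f'])
  have dl: "((\<lambda>z. Ln (curve_w k (f z))) has_field_derivative inverse (curve_w k ?q) * (2 * of_real k / ?q ^ 3 * f')) (at z)"
    by (rule DERIV_chain2[OF has_field_derivative_Ln[OF w0(2)] dw])
  have d1: "((\<lambda>z. 1 - f z) has_field_derivative - f') (at z)" using f' by (auto intro!: derivative_eq_intros)
  have dl1: "((\<lambda>z. Ln (1 - f z)) has_field_derivative inverse (1 - ?q) * (- f')) (at z)"
    by (rule DERIV_chain2[OF has_field_derivative_Ln[OF q1] d1])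
  have "(sheet_primitive f has_field_derivative
      (1 * Ln (curve_w k (f z)) + inverse (curve_w k ?q) * (2 * of_real k / ?q ^ 3 * f') * z) - 2 * (inverse (1 - ?q) * (- f'))) (at z)"
    unfolding sheet_primitive_def[abs_def]
    by (rule DERIV_diff[OF DERIV_mult[OF DERIV_ident dl] DERIV_cmult[OF dl1]])
  moreover have "inverse (curve_w k ?q) * (2 * of_real k / ?q ^ 3) * z = - 2 * inverse (1 - ?q)"
  proof -
    have zq: "z = ?q * (of_real k - ?q\<^sup>2) / (of_real k * (1 - ?q))"
      using curve_cubic_iff[of k "?q" z] q k by (simp add: curve_z_def)
    have n: "?q\<^sup>2 - of_real k \<noteq> 0" "1 - ?q \<noteq> 0" "complex_of_real k \<noteq> 0" using w0 q k by (auto simp: curve_w_def)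
    have "curve_w k ?q = (?q\<^sup>2 - of_real k) / ?q\<^sup>2" using q by (simp add: curve_w_def diff_divide_distrib)
    then have "inverse (curve_w k ?q) * (2 * of_real k / ?q ^ 3) = (?q\<^sup>2 * (2 * of_real k)) / ((?q\<^sup>2 - of_real k) * ?q ^ 3)"
      by (simp only: inverse_divide times_divide_times_eq)
    also have "(?q\<^sup>2 - of_real k) * ?q ^ 3 = ?q\<^sup>2 * (?q * (?q\<^sup>2 - of_real k))" by (simp only: power2_eq_square power3_eq_cube mult_ac)
    also have "(?q\<^sup>2 * (2 * of_real k)) / (?q\<^sup>2 * (?q * (?q\<^sup>2 - of_real k))) = 2 * of_real k / (?q * (?q\<^sup>2 - of_real k))"
      by (rule mult_divide_mult_cancel_left) (use q in simp)
    finally have A: "inverse (curve_w k ?q) * (2 * of_real k / ?q ^ 3) = 2 * of_real k / (?q * (?q\<^sup>2 - of_real k))" .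
    have "inverse (curve_w k ?q) * (2 * of_real k / ?q ^ 3) * z = 2 * of_real k / (?q * (?q\<^sup>2 - of_real k)) * z"
      by (simp only: A)
    also have "2 * of_real k / (?q * (?q\<^sup>2 - of_real k)) * z
        = 2 * of_real k / (?q * (?q\<^sup>2 - of_real k)) * (?q * (of_real k - ?q\<^sup>2) / (of_real k * (1 - ?q)))"
      by (rule arg_cong[OF zq, where f = "\<lambda>u. 2 * of_real k / (?q * (?q\<^sup>2 - of_real k)) * u"])
    also have "\<dots> = (2 * of_real k * (?q * (of_real k - ?q\<^sup>2))) / (?q * (?q\<^sup>2 - of_real k) * (of_real k * (1 - ?q)))"
      by (simp only: times_divide_times_eq)
    also have "2 * of_real k * (?q * (of_real k - ?q\<^sup>2)) = (- 2) * (of_real k * ?q * (?q\<^sup>2 - of_real k))" by algebra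
    also have "?q * (?q\<^sup>2 - of_real k) * (of_real k * (1 - ?q)) = (1 - ?q) * (of_real k * ?q * (?q\<^sup>2 - of_real k))" by algebra
    also have "(- 2) * (of_real k * ?q * (?q\<^sup>2 - of_real k)) / ((1 - ?q) * (of_real k * ?q * (?q\<^sup>2 - of_real k))) = (- 2) / (1 - ?q)"
      by (rule mult_divide_mult_cancel_right) (use n q in simp)
    also have "(- 2) / (1 - ?q) = - 2 * inverse (1 - ?q)" by (simp only: divide_inverse)
    finally show ?thesis .
  qed
  then have E: "inverse (curve_w k ?q) * (2 * of_real k / ?q ^ 3 * f') * z = - 2 * inverse (1 - ?q) * f'"
  proof -
    assume e: "inverse (curve_w k ?q) * (2 * of_real k / ?q ^ 3) * z = - 2 * inverse (1 - ?q)"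
    have "inverse (curve_w k ?q) * (2 * of_real k / ?q ^ 3 * f') * z = inverse (curve_w k ?q) * (2 * of_real k / ?q ^ 3) * z * f'"
      by (simp only: mult.assoc mult.commute[of f'])
    then show ?thesis by (simp only: e)
  qed
  ultimately show ?thesis unfolding E by simp
qed

text \<open>The imaginary part of a logarithm is bounded by pi, so its product with y disappears in
  the limit. Over x = 0 the factor x suppresses ln |curve_w|, which is unbounded there. The term x
  ln (1 - k) compensates for \<open>curve_w\<close> replacing phi.\<close>

lemma sheet_primitive_boundary:
  assumes L: "((\<lambda>y. f (Complex x y)) \<longlongrightarrow> L) (at_left 0)" "curve_cubic k (of_real x) L = 0" "L \<noteq> 0"
    and nz: "\<And>y. y < 0 \<Longrightarrow> curve_w k (f (Complex x y)) \<noteq> 0"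
  shows "((\<lambda>y. Re (sheet_primitive f (Complex x y))) \<longlongrightarrow> pot L + x * ln (1 - k)) (at_left 0)"
proof -
  have neg: "eventually (\<lambda>y. y < 0) (at_left (0::real))" by (simp add: eventually_at_filter)
  have L1: "L \<noteq> 1" using cubic_root_ne_1[OF L(2)] .
  have w: "((\<lambda>y. curve_w k (f (Complex x y))) \<longlongrightarrow> curve_w k L) (at_left 0)"
    unfolding curve_w_def by (intro tendsto_intros L(1)) (use L(3) in auto)
  have wne: "curve_w k L \<noteq> 0" if "x \<noteq> 0"
  proof -
    have "curve_phi k L \<noteq> 0" using curve_phi_nonzero(1)[OF L(2)] that by simp
    then show ?thesis using curve_phi_eq_w[OF L(3)] by auto
  qed
  have 1: "((\<lambda>y. x * ln (cmod (curve_w k (f (Complex x y))))) \<longlongrightarrow> x * ln (cmod (curve_w k L))) (at_left 0)"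
  proof (cases "x = 0")
    case False
    then show ?thesis using wne by (intro tendsto_intros w) auto
  qed simp
  have 2: "((\<lambda>y. y * Im (Ln (curve_w k (f (Complex x y))))) \<longlongrightarrow> 0) (at_left 0)"
  proof (rule Lim_null_comparison)
    show "eventually (\<lambda>y. norm (y * Im (Ln (curve_w k (f (Complex x y))))) \<le> \<bar>y\<bar> * pi) (at_left 0)"
      using neg
    proof eventually_elim
      case (elim y)
      have "\<bar>Im (Ln (curve_w k (f (Complex x y))))\<bar> \<le> pi"
        using mpi_less_Im_Ln[OF nz[OF elim]] Im_Ln_le_pi[OF nz[OF elim]] by linarith
      then show "norm (y * Im (Ln (curve_w k (f (Complex x y))))) \<le> \<bar>y\<bar> * pi"
        using mult_left_mono[OF _ abs_ge_zero[of y]] by (simp add: abs_mult)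
    qed
    have "((\<lambda>y::real. \<bar>y\<bar> * pi) \<longlongrightarrow> \<bar>0\<bar> * pi) (at_left 0)" by (intro tendsto_intros)
    then show "((\<lambda>y::real. \<bar>y\<bar> * pi) \<longlongrightarrow> 0) (at_left 0)" by simp
  qed
  have 3: "((\<lambda>y. 2 * ln (cmod (1 - f (Complex x y)))) \<longlongrightarrow> 2 * ln (cmod (1 - L))) (at_left 0)"
    by (intro tendsto_intros L(1)) (use L1 in auto)
  have lim: "((\<lambda>y. x * ln (cmod (curve_w k (f (Complex x y)))) - y * Im (Ln (curve_w k (f (Complex x y))))
      - 2 * ln (cmod (1 - f (Complex x y)))) \<longlongrightarrow> x * ln (cmod (curve_w k L)) - 0 - 2 * ln (cmod (1 - L))) (at_left 0)"
    by (intro tendsto_diff 1 2 3)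
  have val: "x * ln (cmod (curve_w k L)) = x * ln (cmod (curve_phi k L)) + x * ln (1 - k)"
  proof (cases "x = 0")
    case False
    have "cmod (curve_phi k L) = cmod (curve_w k L) / (1 - k)"
      using k unfolding curve_phi_eq_w[OF L(3)] norm_divide norm_of_real by simp
    then show ?thesis using wne[OF False] k by (simp add: ln_div algebra_simps)
  qed simp
  have "eventually (\<lambda>y. Re (sheet_primitive f (Complex x y)) = x * ln (cmod (curve_w k (f (Complex x y))))
      - y * Im (Ln (curve_w k (f (Complex x y)))) - 2 * ln (cmod (1 - f (Complex x y)))) (at_left 0)"
  proof -
    have "((\<lambda>y. 1 - f (Complex x y)) \<longlongrightarrow> 1 - L) (at_left 0)" by (intro tendsto_intros L(1))
    then have e1: "eventually (\<lambda>y. 1 - f (Complex x y) \<noteq> 0) (at_left 0)"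
      by (rule tendsto_imp_eventually_ne) (use L1 in simp)
    show ?thesis using e1 neg by eventually_elim (auto simp: sheet_primitive_def Re_Ln nz)
  qed
  then have "((\<lambda>y. Re (sheet_primitive f (Complex x y))) \<longlongrightarrow> x * ln (cmod (curve_w k L)) - 0 - 2 * ln (cmod (1 - L))) (at_left 0)"
    by (intro Lim_transform_eventually[OF lim]) (erule eventually_mono, simp)
  then show ?thesis unfolding val pot_eq_at_root[OF L(2)] by (simp add: algebra_simps)
qed

text \<open>Re q < 0 keeps q away from 1, so bounded q means bounded z, and q tends to infinity with
  z. With u = - k / q^2 the product z u is a rational function of 1/q with the value -1 at 0. The
  resulting limit 1 will be the mass of mu.\<close>

lemma second_sheet_at_infinity:
  assumes root: "\<And>z. Im z < 0 \<Longrightarrow> curve_cubic k z (g z) = 0" and re: "\<And>z. Im z < 0 \<Longrightarrow> Re (g z) < 0"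
  shows "((\<lambda>z. z * (- Ln (curve_w k (g z)))) \<longlongrightarrow> 1) (inf at_infinity (principal {z. Im z < 0}))"
    (is "(_ \<longlongrightarrow> _) ?F")
proof -
  have g: "filterlim g at_infinity ?F"
    unfolding filterlim_at_infinity[OF order_refl]
  proof (intro allI impI)
    fix r :: real assume r: "r > 0"
    have "eventually (\<lambda>z. norm z \<ge> r * (k + r\<^sup>2) / k + 1) (at_infinity :: complex filter)"
      by (auto simp: eventually_at_infinity)
    then show "eventually (\<lambda>z. r \<le> norm (g z)) ?F"
      unfolding eventually_inf_principal
    proof eventually_elim
      case (elim z)
      show ?case
      proof (intro impI, rule ccontr)
        assume z: "z \<in> {z. Im z < 0}" and "\<not> r \<le> norm (g z)"
        then have gr: "norm (g z) \<le> r" by simp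
        have g1: "g z \<noteq> 1" using re[of z] z by auto
        have zq: "z = g z * (of_real k - (g z)\<^sup>2) / (of_real k * (1 - g z))"
          using curve_cubic_iff[OF _ g1, of k z] root[of z] z k by (simp add: curve_z_def)
        have n1: "1 \<le> cmod (1 - g z)" using complex_Re_le_cmod[of "1 - g z"] re[of z] z by simp
        have "norm z = norm (g z) * norm (of_real k - (g z)\<^sup>2) / (k * norm (1 - g z))"
          using k by (subst zq) (simp only: norm_divide norm_mult norm_of_real abs_of_pos)
        also have "\<dots> \<le> r * (k + r\<^sup>2) / (k * 1)"
        proof (rule frac_le)
          have "norm (of_real k - (g z)\<^sup>2) \<le> norm (complex_of_real k) + norm ((g z)\<^sup>2)" by (rule norm_triangle_ineq4)
          also have "\<dots> \<le> k + r\<^sup>2" using k gr by (simp add: norm_power power_mono)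
          finally show "norm (g z) * norm (of_real k - (g z)\<^sup>2) \<le> r * (k + r\<^sup>2)"
            using gr r by (intro mult_mono) auto
          show "k * 1 \<le> k * cmod (1 - g z)" using n1 k by (intro mult_left_mono) auto
        qed (use k r in auto)
        finally show False using elim by simp
      qed
    qed
  qed
  have inv: "((\<lambda>z. inverse (g z)) \<longlongrightarrow> 0) ?F" by (rule filterlim_compose[OF tendsto_inverse_0 g])
  define u where "u = (\<lambda>z. - of_real k * (inverse (g z))\<^sup>2)"
  have u0: "(u \<longlongrightarrow> - of_real k * 0\<^sup>2) ?F" unfolding u_def by (intro tendsto_intros inv)
  have "((\<lambda>z. - ((of_real k * (inverse (g z))\<^sup>2 - 1) / (inverse (g z) - 1))) \<longlongrightarrow> - ((of_real k * 0\<^sup>2 - 1) / (0 - 1))) ?F"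
    by (intro tendsto_intros inv) auto
  then have lim: "((\<lambda>z. - ((of_real k * (inverse (g z))\<^sup>2 - 1) / (inverse (g z) - 1))) \<longlongrightarrow> - 1) ?F" by simp
  have "eventually (\<lambda>z. - ((of_real k * (inverse (g z))\<^sup>2 - 1) / (inverse (g z) - 1)) = z * u z) ?F"
    unfolding eventually_inf_principal
  proof (intro always_eventually allI impI)
    fix z assume z: "z \<in> {z. Im z < 0}"
    have g1: "g z \<noteq> 1" "g z \<noteq> 0" "1 - g z \<noteq> 0" using re[of z] z by auto
    have zq: "z = g z * (of_real k - (g z)\<^sup>2) / (of_real k * (1 - g z))"
      using curve_cubic_iff[OF _ g1(1), of k z] root[of z] z k by (simp add: curve_z_def)
    define i where "i = inverse (g z)"
    have gi: "g z * i = 1" using g1 by (simp add: i_def)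
    have nz: "of_real k * (1 - g z) \<noteq> 0" using g1 k by simp
    have "z * (of_real k * (1 - g z)) = g z * (of_real k - (g z)\<^sup>2)"
      using nonzero_eq_divide_eq[OF nz, of z "g z * (of_real k - (g z)\<^sup>2)"] zq by blast
    then have "z * (of_real k * i\<^sup>2) * (i - 1) = of_real k * i\<^sup>2 - 1" using gi by algebra
    moreover have "i - 1 \<noteq> 0" using gi g1 by auto
    ultimately have "z * (of_real k * i\<^sup>2) = (of_real k * i\<^sup>2 - 1) / (i - 1)"
      using nonzero_eq_divide_eq[of "i - 1" "z * (of_real k * i\<^sup>2)" "of_real k * i\<^sup>2 - 1"] by blast
    then show "- ((of_real k * (inverse (g z))\<^sup>2 - 1) / (inverse (g z) - 1)) = z * u z"
      by (simp add: u_def i_def)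

  qed
  then have zu: "((\<lambda>z. z * u z) \<longlongrightarrow> - 1) ?F" by (rule Lim_transform_eventually[OF lim])
  have "((\<lambda>z. - (z * Ln (1 + u z))) \<longlongrightarrow> - (- 1)) ?F"
    by (intro tendsto_minus tendsto_mult_Ln_one_plus[OF _ zu]) (use u0 in simp)
  moreover have "1 + u z = curve_w k (g z)" for z
    by (simp add: u_def curve_w_def divide_inverse power_inverse)
  ultimately show ?thesis by simp
qed

end

section \<open>The measures and their potentials\<close>

context
  fixes \<rho> :: "real \<Rightarrow> real"
  assumes m\<rho> [measurable]: "\<rho> \<in> borel_measurable borel" and \<rho>0: "\<And>x. 0 \<le> \<rho> x"
begin

lemma emeasure_density_le_lborel:
  assumes "\<And>x. \<rho> x \<le> 1" "A \<in> sets borel"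
  shows "emeasure (density lborel (\<lambda>x. ennreal (\<rho> x))) A \<le> emeasure lborel A"
proof -
  have "emeasure (density lborel (\<lambda>x. ennreal (\<rho> x))) A = (\<integral>\<^sup>+x. ennreal (\<rho> x) * indicator A x \<partial>lborel)"
    using assms(2) by (intro emeasure_density) auto
  also have "\<dots> \<le> (\<integral>\<^sup>+x. indicator A x \<partial>lborel)"
    using assms(1) by (intro nn_integral_mono) (auto simp: indicator_def ennreal_le_1)
  also have "\<dots> = emeasure lborel A" using assms(2) by simp
  finally show ?thesis .
qed

lemma emeasure_density_UNIV:
  assumes "integrable lborel \<rho>"
  shows "emeasure (density lborel (\<lambda>x. ennreal (\<rho> x))) UNIV = ennreal (integral\<^sup>L lborel \<rho>)"
  using assms \<rho>0 by (simp add: emeasure_density nn_integral_eq_integral)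

lemma log_potential_density:
  "log_potential (density lborel (\<lambda>x. ennreal (\<rho> x))) z = - (\<integral>t. \<rho> t * ln (cmod (z - of_real t)) \<partial>lborel)"
proof -
  have "(\<integral>t. ln (cmod (z - of_real t)) \<partial>density lborel (\<lambda>x. ennreal (\<rho> x))) = (\<integral>t. \<rho> t *\<^sub>R ln (cmod (z - of_real t)) \<partial>lborel)"
    by (rule integral_density) (use \<rho>0 in auto)
  then show ?thesis by (simp add: log_potential_def)
qed

lemma has_log_potential_density:
  assumes "\<And>z. integrable lborel (\<lambda>t. \<rho> t * ln (cmod (z - of_real t)))"
  shows "has_log_potential (density lborel (\<lambda>x. ennreal (\<rho> x)))"
  unfolding has_log_potential_def
proof
  fix z :: complex
  have "integrable (density lborel (\<lambda>x. ennreal (\<rho> x))) (\<lambda>t. ln (cmod (z - of_real t)))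
      \<longleftrightarrow> integrable lborel (\<lambda>t. \<rho> t *\<^sub>R ln (cmod (z - of_real t)))"
    by (rule integrable_density) (use \<rho>0 in auto)
  then show "integrable (density lborel (\<lambda>x. ennreal (\<rho> x))) (\<lambda>t. ln (cmod (z - of_real t)))"
    using assms[of z] by simp
qed

lemma not_in_supp_density:
  assumes "open U" "x \<in> U" "\<And>y. y \<in> U \<Longrightarrow> \<rho> y = 0"
  shows "x \<notin> supp (density lborel (\<lambda>x. ennreal (\<rho> x)))"
proof -
  have "emeasure (density lborel (\<lambda>x. ennreal (\<rho> x))) U = (\<integral>\<^sup>+x. ennreal (\<rho> x) * indicator U x \<partial>lborel)"
    using assms(1) by (intro emeasure_density) auto
  also have "\<dots> = (\<integral>\<^sup>+(x::real). 0 \<partial>lborel)" by (intro nn_integral_cong) (use assms(3) in \<open>auto simp: indicator_def\<close>)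
  finally show ?thesis using assms by (auto simp: supp_def)
qed

text \<open>If \<open>l - \<nu>\<close> were not a measure, \<^const>\<open>diff_measure\<close> would yield the null measure, so that the
  claim holds without checking that the difference is a measure.\<close>
lemma not_in_supp_slack_density:
  assumes A: "A \<in> sets borel" and eq: "AE y in lborel. y \<in> {a<..<b} \<longrightarrow> \<rho> y = indicator A y" and x: "x \<in> {a<..<b}"
  shows "x \<notin> supp (slack A (density lborel (\<lambda>x. ennreal (\<rho> x))))"
proof -
  let ?N = "density lborel (\<lambda>x. ennreal (\<rho> x))" and ?M = "density lborel (indicator A :: real \<Rightarrow> ennreal)" and ?U = "{a<..<b}"
  have [measurable]: "A \<in> sets borel" by (rule A)
  have M: "emeasure ?M ?U = (\<integral>\<^sup>+x. indicator A x * indicator ?U x \<partial>lborel)"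
    by (intro emeasure_density) auto
  have N: "emeasure ?N ?U = (\<integral>\<^sup>+x. ennreal (\<rho> x) * indicator ?U x \<partial>lborel)"
    by (intro emeasure_density) auto
  have MN: "emeasure ?N ?U = emeasure ?M ?U"
    unfolding M N using eq by (intro nn_integral_cong_AE, elim eventually_mono) (auto simp: indicator_def)
  have "emeasure ?M ?U \<le> (\<integral>\<^sup>+x. indicator ?U x \<partial>lborel)"
    unfolding M by (intro nn_integral_mono) (auto simp: indicator_def)
  also have "\<dots> = emeasure lborel ?U" by simp
  also have "\<dots> < \<infinity>" using x by (subst emeasure_lborel_Ioo) auto
  finally have fin: "emeasure ?M ?U \<noteq> \<infinity>" by simp
  have "emeasure (diff_measure ?M ?N) ?U = 0"
    unfolding diff_measure_def emeasure_measure_of_conv using MN fin by (auto simp: ennreal_minus_eq_0)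
  then show ?thesis unfolding slack_def supp_def using x by (auto intro!: exI[of _ ?U])
qed

end

section \<open>From a sheet to its density and its potential\<close>

context spectral_curve
begin

text \<open>Both sheets in one statement: C is the identity for phi_0 and conjugation for phi_2, and
  m is the mass. Only the imaginary part of F is tied to the argument of C phi, which leaves a real
  constant free for the normalization at infinity.\<close>

lemma sheet_density:
  fixes C F f :: "complex \<Rightarrow> complex" and m :: real
  assumes C: "C = (\<lambda>w. w) \<or> C = cnj"
    and K: "closed K" "\<And>q. q \<in> K \<Longrightarrow> Re q \<noteq> 0"
    and uniq: "\<And>x p q. p \<in> K \<Longrightarrow> q \<in> K \<Longrightarrow> curve_cubic k (of_real x) p = 0 \<Longrightarrow> curve_cubic k (of_real x) q = 0 \<Longrightarrow> p = q"
    and f: "\<And>z. Im z < 0 \<Longrightarrow> f z \<in> K \<and> curve_cubic k z (f z) = 0"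
    and im: "\<And>z. Im z < 0 \<Longrightarrow> Im (C (curve_phi k (f z))) > 0"
    and F: "F holomorphic_on {z. Im z < 0}" "\<And>z. Im z < 0 \<Longrightarrow> Im (F z) = Im (Ln (C (curve_phi k (f z))))"
    and inf: "((\<lambda>z. z * F z) \<longlongrightarrow> of_real m) (inf at_infinity (principal {z. Im z < 0}))"
  obtains \<rho> :: "real \<Rightarrow> real" and P :: "real \<Rightarrow> complex" where
    "\<And>x. P x \<in> K" "\<And>x. curve_cubic k (of_real x) (P x) = 0" "\<And>x. ((\<lambda>y. f (Complex x y)) \<longlongrightarrow> P x) (at_left 0)"
    "\<And>x. ((\<lambda>y. Im (F (Complex x y))) \<longlongrightarrow> pi * \<rho> x) (at_left 0)"
    "\<And>x. x \<noteq> 0 \<Longrightarrow> pi * \<rho> x = upper_angle (C (curve_phi k (P x)))"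
    "\<rho> \<in> borel_measurable borel" "\<And>x. 0 \<le> \<rho> x" "\<And>x. \<rho> x \<le> 1" "integrable lborel \<rho>" "integral\<^sup>L lborel \<rho> = m"
    "\<And>z. Im z < 0 \<Longrightarrow> F z = (\<integral>t. of_real (\<rho> t) / (z - of_real t) \<partial>lborel)"
proof -
  have "\<exists>L. L \<in> K \<and> curve_cubic k (of_real x) L = 0 \<and> ((\<lambda>y. f (Complex x y)) \<longlongrightarrow> L) (at_left 0) \<and>
    ((\<lambda>y. Im (Ln (C (curve_phi k (f (Complex x y)))))) \<longlongrightarrow> (if x = 0 then pi / 2 else upper_angle (C (curve_phi k L)))) (at_left 0)" for x
    by (rule boundary_angle[where x = x, OF C K uniq f im]) blast+
  then obtain P where P: "\<And>x. P x \<in> K" "\<And>x. curve_cubic k (of_real x) (P x) = 0" "\<And>x. ((\<lambda>y. f (Complex x y)) \<longlongrightarrow> P x) (at_left 0)"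
    "\<And>x. ((\<lambda>y. Im (Ln (C (curve_phi k (f (Complex x y)))))) \<longlongrightarrow> (if x = 0 then pi / 2 else upper_angle (C (curve_phi k (P x))))) (at_left 0)"
    by metis
  \<comment> \<open>The value 1/2 at 0 is the vertical limit obtained from
    \<open>boundary_angle\<close>.\<close>
  define \<rho> where "\<rho> = (\<lambda>x. (if x = 0 then pi / 2 else upper_angle (C (curve_phi k (P x)))) / pi)"
  have neg: "eventually (\<lambda>y. y < 0) (at_left (0::real))" by (simp add: eventually_at_filter)
  have lim: "((\<lambda>y. Im (F (Complex x y))) \<longlongrightarrow> pi * \<rho> x) (at_left 0)" for x
  proof -
    have "eventually (\<lambda>y. Im (Ln (C (curve_phi k (f (Complex x y))))) = Im (F (Complex x y))) (at_left 0)"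
      using neg by eventually_elim (simp add: F(2))
    from Lim_transform_eventually[OF P(4) this] show ?thesis by (simp add: \<rho>_def)
  qed
  have seq: "(\<lambda>n. Im (F (Complex x (- (1 / Suc n))))) \<longlonglongrightarrow> pi * \<rho> x" for x
    by (rule filterlim_compose[OF lim filterlim_minus_inverse_Suc])
  have imF: "0 \<le> Im (F z) \<and> Im (F z) \<le> pi" if "Im z < 0" for z
    using Im_Ln_pos_lt_imp[OF im[OF that]] F(2)[OF that] by simp
  note S = stieltjes_representation[OF F(1) imF inf seq]
  have "pi * \<rho> x = upper_angle (C (curve_phi k (P x)))" if "x \<noteq> 0" for x using that by (simp add: \<rho>_def)
  from that[OF P(1-3) lim this S] show thesis by blast
qed

text \<open>The coefficients cover ln phi_0, with a = 1 and b = - ln (1 - k), and ln (sigma /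
  phi_2), with a = -1 and b = 0. On the half plane the logarithmic integral and the real part of the
  primitive of F differ by a constant, and both have limits on the real axis.\<close>

lemma sheet_potential:
  fixes f F :: "complex \<Rightarrow> complex" and a b :: real
  assumes holo: "f holomorphic_on {z. Im z < 0}" and root: "\<And>z. Im z < 0 \<Longrightarrow> curve_cubic k z (f z) = 0"
    and im: "\<And>z. Im z < 0 \<Longrightarrow> Im (f z) > 0"
    and F: "\<And>z. Im z < 0 \<Longrightarrow> F z = of_real a * Ln (curve_w k (f z)) + of_real b"
    and P: "\<And>x. curve_cubic k (of_real x) (P x) = 0" "\<And>x. ((\<lambda>y. f (Complex x y)) \<longlongrightarrow> P x) (at_left 0)" "\<And>x. P x \<noteq> 0"
    and \<rho>: "\<And>x. 0 \<le> \<rho> x" "integrable lborel \<rho>"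
    and rep: "\<And>z. Im z < 0 \<Longrightarrow> F z = (\<integral>t. of_real (\<rho> t) / (z - of_real t) \<partial>lborel)"
    and li: "\<And>z. integrable lborel (\<lambda>t. \<rho> t * ln (cmod (z - of_real t)))"
  obtains C :: real where "\<And>x. (\<integral>t. \<rho> t * ln (cmod (of_real x - of_real t)) \<partial>lborel)
      = a * (pot (P x) + x * ln (1 - k)) + b * x + C"
proof -
  define G where "G z = of_real a * sheet_primitive f z + of_real b * z" for z
  have G: "(G has_field_derivative F z) (at z)" if "Im z < 0" for z
    unfolding G_def F[OF that]
    using DERIV_add[OF DERIV_cmult[OF sheet_primitive_deriv[OF holo root im that]] DERIV_cmult[OF DERIV_ident], of "of_real a" "of_real b"]
    by simp
  obtain C where Cz: "\<And>z. Im z < 0 \<Longrightarrow> (\<integral>t. \<rho> t * ln (cmod (z - of_real t)) \<partial>lborel) = Re (G z) + C"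
    using logarithmic_potential_eq_Re_primitive[OF \<rho> li rep G] by blast
  show thesis
  proof (rule that[of C])
    fix x
    have nz: "curve_w k (f (Complex x y)) \<noteq> 0" if "y < 0" for y
    proof -
      have z: "Im (Complex x y) < 0" using that by simp
      have "Re (f (Complex x y)) \<noteq> 0" using lower_root_cases(2)[OF z root[OF z] im[OF z]] by simp
      then show ?thesis using Im_curve_w_sign[OF im[OF z]] by (cases "Re (f (Complex x y)) > 0") auto
    qed
    have Lneq: "P x \<noteq> 0" by (rule P(3))
    have "((\<lambda>y. a * Re (sheet_primitive f (Complex x y)) + b * x) \<longlongrightarrow> a * (pot (P x) + x * ln (1 - k)) + b * x) (at_left 0)"
      by (intro tendsto_intros sheet_primitive_boundary[OF P(2) P(1) Lneq nz])
    from filterlim_compose[OF this filterlim_minus_inverse_Suc]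
    have "(\<lambda>n. Re (G (Complex x (- (1 / Suc n))))) \<longlonglongrightarrow> a * (pot (P x) + x * ln (1 - k)) + b * x"
      by (simp add: G_def)
    from tendsto_add[OF this tendsto_const[of C]]
    have 1: "(\<lambda>n. \<integral>t. \<rho> t * ln (cmod (Complex x (- (1 / Suc n)) - of_real t)) \<partial>lborel)
        \<longlonglongrightarrow> a * (pot (P x) + x * ln (1 - k)) + b * x + C"
      by (subst Cz) auto
    show "(\<integral>t. \<rho> t * ln (cmod (of_real x - of_real t)) \<partial>lborel) = a * (pot (P x) + x * ln (1 - k)) + b * x + C"
      by (rule LIMSEQ_unique[OF logarithmic_potential_boundary_limit[OF \<rho> li] 1])
  qed
qed

end

section \<open>Values and decay of the two densities\<close>

context spectral_curve
begin

lemma K_Re_nonzero: "q \<in> K0 \<Longrightarrow> Re q \<noteq> 0" "q \<in> K2 \<Longrightarrow> Re q \<noteq> 0"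
  using region_Re_nonzero by (auto simp: K0_def K2_def)

text \<open>A critical point satisfies k = 3 X^2 - 2 X^3, whence the coefficients 3 X^2 and 2 X^3 of
  the cubic. The second claim says that the derivative of the cubic in q vanishes at X.\<close>

lemma cubic_double_root:
  assumes X: "X = Xa \<or> X = Xb \<or> X = Xc"
  shows "curve_cubic k (of_real (curve_zr k X)) w = (w - of_real X)\<^sup>2 * (w + 2 * of_real X)"
    and "3 * X\<^sup>2 = k * (1 + curve_zr k X)"
proof -
  have X1: "X \<noteq> 1" using X crit by auto
  have "(2 * X + 1) * (1 - X)\<^sup>2 - (1 - k) = 0" using X unfolding crit_poly by auto
  then have kk: "k = 3 * X\<^sup>2 - 2 * X ^ 3" by (simp add: power2_eq_square power3_eq_cube algebra_simps)
  have "k * (1 - X) \<noteq> 0" using X1 k by simp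
  then have z: "curve_zr k X * (k * (1 - X)) = X * (k - X\<^sup>2)" by (simp add: curve_zr_def)
  have "(1 - X) * (k * (1 + curve_zr k X) - 3 * X\<^sup>2) = k * (1 - X) + curve_zr k X * (k * (1 - X)) - 3 * X\<^sup>2 * (1 - X)"
    by (simp add: algebra_simps)
  also have "\<dots> = k - (3 * X\<^sup>2 - 2 * X ^ 3)" unfolding z by (simp add: power2_eq_square power3_eq_cube algebra_simps)
  also have "\<dots> = 0" using kk by linarith
  finally have "(1 - X) * (k * (1 + curve_zr k X) - 3 * X\<^sup>2) = 0" .
  then show a: "3 * X\<^sup>2 = k * (1 + curve_zr k X)" using X1 by simp
  have "k * (1 + curve_zr k X) = k + k * curve_zr k X" by (simp add: distrib_left)
  then have b: "k * curve_zr k X = 2 * X ^ 3" using a kk by linarith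
  have "curve_cubic k (of_real (curve_zr k X)) w = w ^ 3 - of_real (k * (1 + curve_zr k X)) * w + of_real (k * curve_zr k X)"
    by (simp add: curve_cubic_def)
  also have "\<dots> = w ^ 3 - of_real (3 * X\<^sup>2) * w + of_real (2 * X ^ 3)" by (simp only: a b)
  also have "\<dots> = (w - of_real X)\<^sup>2 * (w + 2 * of_real X)"
    by (simp add: power2_eq_square power3_eq_cube algebra_simps)
  finally show "curve_cubic k (of_real (curve_zr k X)) w = (w - of_real X)\<^sup>2 * (w + 2 * of_real X)" .
qed

text \<open>Over such a critical value the middle sheet meets sheet 0: of the roots X, X and - 2 X
  the one in the left half plane is - 2 X.\<close>

lemma middle_root_at_critical_p:
  assumes X: "X = Xb \<or> X = Xc" and q: "q \<in> K2" "curve_cubic k (of_real (curve_zr k X)) q = 0"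
  shows "- of_real X - q = of_real X"
proof -
  have "(q - of_real X)\<^sup>2 * (q + 2 * of_real X) = 0" using cubic_double_root(1)[of X q] X q(2) by auto
  then have "q = of_real X \<or> q = - (2 * of_real X)" by (simp add: eq_neg_iff_add_eq_0)
  moreover have "Re q < 0" using K_Re_nonzero(2)[OF q(1)] q(1) by (simp add: K2_def)
  moreover have "q \<noteq> of_real X"
  proof
    assume "q = of_real X"
    then have "X < 0" using \<open>Re q < 0\<close> by simp
    then show False using X crit by linarith
  qed
  ultimately have "q = - (2 * of_real X)" by blast
  then show ?thesis by simp
qed

lemma middle_root_at_critical_q:
  assumes p: "p \<in> K0" "curve_cubic k (of_real (curve_zr k Xa)) p = 0"
  shows "- p - of_real Xa = of_real Xa"
proof -
  have "(p - of_real Xa)\<^sup>2 * (p + 2 * of_real Xa) = 0" using cubic_double_root(1)[of Xa p] p(2) by auto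
  then have "p = of_real Xa \<or> p = - (2 * of_real Xa)" by (simp add: eq_neg_iff_add_eq_0)
  moreover have "Re p > 0" using K_Re_nonzero(1)[OF p(1)] p(1) by (simp add: K0_def)
  moreover have "p \<noteq> of_real Xa"
  proof
    assume "p = of_real Xa"
    then have "Xa > 0" using \<open>Re p > 0\<close> by simp
    then show False using crit by linarith
  qed
  ultimately have "p = - (2 * of_real Xa)" by blast
  then show ?thesis by simp
qed

lemma cubic_real_between:
  assumes ab: "a \<le> b" and sgn: "a ^ 3 - k * (1 + x) * a + k * x < 0 \<and> 0 < b ^ 3 - k * (1 + x) * b + k * x \<or>
      0 < a ^ 3 - k * (1 + x) * a + k * x \<and> b ^ 3 - k * (1 + x) * b + k * x < 0"
  obtains t where "a < t" "t < b" "curve_cubic k (of_real x) (of_real t) = 0"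
proof -
  let ?g = "\<lambda>t::real. t ^ 3 - k * (1 + x) * t + k * x"
  have cont: "continuous_on {a..b} ?g" by (intro continuous_intros)
  obtain t where t: "a \<le> t" "t \<le> b" "?g t = 0"
    using IVT'[of ?g a 0 b, OF _ _ ab cont] IVT2'[of ?g b 0 a, OF _ _ ab cont] sgn by force
  have "t \<noteq> a" "t \<noteq> b" using t sgn by auto
  moreover have "curve_cubic k (of_real x) (of_real t) = of_real (?g t)" by (simp add: curve_cubic_def)
  ultimately show thesis using that[of t] t by auto
qed

text \<open>A comparison of x with z(t) becomes the sign of the cubic at t, ready for the
  intermediate value theorem.\<close>

lemma cubic_value:
  assumes "t \<noteq> 1"
  shows "t ^ 3 - k * (1 + x) * t + k * x = k * (t - 1) * (curve_zr k t - x)"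
proof -
  have "k * (1 - t) \<noteq> 0" using assms k by simp
  then have "curve_zr k t * (k * (1 - t)) = t * (k - t\<^sup>2)" by (simp add: curve_zr_def)
  then show ?thesis by algebra
qed

lemma phir_sign: "t \<noteq> 0 \<Longrightarrow> t\<^sup>2 > k \<Longrightarrow> phir t > 0" "t \<noteq> 0 \<Longrightarrow> t\<^sup>2 < k \<Longrightarrow> phir t < 0"
  using k by (auto simp: phir_def intro!: divide_pos_pos divide_neg_pos)

lemma upper_angle_real_sheet:
  assumes "C = (\<lambda>w. w) \<or> C = cnj" "t \<noteq> 0"
  shows "t\<^sup>2 > k \<Longrightarrow> upper_angle (C (curve_phi k (of_real t))) = 0"
    and "t\<^sup>2 < k \<Longrightarrow> upper_angle (C (curve_phi k (of_real t))) = pi"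
proof -
  have "C (curve_phi k (of_real t)) = of_real (phir t)" using assms(1) by (auto simp: curve_phi_of_real)
  then show "t\<^sup>2 > k \<Longrightarrow> upper_angle (C (curve_phi k (of_real t))) = 0"
    "t\<^sup>2 < k \<Longrightarrow> upper_angle (C (curve_phi k (of_real t))) = pi"
    using phir_sign[OF assms(2)] upper_angle_real by simp_all
qed

text \<open>On these ranges p is real, so phi is real and its argument depends on the sign of p^2 -
  k. For x < 0 a nonreal p is impossible. In the other ranges the intermediate value theorem yields
  a real root in \<open>K0\<close>, between 1 and \<open>Xc\<close> or between \<open>Xb\<close> and
  1, and \<open>K0_unique\<close> identifies it with p.\<close>

lemma upper_angle_K0:
  assumes p: "p \<in> K0" "curve_cubic k (of_real x) p = 0" and q: "q \<in> K2" "curve_cubic k (of_real x) q = 0"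
  shows "x < 0 \<Longrightarrow> upper_angle (curve_phi k p) = 0"
    and "x > curve_zr k Xc \<Longrightarrow> upper_angle (curve_phi k p) = 0"
    and "0 < x \<Longrightarrow> x < curve_zr k Xb \<Longrightarrow> upper_angle (curve_phi k p) = pi"
proof -
  note ang = upper_angle_real_sheet[of "\<lambda>w. w", OF disjI1[OF refl]]
  show "upper_angle (curve_phi k p) = 0" if x: "x < 0"
  proof -
    have "Im p = 0" using middle_root_cnj_p(2)[OF p q] x by force
    then obtain t where t: "p = of_real t" by (metis complex_is_Real_iff Reals_cases)
    have tb: "Xb \<le> t" using p(1) K0_real t by auto
    have t1: "t \<noteq> 1" using cubic_root_ne_1[OF p(2)] t by auto
    have z: "t * (k - t\<^sup>2) / (k * (1 - t)) = x" using p(2) t t1 cubic_real_iff[OF t1] by (simp add: curve_zr_def)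
    have "t\<^sup>2 > k"
    proof (cases "t > 1")
      case True
      then have "1 < t\<^sup>2" by (simp add: one_less_power)
      then show ?thesis using k by linarith
    next
      case False
      show ?thesis
      proof (rule ccontr)
        assume "\<not> t\<^sup>2 > k"
        then have "0 \<le> t * (k - t\<^sup>2) / (k * (1 - t))"
          using False tb crit k by (intro divide_nonneg_nonneg mult_nonneg_nonneg) auto
        then show False using z x by simp
      qed
    qed
    then show ?thesis using ang(1)[of t] t tb crit by simp
  qed
  show "upper_angle (curve_phi k p) = 0" if x: "x > curve_zr k Xc"
  proof -
    have "(1::real) ^ 3 - k * (1 + x) * 1 + k * x = 1 - k" by (simp add: algebra_simps)
    moreover have "k * (Xc - 1) * (curve_zr k Xc - x) < 0" using crit k x by (intro mult_pos_neg) auto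
    then have "Xc ^ 3 - k * (1 + x) * Xc + k * x < 0" using cubic_value[of Xc x] crit by simp
    ultimately obtain t where t: "1 < t" "t < Xc" "curve_cubic k (of_real x) (of_real t) = 0"
      using cubic_real_between[of 1 Xc x] crit k by auto
    have "p = of_real t"
      by (rule K0_unique[OF p(1) _ p(2) t(3)]) (use K0_real t crit in auto)
    moreover have "t\<^sup>2 > k" using t(1) k by (smt (verit) one_less_power pos2)
    ultimately show ?thesis using ang(1)[of t] t by simp
  qed
  show "upper_angle (curve_phi k p) = pi" if x: "0 < x" "x < curve_zr k Xb"
  proof -
    have "(1::real) ^ 3 - k * (1 + x) * 1 + k * x = 1 - k" by (simp add: algebra_simps)
    moreover have "k * (Xb - 1) * (curve_zr k Xb - x) < 0" using crit k x by (intro mult_neg_pos mult_pos_neg) auto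
    then have "Xb ^ 3 - k * (1 + x) * Xb + k * x < 0" using cubic_value[of Xb x] crit by simp
    ultimately obtain t where t: "Xb < t" "t < 1" "curve_cubic k (of_real x) (of_real t) = 0"
      using cubic_real_between[of Xb 1 x] crit k by auto
    have p': "p = of_real t"
      by (rule K0_unique[OF p(1) _ p(2) t(3)]) (use K0_real t crit in auto)
    have "t * (k - t\<^sup>2) / (k * (1 - t)) = x" using t cubic_real_iff[of t x] by (simp add: curve_zr_def)
    moreover have "t * (k - t\<^sup>2) / (k * (1 - t)) \<le> 0" if "t\<^sup>2 \<ge> k"
      using that t crit k by (intro divide_nonpos_pos mult_nonneg_nonpos mult_pos_pos) auto
    ultimately have "t\<^sup>2 < k" using x by (meson not_le)
    then show ?thesis using ang(2)[of t] p' t crit by simp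
  qed
qed

lemma upper_angle_K2:
  assumes p: "p \<in> K0" "curve_cubic k (of_real x) p = 0" and q: "q \<in> K2" "curve_cubic k (of_real x) q = 0"
  shows "x > 0 \<Longrightarrow> upper_angle (cnj (curve_phi k q)) = 0"
    and "curve_zr k Xa < x \<Longrightarrow> x < 0 \<Longrightarrow> upper_angle (cnj (curve_phi k q)) = pi"
proof -
  note ang = upper_angle_real_sheet[of cnj, OF disjI2[OF refl]]
  show "upper_angle (cnj (curve_phi k q)) = 0" if x: "x > 0"
  proof -
    have "Im q = 0" using middle_root_cnj_q(2)[OF p q] x by force
    then obtain t where t: "q = of_real t" by (metis complex_is_Real_iff Reals_cases)
    have tb: "t \<le> Xa" using q(1) K2_real t by auto
    have t1: "t \<noteq> 1" using tb crit by auto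
    have z: "t * (k - t\<^sup>2) / (k * (1 - t)) = x" using q(2) t t1 cubic_real_iff[OF t1] by (simp add: curve_zr_def)
    have "t\<^sup>2 > k"
    proof (rule ccontr)
      assume "\<not> t\<^sup>2 > k"
      then have "t * (k - t\<^sup>2) / (k * (1 - t)) \<le> 0"
        using tb crit k by (intro divide_nonpos_pos mult_nonpos_nonneg mult_pos_pos) auto
      then show False using z x by simp
    qed
    then show ?thesis using ang(1)[of t] t tb crit by simp
  qed
  show "upper_angle (cnj (curve_phi k q)) = pi" if x: "curve_zr k Xa < x" "x < 0"
  proof -
    \<comment> \<open>- sqrt k is the negative zero of z. From there to \<open>Xa\<close> the
      function z decreases from 0 to its critical value, so the root over x lies in between.\<close>
    define r where "r = - sqrt k"
    have r: "r\<^sup>2 = k" "r < 0" using k by (simp_all add: r_def)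
    have rXa: "r < Xa"
    proof -
      have "(- Xa)\<^sup>2 < (sqrt k)\<^sup>2" using Xa_sq k by simp
      then have "- Xa < sqrt k" by (rule power_less_imp_less_base) (use k in simp)
      then show ?thesis by (simp add: r_def)
    qed
    have "r ^ 3 = k * r" using r(1) by (simp add: power2_eq_square power3_eq_cube)
    then have "r ^ 3 - k * (1 + x) * r + k * x = k * x * (1 - r)" by (simp add: algebra_simps)
    moreover have "k * x * (1 - r) < 0"
      by (rule mult_neg_pos[OF mult_pos_neg[OF k(1) x(2)]]) (use r in linarith)
    moreover have "0 < k * (Xa - 1) * (curve_zr k Xa - x)"
      by (rule mult_neg_neg[OF mult_pos_neg[OF k(1)]]) (use crit x in linarith)+
    then have "0 < Xa ^ 3 - k * (1 + x) * Xa + k * x" using cubic_value[of Xa x] crit by simp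
    ultimately obtain t where t: "r < t" "t < Xa" "curve_cubic k (of_real x) (of_real t) = 0"
      using cubic_real_between[of r Xa x] rXa by auto
    have q': "q = of_real t"
      by (rule K2_unique[OF q(1) _ q(2) t(3)]) (use K2_real t crit in auto)
    have "(- t)\<^sup>2 < (- r)\<^sup>2" using t crit by (intro power_strict_mono) auto
    then have "t\<^sup>2 < k" using r by simp
    then show ?thesis using ang(2)[of t] q' t crit by simp
  qed
qed

text \<open>Beyond the critical value q is not real and lies on the curve (2 Re q + 1) |1 - q|^2 = 1
  - k, so -1/2 < Re q < 0. Then |x| <= 1 + |q|^2 / k, and for w = \<open>curve_w k q\<close> the
  angle is at most 2 |Im w| <= 2 k / |q|^3, whence the exponent -3/2. The condition x <= -4 ensures
  |q|^2 >= 2 k, so that Re w >= 1/2, and |q|^2 >= (k / 4) (1 + |x|).\<close>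

lemma upper_angle_K2_decay:
  assumes q: "q \<in> K2" "curve_cubic k (of_real x) q = 0" and x: "x < curve_zr k Xa" "x \<le> - 4"
  shows "upper_angle (cnj (curve_phi k q)) \<le> 2 * k * (k / 4) powr (- 3 / 2) * (1 + \<bar>x\<bar>) powr (- 3 / 2)"
proof -
  have q1: "q \<noteq> 1" using cubic_root_ne_1[OF q(2)] .
  have zq: "curve_z k q = of_real x" using curve_cubic_iff[of k q "of_real x"] k q1 q(2) by auto
  have req: "Re q < 0" using K_Re_nonzero(2)[OF q(1)] q(1) by (simp add: K2_def)
  have imq: "Im q > 0"
  proof (rule ccontr)
    assume "\<not> Im q > 0"
    then have "Im q = 0" using q(1) by (simp add: K2_def)
    then obtain t where t: "q = of_real t" by (metis complex_is_Real_iff Reals_cases)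
    have tb: "t \<le> Xa" using q(1) K2_real t by auto
    have zt: "curve_zr k t = x" using zq t by (simp add: curve_z_of_real)
    have "curve_zr k Xa \<le> curve_zr k t"
    proof (cases "t = Xa")
      case False
      then show ?thesis using curve_zr_strict_decreasing[of t Xa] tb crit by force
    qed simp
    then show False using zt x by simp
  qed
  have q0: "q \<noteq> 0" using imq by auto
  have reh: "Re q > - 1 / 2"
  proof -
    have "Im q * ((2 * Re q + 1) * (cmod (1 - q))\<^sup>2 - (1 - k)) / (k * (cmod (1 - q))\<^sup>2) = 0"
      using Im_curve_z[OF k(1) q1] zq by simp
    then have "(2 * Re q + 1) * (cmod (1 - q))\<^sup>2 = 1 - k" using imq k q1 by simp
    then have "0 < (2 * Re q + 1) * (cmod (1 - q))\<^sup>2" using k by simp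
    moreover have "0 < (cmod (1 - q))\<^sup>2" using q1 by simp
    ultimately have "0 < 2 * Re q + 1" by (rule zero_less_mult_pos2)
    then show ?thesis by simp
  qed
  define n where "n = cmod q"
  have n0: "n > 0" using q0 by (simp add: n_def)
  have n1: "n \<le> cmod (1 - q)"
  proof -
    have "n\<^sup>2 \<le> (cmod (1 - q))\<^sup>2" unfolding n_def cmod_power2 using req by (simp add: power2_eq_square algebra_simps)
    then show ?thesis by (rule power2_le_imp_le) simp
  qed
  have xb: "\<bar>x\<bar> \<le> (k + n\<^sup>2) / k"
  proof -
    have "\<bar>x\<bar> = cmod (curve_z k q)" by (simp add: zq)
    also have "\<dots> = n * cmod (of_real k - q\<^sup>2) / (k * cmod (1 - q))"
      using k unfolding curve_z_def by (simp only: norm_divide norm_mult norm_of_real abs_of_pos n_def)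
    also have "\<dots> \<le> n * (k + n\<^sup>2) / (k * n)"
    proof (rule frac_le)
      have "cmod (of_real k - q\<^sup>2) \<le> cmod (of_real k) + cmod (q\<^sup>2)" by (rule norm_triangle_ineq4)
      also have "\<dots> = k + n\<^sup>2" using k by (simp add: norm_power n_def)
      finally show "n * cmod (of_real k - q\<^sup>2) \<le> n * (k + n\<^sup>2)" using n0 by (intro mult_left_mono) auto
      show "k * n \<le> k * cmod (1 - q)" using n1 k by (intro mult_left_mono) auto
    qed (use k n0 in auto)
    also have "\<dots> = (k + n\<^sup>2) / k" using n0 by simp
    finally show ?thesis .
  qed
  have nx: "k * (\<bar>x\<bar> - 1) \<le> n\<^sup>2" using xb k by (simp add: pos_le_divide_eq algebra_simps)
  have n2: "k / 4 * (1 + \<bar>x\<bar>) \<le> n\<^sup>2"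
  proof -
    have "k / 4 * (1 + \<bar>x\<bar>) \<le> k * (\<bar>x\<bar> - 1)"
    proof -
      have "k * ((1 + \<bar>x\<bar>) / 4) \<le> k * (\<bar>x\<bar> - 1)" using x k by (intro mult_left_mono) auto
      then show ?thesis by simp
    qed
    then show ?thesis using nx by simp
  qed
  have n3: "2 * k \<le> n\<^sup>2"
  proof -
    have "k * 2 \<le> k * (\<bar>x\<bar> - 1)" using x k by (intro mult_left_mono) auto
    then show ?thesis using nx by simp
  qed
  define w where "w = curve_w k q"
  have imw: "Im w = 2 * k * (Re q * Im q) / n ^ 4" unfolding w_def n_def by (rule Im_curve_w[OF q0])
  have imneg: "Im w < 0" unfolding w_def by (rule Im_curve_w_sign(2)[OF imq req])
  have rew: "Re w \<ge> 1 / 2"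
  proof -
    have "Re (of_real k / q\<^sup>2) \<le> cmod (of_real k / q\<^sup>2)" by (rule complex_Re_le_cmod)
    also have "\<dots> = k / n\<^sup>2" using k by (simp add: norm_divide norm_power n_def)
    also have "\<dots> \<le> 1 / 2" using n3 n0 by (simp add: divide_simps)
    finally show ?thesis by (simp add: w_def curve_w_def)
  qed
  have cphi: "cnj (curve_phi k q) = of_real (1 / (1 - k)) * cnj w"
    unfolding curve_phi_eq_w[OF q0] w_def complex_cnj_divide complex_cnj_complex_of_real
    by (simp only: of_real_divide of_real_1 times_divide_eq_left mult_1_left)
  have pos: "Im (cnj (curve_phi k q)) > 0" using imneg k unfolding cphi by (simp add: divide_neg_pos)
  have wn: "cnj w \<noteq> 0" using imneg by auto
  have "upper_angle (cnj (curve_phi k q)) = Im (Ln (cnj (curve_phi k q)))" by (rule upper_angle_eq_Im_Ln[OF pos])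
  also have "\<dots> = Im (Ln (cnj w))"
    unfolding cphi using Ln_times_of_real[of "1 / (1 - k)" "cnj w"] Ln_of_real[of "1 / (1 - k)"] k wn by simp
  also have "\<dots> = arctan (Im (cnj w) / Re (cnj w))" using Im_Ln_eq[OF wn] rew by simp
  also have "\<dots> \<le> \<bar>Im (cnj w) / Re (cnj w)\<bar>" using abs_arctan_le[of "Im (cnj w) / Re (cnj w)"] by simp
  also have "\<dots> \<le> 2 * \<bar>Im w\<bar>"
  proof -
    have "\<bar>Im w\<bar> / Re w \<le> \<bar>Im w\<bar> / (1 / 2)" using rew by (intro divide_left_mono) auto
    then show ?thesis using rew by (simp add: abs_divide)
  qed
  also have "\<dots> \<le> 2 * (k / n ^ 3)"
  proof -
    have "\<bar>Re q * Im q\<bar> \<le> 1 / 2 * n"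
      unfolding abs_mult n_def using req reh abs_Im_le_cmod[of q] by (intro mult_mono) auto
    then have "2 * k * \<bar>Re q * Im q\<bar> / n ^ 4 \<le> 2 * k * (1 / 2 * n) / n ^ 4"
      using k n0 by (intro divide_right_mono mult_left_mono) auto
    moreover have "2 * k * (1 / 2 * n) / n ^ 4 = k / n ^ 3" 
    proof -
      have "n ^ 4 = n * n ^ 3" by (simp add: power_Suc[symmetric])
      then show ?thesis using n0 by simp
    qed
    moreover have "\<bar>Im w\<bar> = 2 * k * \<bar>Re q * Im q\<bar> / n ^ 4" unfolding imw using k n0 by (simp add: abs_mult abs_divide)
    ultimately show ?thesis by simp
  qed
  also have "k / n ^ 3 = k * (n\<^sup>2) powr (- 3 / 2)"
  proof -
    have "(n\<^sup>2) powr (- 3 / 2) = (n powr 2) powr (- 3 / 2)" using n0 by (simp add: powr_numeral)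
    also have "\<dots> = n powr (- 3)" by (simp add: powr_powr)
    also have "\<dots> = 1 / n powr 3" by (rule powr_minus_divide)
    also have "\<dots> = 1 / n ^ 3" using n0 by (simp add: powr_numeral)
    finally show ?thesis by simp
  qed
  also have "(n\<^sup>2) powr (- 3 / 2) \<le> (k / 4 * (1 + \<bar>x\<bar>)) powr (- 3 / 2)"
    by (rule powr_mono2') (use n2 k in \<open>auto intro!: mult_pos_pos\<close>)
  also have "(k / 4 * (1 + \<bar>x\<bar>)) powr (- 3 / 2) = (k / 4) powr (- 3 / 2) * (1 + \<bar>x\<bar>) powr (- 3 / 2)"
    by (rule powr_mult)
  finally show ?thesis using k by (simp add: mult_ac)
qed

lemma second_density_log_integrable:
  fixes \<rho> :: "real \<Rightarrow> real"
  assumes P: "\<And>x. P x \<in> K0" "\<And>x. curve_cubic k (of_real x) (P x) = 0" "\<And>x. Q x \<in> K2" "\<And>x. curve_cubic k (of_real x) (Q x) = 0"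
    and \<rho>: "\<And>x. x \<noteq> 0 \<Longrightarrow> pi * \<rho> x = upper_angle (cnj (curve_phi k (Q x)))" "\<rho> \<in> borel_measurable borel"
      "\<And>x. 0 \<le> \<rho> x" "\<And>x. \<rho> x \<le> 1"
  shows "integrable lborel (\<lambda>t. \<rho> t * ln (1 + \<bar>t\<bar>))"
proof -
  define R where "R = 4 + \<bar>curve_zr k Xa\<bar>"
  \<comment> \<open>The second summand makes the bound at least 1 for |t| <= R, where the density is
    only known to be at most 1; the first is the decay constant for t < - R.\<close>
  define K where "K = 2 * k * (k / 4) powr (- 3 / 2) / pi + (1 + R) powr (3 / 2)"
  show ?thesis
  proof (rule integrable_density_log_of_powr_bound[OF \<rho>(3,2)])
    fix t :: real
    have b0: "(1 + \<bar>t\<bar>) powr (- 3 / 2) \<ge> 0" by simp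
    consider "t > 0" | "- R \<le> t" "t \<le> 0" | "t < - R" by linarith
    then show "\<rho> t \<le> K * (1 + \<bar>t\<bar>) powr (- 3 / 2)"
    proof cases
      case 1
      have "pi * \<rho> t = 0" using \<rho>(1)[of t] upper_angle_K2(1)[OF P(1,2,3,4)[of t] 1] 1 by simp
      then have "\<rho> t = 0" by simp
      then show ?thesis using k by (auto simp: K_def intro!: mult_nonneg_nonneg add_nonneg_nonneg)
    next
      case 2
      have "1 = (1 + R) powr (3 / 2) * (1 + R) powr (- 3 / 2)" by (simp add: powr_add[symmetric] R_def)
      also have "\<dots> \<le> (1 + R) powr (3 / 2) * (1 + \<bar>t\<bar>) powr (- 3 / 2)"
        using 2 by (intro mult_left_mono powr_mono2') auto
      also have "\<dots> \<le> K * (1 + \<bar>t\<bar>) powr (- 3 / 2)" using k by (intro mult_right_mono) (auto simp: K_def)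
      finally show ?thesis using \<rho>(4)[of t] by linarith
    next
      case 3
      have t: "t < curve_zr k Xa" "t \<le> - 4" "t \<noteq> 0" using 3 by (auto simp: R_def)
      have "pi * \<rho> t \<le> 2 * k * (k / 4) powr (- 3 / 2) * (1 + \<bar>t\<bar>) powr (- 3 / 2)"
        using upper_angle_K2_decay[OF P(3,4) t(1,2)] \<rho>(1)[OF t(3)] by simp
      then have "\<rho> t \<le> 2 * k * (k / 4) powr (- 3 / 2) / pi * (1 + \<bar>t\<bar>) powr (- 3 / 2)"
        by (simp add: pos_le_divide_eq mult.commute)
      also have "\<dots> \<le> K * (1 + \<bar>t\<bar>) powr (- 3 / 2)" by (intro mult_right_mono b0) (simp add: K_def)
      finally show ?thesis .
    qed
  qed
qed

end

section \<open>The solution of the equilibrium problem\<close>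

lemma filterlim_negative_imaginary:
  "filterlim (\<lambda>n. Complex 0 (- real (Suc n))) (inf at_infinity (principal {z. Im z < 0})) sequentially"
proof -
  have "filterlim (\<lambda>n. Complex 0 (- real (Suc n))) at_infinity sequentially"
  proof (rule filterlim_norm_at_top_imp_at_infinity)
    have "norm (Complex 0 (- real (Suc n))) = real (Suc n)" for n by (simp add: cmod_def del: of_nat_Suc)
    then show "filterlim (\<lambda>n. norm (Complex 0 (- real (Suc n)))) at_top sequentially" by simp real_asymp
  qed
  then show ?thesis by (intro filterlim_inf[THEN iffD2] conjI) (auto simp: filterlim_principal)
qed

text \<open>Since f stays in the upper half plane, the principal branch is holomorphic along it. The
  difference of the two logarithms has derivative 0 and tends to 0 at infinity.\<close>

lemma holomorphic_log_eq_Ln: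
  assumes H: "H holomorphic_on {z. Im z < 0}" and f: "f holomorphic_on {z. Im z < 0}"
    and exp: "\<And>z. Im z < 0 \<Longrightarrow> exp (H z) = f z" and im: "\<And>z. Im z < 0 \<Longrightarrow> Im (f z) > 0"
    and H0: "(H \<longlongrightarrow> 0) at_infinity" and f1: "(f \<longlongrightarrow> 1) at_infinity" and z: "Im z < 0"
  shows "H z = Ln (f z)"
proof -
  have oH: "open {z::complex. Im z < 0}" by (simp add: open_halfspace_Im_lt)
  have "\<exists>c. \<forall>z\<in>{z. Im z < 0}. H z - Ln (f z) = c"
  proof (rule has_field_derivative_zero_constant[OF convex_halfspace_Im_lt])
    fix z assume z: "z \<in> {z. Im z < 0}"
    obtain h where h: "(H has_field_derivative h) (at z)"
      using holomorphic_on_imp_differentiable_at[OF H oH z] by (auto simp: field_differentiable_def)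
    obtain d where d: "(f has_field_derivative d) (at z)"
      using holomorphic_on_imp_differentiable_at[OF f oH z] by (auto simp: field_differentiable_def)
    have nz: "f z \<notin> \<real>\<^sub>\<le>\<^sub>0" "f z \<noteq> 0" using im[of z] z by (auto simp: complex_nonpos_Reals_iff)
    have "((\<lambda>z. exp (H z)) has_field_derivative exp (H z) * h) (at z)" by (rule DERIV_chain2[OF DERIV_exp h])
    moreover have "eventually (\<lambda>z. exp (H z) = f z) (nhds z)"
      using eventually_nhds_in_open[OF oH z] by eventually_elim (simp add: exp)
    ultimately have "(f has_field_derivative exp (H z) * h) (at z)"
      using DERIV_cong_ev[OF refl _ refl, of "\<lambda>z. exp (H z)" f z] by blast
    then have "d = f z * h" using DERIV_unique[OF d] exp[of z] z by simp
    then have "h - inverse (f z) * d = 0" using nz by simp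
    moreover have "((\<lambda>z. H z - Ln (f z)) has_field_derivative h - inverse (f z) * d) (at z)"
      by (rule DERIV_diff[OF h DERIV_chain2[OF has_field_derivative_Ln[OF nz(1)] d]])
    ultimately have "((\<lambda>z. H z - Ln (f z)) has_field_derivative 0) (at z)" by simp
    then show "((\<lambda>z. H z - Ln (f z)) has_field_derivative 0) (at z within {z. Im z < 0})"
      by (rule has_field_derivative_at_within)
  qed
  then obtain c where c: "\<And>z. Im z < 0 \<Longrightarrow> H z - Ln (f z) = c" by auto
  have "((\<lambda>z. H z - Ln (f z)) \<longlongrightarrow> 0 - Ln 1) at_infinity"
    by (intro tendsto_intros H0 f1) auto
  then have "((\<lambda>z. H z - Ln (f z)) \<longlongrightarrow> 0) (inf at_infinity (principal {z. Im z < 0}))"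
    by (intro tendsto_mono[OF inf_le1]) simp
  from filterlim_compose[OF this filterlim_negative_imaginary]
  have "(\<lambda>n::nat. c) \<longlonglongrightarrow> 0" by (simp add: c)
  then have "c = 0" by (simp add: LIMSEQ_const_iff)
  then show ?thesis using c[OF z] by simp
qed

theorem proposition2p2:
  fixes c \<sigma> e2 :: real and phi0 H :: "complex \<Rightarrow> complex"
  assumes c: "0 < c" "c < 1" and \<sigma>: "\<sigma> = 1 / c"
    and e2_pos: "0 < e2"
    and e2_branch: "branch_point (phi_poly \<sigma>) (complex_of_real e2)"
    and e2_largest:
      "\<And>x::real. 0 < x \<Longrightarrow> branch_point (phi_poly \<sigma>) (complex_of_real x) \<Longrightarrow> x \<le> e2"
    and phi0_holo: "phi0 holomorphic_on (UNIV - complex_of_real ` {0..e2})"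
    and phi0_root:
      "\<And>z. z \<notin> complex_of_real ` {0..e2} \<Longrightarrow> poly (phi_poly \<sigma> z) (phi0 z) = 0"
    and phi0_inf: "(\<lambda>z. phi0 z - (1 + 2 / z)) \<in> O[at_infinity](\<lambda>z. 1 / z\<^sup>2)"
    and H_holo: "H holomorphic_on (UNIV - complex_of_real ` {0..e2})"
    and H_log: "\<And>z. z \<notin> complex_of_real ` {0..e2} \<Longrightarrow> exp (H z) = phi0 z"
    and H_inf: "(H \<longlongrightarrow> 0) at_infinity"
  shows "\<exists>lam mu \<rho>.
      solves_E2 c lam mu \<and>
      absolutely_continuous lborel lam \<and>
      supp lam \<subseteq> {0..e2} \<and>
      \<rho> \<in> borel_measurable borel \<and>
      lam = density lborel (\<lambda>x. ennreal (\<rho> x * indicator {0..e2} x)) \<and>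
      (\<forall>x\<in>{0..e2}. 0 \<le> \<rho> x \<and>
         ((\<lambda>y::real. 1 / pi * Im (H (Complex x y))) \<longlongrightarrow> \<rho> x) (at_left 0))"
proof -
  define k where "k = 1 - c"
  have k: "0 < k" "k < 1" and ck: "c = 1 - k" using c by (auto simp: k_def)
  have \<sigma>k: "\<sigma> = 1 / (1 - k)" using \<sigma> ck by simp
  obtain Xa Xb Xc where X: "-1/2 < Xa" "Xa < 0" "0 < Xb" "Xb < 1" "1 < Xc"
    "\<And>x. (2 * x + 1) * (1 - x)\<^sup>2 - c = 2 * ((x - Xa) * ((x - Xb) * (x - Xc)))"
    using critical_points_exist[OF c] by blast
  interpret spectral_curve k Xa Xb Xc
    by unfold_locales (use k X ck in auto)
  define S where "S = complex_of_real ` {0..e2}"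
  have cS: "closed S" unfolding S_def
    by (intro compact_imp_closed compact_continuous_image continuous_intros) auto
  have oS: "open (UNIV - S)" using cS by (simp add: open_Diff)
  have HmS: "{z. Im z < 0} \<subseteq> UNIV - S" by (auto simp: S_def)
  have z0S: "z \<noteq> 0" if "z \<notin> S" for z using that e2_pos by (auto simp: S_def image_iff)
  define q0 where "q0 z = z * (phi0 z - of_real \<sigma>) / (z * (phi0 z - of_real \<sigma>) + phi0 z)" for z
  note cp = curve_parameter[OF k \<sigma>k phi0_root[folded S_def] z0S q0_def]
  have q0_holo: "q0 holomorphic_on (UNIV - S)"
    unfolding q0_def by (intro holomorphic_intros phi0_holo[folded S_def]) (use cp(1) in auto)
  have q0_root: "curve_cubic k z (q0 z) = 0" and q0_phi: "curve_phi k (q0 z) = phi0 z" if "z \<notin> S" for z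
    using cp(4,5)[OF that that] by auto
  have q0_holo': "q0 holomorphic_on {z. Im z < 0}" by (rule holomorphic_on_subset[OF q0_holo HmS])

  \<comment> \<open>Behaviour of phi_0 and q_0 at infinity\<close>
  have phi_z: "((\<lambda>z. z * (phi0 z - 1)) \<longlongrightarrow> 2) at_infinity"
  proof -
    obtain B where B: "eventually (\<lambda>z. norm (phi0 z - (1 + 2 / z)) \<le> B * norm (1 / z\<^sup>2)) at_infinity"
      using phi0_inf by (auto elim: landau_o.bigE)
    have nz: "eventually (\<lambda>z::complex. z \<noteq> 0) at_infinity"
      by (auto simp: eventually_at_infinity intro!: exI[of _ 1])
    have i0: "((\<lambda>z::complex. B * norm (inverse z)) \<longlongrightarrow> B * norm (0::complex)) at_infinity"
      by (intro tendsto_intros tendsto_inverse_0)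
    have "((\<lambda>z. z * (phi0 z - (1 + 2 / z))) \<longlongrightarrow> 0) at_infinity"
    proof (rule Lim_null_comparison)
      show "eventually (\<lambda>z. norm (z * (phi0 z - (1 + 2 / z))) \<le> B * norm (inverse z)) at_infinity"
        using B nz
      proof eventually_elim
        case (elim z)
        have "norm (z * (phi0 z - (1 + 2 / z))) \<le> norm z * (B * norm (1 / z\<^sup>2))"
          unfolding norm_mult by (intro mult_left_mono elim) auto
        also have "\<dots> = B * norm (inverse z)"
          using elim(2) by (simp add: norm_divide norm_inverse norm_mult power2_eq_square divide_inverse)
        finally show ?case .
      qed
    qed (use i0 in simp)
    from tendsto_add[OF this tendsto_const[of 2]]
    have t: "((\<lambda>z. z * (phi0 z - (1 + 2 / z)) + 2) \<longlongrightarrow> 2) at_infinity" by simp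
    show ?thesis
      by (rule Lim_transform_eventually[OF t]) (use nz in eventually_elim, simp add: field_simps)
  qed
  have phi_u: "((\<lambda>z. phi0 z - 1) \<longlongrightarrow> 0) at_infinity"
  proof -
    have t: "((\<lambda>z. z * (phi0 z - 1) * inverse z) \<longlongrightarrow> 2 * 0) at_infinity"
      by (intro tendsto_mult phi_z tendsto_inverse_0)
    show ?thesis
    proof (rule Lim_transform_eventually)
      show "((\<lambda>z. z * (phi0 z - 1) * inverse z) \<longlongrightarrow> 0) at_infinity" using t by simp
      show "eventually (\<lambda>z. z * (phi0 z - 1) * inverse z = phi0 z - 1) at_infinity"
      proof -
        have "eventually (\<lambda>z::complex. z \<noteq> 0) at_infinity"
          by (auto simp: eventually_at_infinity intro!: exI[of _ 1])
        then show ?thesis by eventually_elim simp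
      qed
    qed
  qed
  have phi1: "(phi0 \<longlongrightarrow> 1) at_infinity" using tendsto_add[OF phi_u tendsto_const[of 1]] by simp

  have q0_inf: "((\<lambda>z. 1 - q0 z) \<longlongrightarrow> 0) at_infinity"
  proof -
    have \<sigma>1: "1 - complex_of_real \<sigma> \<noteq> 0"
    proof -
      have "\<sigma> \<noteq> 1" using c \<sigma> by auto
      then show ?thesis by (metis of_real_1 of_real_eq_iff right_minus_eq)
    qed
    \<comment> \<open>This is 1 - q_0 with numerator and denominator divided by z. The denominator
      tends to 1 - sigma, which is not 0.\<close>
    have "((\<lambda>z. phi0 z * inverse z / ((phi0 z - of_real \<sigma>) + phi0 z * inverse z)) \<longlongrightarrow> 1 * 0 / ((1 - of_real \<sigma>) + 1 * 0)) at_infinity"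
      by (intro tendsto_intros phi1 tendsto_inverse_0) (use \<sigma>1 in auto)
    then have t: "((\<lambda>z. phi0 z * inverse z / ((phi0 z - of_real \<sigma>) + phi0 z * inverse z)) \<longlongrightarrow> 0) at_infinity" by simp
    have "eventually (\<lambda>z. z \<notin> S) at_infinity"
    proof -
      have "bounded S" unfolding S_def by (intro compact_imp_bounded compact_continuous_image continuous_intros) auto
      then obtain b where b: "\<And>z. z \<in> S \<Longrightarrow> norm z \<le> b" by (auto simp: bounded_iff)
      have "z \<notin> S" if "norm z \<ge> b + 1" for z using b[of z] that by auto
      then show ?thesis by (auto simp: eventually_at_infinity)
    qed
    then have "eventually (\<lambda>z. phi0 z * inverse z / ((phi0 z - of_real \<sigma>) + phi0 z * inverse z) = 1 - q0 z) at_infinity"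
    proof eventually_elim
      case (elim z)
      have z: "z \<noteq> 0" using z0S elim by auto
      have d: "z * (phi0 z - of_real \<sigma>) + phi0 z \<noteq> 0" using cp(1)[OF elim elim] .
      have "1 - q0 z = phi0 z / (z * (phi0 z - of_real \<sigma>) + phi0 z)"
        unfolding q0_def using d by (simp add: field_simps)
      also have "\<dots> = (z * (phi0 z * inverse z)) / (z * ((phi0 z - of_real \<sigma>) + phi0 z * inverse z))"
      proof -
        have e: "z * (phi0 z * inverse z) = phi0 z" using z by (simp add: field_simps)
        show ?thesis by (simp only: distrib_left e)
      qed
      also have "\<dots> = phi0 z * inverse z / ((phi0 z - of_real \<sigma>) + phi0 z * inverse z)"
        by (rule mult_divide_mult_cancel_left[OF z])
      finally show ?case by simp
    qed
    then show ?thesis by (rule Lim_transform_eventually[OF t])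
  qed

  \<comment> \<open>The branches q_0 and q_2 over the lower half plane\<close>
  have q0_quad: "Im (q0 z) > 0 \<and> Re (q0 z) > 0" if z: "Im z < 0" for z
  proof -
    \<comment> \<open>The bound 1/2 keeps Re q positive, and (1 - k) / 4 gives (2 Re q + 1) |1 -
      q|^2 <= (1 - k) / 2, which excludes a root in the lower half plane.\<close>
    define \<delta> where "\<delta> = min (1 / 2) ((1 - k) / 4)"
    have \<delta>: "\<delta> > 0" "\<delta> \<le> 1 / 2" "\<delta> \<le> (1 - k) / 4" using k unfolding \<delta>_def by auto
    have "eventually (\<lambda>z. norm (1 - q0 z) < \<delta>) (inf at_infinity (principal {z. Im z < 0}))"
      using tendstoD[OF tendsto_mono[OF inf_le1 q0_inf] \<delta>(1)] by (simp add: dist_norm)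
    then have "eventually (\<lambda>n. norm (1 - q0 (Complex 0 (- real (Suc n)))) < \<delta>) sequentially"
      by (rule eventually_compose_filterlim[OF _ filterlim_negative_imaginary])
    then obtain n where n: "norm (1 - q0 (Complex 0 (- real (Suc n)))) < \<delta>"
      by (auto simp: eventually_sequentially)
    define z1 where "z1 = Complex 0 (- real (Suc n))"
    have z1: "Im z1 < 0" by (simp add: z1_def)
    have n1: "cmod (1 - q0 z1) < \<delta>" using n by (simp add: z1_def)
    have r1: "curve_cubic k z1 (q0 z1) = 0" using q0_root[of z1] z1 HmS by auto
    have re: "\<bar>1 - Re (q0 z1)\<bar> < \<delta>" using abs_Re_le_cmod[of "1 - q0 z1"] n1 by simp
    have "Im (q0 z1) > 0"
    proof (rule ccontr)
      assume "\<not> Im (q0 z1) > 0"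
      then have "Im (q0 z1) < 0" using lower_root_cases(1)[OF z1 r1] by linarith
      then have "1 - k < (2 * Re (q0 z1) + 1) * (cmod (1 - q0 z1))\<^sup>2" by (rule lower_root_cases(3)[OF z1 r1])
      also have "\<dots> \<le> 4 * (1 / 2 * \<delta>)"
      proof (rule mult_mono)
        show "2 * Re (q0 z1) + 1 \<le> 4" using re \<delta> by linarith
        show "(cmod (1 - q0 z1))\<^sup>2 \<le> 1 / 2 * \<delta>"
          unfolding power2_eq_square using n1 \<delta> by (intro mult_mono) auto
      qed auto
      also have "\<dots> \<le> (1 - k) / 2" using \<delta> by simp
      finally show False using k by simp
    qed
    moreover have "Re (q0 z1) > 0" using re \<delta> by linarith
    ultimately show ?thesis
      using lower_branch_quadrant[OF holomorphic_on_imp_continuous_on[OF q0_holo'] _ _ z1 _ _ z, of 1] q0_root HmS by auto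
  qed
  have q0_rootH: "curve_cubic k z (q0 z) = 0" if "Im z < 0" for z using q0_root HmS that by auto
  have q0K: "q0 z \<in> K0 \<and> curve_cubic k z (q0 z) = 0" if "Im z < 0" for z
    using q0_quad[OF that] q0_rootH[OF that] lower_root_cases(2)[OF that q0_rootH[OF that]] by (auto simp: K0_def)
  have phi_im: "Im (curve_phi k (q0 z)) > 0" if "Im z < 0" for z
  proof -
    have "Im (curve_w k (q0 z)) > 0" using Im_curve_w_sign(1) q0_quad[OF that] by blast
    moreover have "q0 z \<noteq> 0" using q0_quad[OF that] by auto
    ultimately show ?thesis using k by (simp add: curve_phi_eq_w Im_divide_of_real)
  qed
  obtain q2 where q2: "q2 holomorphic_on {z. Im z < 0}" "\<And>z. Im z < 0 \<Longrightarrow> curve_cubic k z (q2 z) = 0"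
    "\<And>z. Im z < 0 \<Longrightarrow> Im (q2 z) > 0 \<and> Re (q2 z) < 0"
    using second_sheet_exists[OF q0_holo' q0_rootH q0_quad] by blast
  have q2K: "q2 z \<in> K2 \<and> curve_cubic k z (q2 z) = 0" if "Im z < 0" for z
    using q2(3)[OF that] q2(2)[OF that] lower_root_cases(2)[OF that q2(2)[OF that]] by (auto simp: K2_def)
  have w2_im: "Im (curve_w k (q2 z)) < 0" if "Im z < 0" for z
    using Im_curve_w_sign(2) q2(3)[OF that] by blast
  have phi2: "cnj (curve_phi k (q2 z)) = of_real (1 / (1 - k)) * cnj (curve_w k (q2 z))" if "Im z < 0" for z
  proof -
    have "q2 z \<noteq> 0" using q2(3)[OF that] by auto
    then show ?thesis unfolding curve_phi_eq_w[OF \<open>q2 z \<noteq> 0\<close>] complex_cnj_divide complex_cnj_complex_of_real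
      by (simp only: of_real_divide of_real_1 times_divide_eq_left mult_1_left)
  qed
  have phi2_im: "Im (cnj (curve_phi k (q2 z))) > 0" if "Im z < 0" for z
    unfolding phi2[OF that] using w2_im[OF that] k by (simp add: divide_neg_pos)

  \<comment> \<open>The two logarithms as Cauchy transforms\<close>
  have H_Ln: "H z = Ln (phi0 z)" if "Im z < 0" for z
    by (rule holomorphic_log_eq_Ln[OF holomorphic_on_subset[OF H_holo[folded S_def] HmS]
          holomorphic_on_subset[OF phi0_holo[folded S_def] HmS] _ _ H_inf phi1 that])
      (use H_log[folded S_def] HmS phi_im q0_phi in fastforce)+
  have H_im: "Im (H z) = Im (Ln (curve_phi k (q0 z)))" if "Im z < 0" for z
    using H_Ln[OF that] q0_phi[of z] HmS that by auto
  have H_lim: "((\<lambda>z. z * H z) \<longlongrightarrow> of_real 2) (inf at_infinity (principal {z. Im z < 0}))"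
  proof -
    have t: "((\<lambda>z. z * Ln (1 + (phi0 z - 1))) \<longlongrightarrow> 2) (inf at_infinity (principal {z. Im z < 0}))"
      by (rule tendsto_mult_Ln_one_plus[OF tendsto_mono[OF inf_le1 phi_u] tendsto_mono[OF inf_le1 phi_z]])
    have "eventually (\<lambda>z. z * Ln (1 + (phi0 z - 1)) = z * H z) (inf at_infinity (principal {z. Im z < 0}))"
      unfolding eventually_inf_principal by (intro always_eventually allI impI) (simp add: H_Ln)
    from Lim_transform_eventually[OF t this] show ?thesis by simp
  qed
  obtain \<rho>0 P where P: "\<And>x. P x \<in> K0" "\<And>x. curve_cubic k (of_real x) (P x) = 0"
      "\<And>x. ((\<lambda>y. q0 (Complex x y)) \<longlongrightarrow> P x) (at_left 0)"
    and \<rho>0_lim: "\<And>x. ((\<lambda>y. Im (H (Complex x y))) \<longlongrightarrow> pi * \<rho>0 x) (at_left 0)"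
    and \<rho>0_val: "\<And>x. x \<noteq> 0 \<Longrightarrow> pi * \<rho>0 x = upper_angle (curve_phi k (P x))"
    and \<rho>0: "\<rho>0 \<in> borel_measurable borel" "\<And>x. 0 \<le> \<rho>0 x" "\<And>x. \<rho>0 x \<le> 1" "integrable lborel \<rho>0" "integral\<^sup>L lborel \<rho>0 = 2"
      "\<And>z. Im z < 0 \<Longrightarrow> H z = (\<integral>t. of_real (\<rho>0 t) / (z - of_real t) \<partial>lborel)"
    apply (rule sheet_density[OF disjI1[OF refl] closed_K(1) K_Re_nonzero(1) K0_unique q0K phi_im
          holomorphic_on_subset[OF H_holo[folded S_def] HmS] H_im H_lim]; assumption?)
    subgoal premises prems by (rule prems(1)[OF prems(2-)])
    done
  \<comment> \<open>This is ln (sigma / phi_2). The minus sign acts on the imaginary part like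
    conjugation of phi_2, and the factor sigma makes the function vanish at infinity.\<close>
  define F2 where "F2 z = - Ln (curve_w k (q2 z))" for z
  have F2_holo: "F2 holomorphic_on {z. Im z < 0}"
  proof -
    have n0: "q2 z \<noteq> 0" if "Im z < 0" for z using q2(3)[OF that] by auto
    have n1: "1 - of_real k / (q2 z)\<^sup>2 \<notin> \<real>\<^sub>\<le>\<^sub>0" if "Im z < 0" for z
      using w2_im[OF that] unfolding curve_w_def by (auto simp: complex_nonpos_Reals_iff)
    show ?thesis unfolding F2_def curve_w_def
      by (intro holomorphic_intros q2(1)) (use n0 n1 in auto)
  qed
  have F2_im: "Im (F2 z) = Im (Ln (cnj (curve_phi k (q2 z))))" if z: "Im z < 0" for z
  proof -
    have nr: "curve_w k (q2 z) \<notin> \<real>\<^sub>\<le>\<^sub>0" and nz: "cnj (curve_w k (q2 z)) \<noteq> 0"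
      using w2_im[OF z] by (auto simp: complex_nonpos_Reals_iff)
    have "Ln (cnj (curve_phi k (q2 z))) = Ln (of_real (1 / (1 - k))) + Ln (cnj (curve_w k (q2 z)))"
      unfolding phi2[OF z] using Ln_times_of_real[of "1 / (1 - k)" "cnj (curve_w k (q2 z))"] k nz by simp
    moreover have "Im (Ln (complex_of_real (1 / (1 - k)))) = 0" using Ln_of_real[of "1 / (1 - k)"] k by simp
    moreover have "Ln (cnj (curve_w k (q2 z))) = cnj (Ln (curve_w k (q2 z)))" using cnj_Ln[OF nr] by simp
    ultimately show ?thesis by (simp add: F2_def)
  qed
  have F2_lim: "((\<lambda>z. z * F2 z) \<longlongrightarrow> of_real 1) (inf at_infinity (principal {z. Im z < 0}))"
    using second_sheet_at_infinity[OF q2(2)] q2(3) unfolding F2_def by simp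
  obtain \<rho>2 Q where Q: "\<And>x. Q x \<in> K2" "\<And>x. curve_cubic k (of_real x) (Q x) = 0"
      "\<And>x. ((\<lambda>y. q2 (Complex x y)) \<longlongrightarrow> Q x) (at_left 0)"
    and \<rho>2_val: "\<And>x. x \<noteq> 0 \<Longrightarrow> pi * \<rho>2 x = upper_angle (cnj (curve_phi k (Q x)))"
    and \<rho>2: "\<rho>2 \<in> borel_measurable borel" "\<And>x. 0 \<le> \<rho>2 x" "\<And>x. \<rho>2 x \<le> 1" "integrable lborel \<rho>2" "integral\<^sup>L lborel \<rho>2 = 1"
      "\<And>z. Im z < 0 \<Longrightarrow> F2 z = (\<integral>t. of_real (\<rho>2 t) / (z - of_real t) \<partial>lborel)"
    apply (rule sheet_density[OF disjI2[OF refl] closed_K(2) K_Re_nonzero(2) K2_unique q2K phi2_im F2_holo F2_im F2_lim]; assumption?)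
    subgoal premises prems by (rule prems(1)[OF prems(2-4,6-)])
    done
  note PQ = P(1,2) Q(1,2)

  \<comment> \<open>The critical values and the endpoint e_2\<close>
  define E1 Em Ec where "E1 = curve_zr k Xb" and "Em = curve_zr k Xa" and "Ec = curve_zr k Xc"
  have Em0: "Em < 0" and E10: "0 < E1"
  proof -
    have "curve_zr k Xa < curve_zr k 0" by (rule curve_zr_strict_increasing) (use crit in auto)
    then show "Em < 0" by (simp add: Em_def curve_zr_def)
    have "curve_zr k 0 < curve_zr k Xb" by (rule curve_zr_strict_increasing) (use crit in auto)
    then show "0 < E1" by (simp add: E1_def curve_zr_def)
  qed
  have Ec0: "Ec \<ge> 0"
  proof -
    have "Xc * (k - Xc\<^sup>2) / (k * (1 - Xc)) \<ge> 0"
    proof (rule divide_nonpos_neg)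
      have "1 < Xc\<^sup>2" using crit by (simp add: one_less_power)
      then have "k - Xc\<^sup>2 \<le> 0" using k by linarith
      then show "Xc * (k - Xc\<^sup>2) \<le> 0" using crit by (intro mult_nonneg_nonpos) auto
      show "k * (1 - Xc) < 0" using crit k by (intro mult_pos_neg) auto
    qed
    then show ?thesis by (simp add: Ec_def curve_zr_def)
  qed
  have P_Ec: "P Ec = of_real Xc"
    by (rule K0_unique[OF P(1) _ P(2)]) (use K0_real crit cubic_double_root(1)[of Xc] in \<open>auto simp: Ec_def\<close>)
  \<comment> \<open>Outside [0, e_2] the branch q_0 would be differentiable at \<open>Ec\<close>,
    with the value \<open>Xc\<close> by continuity. Differentiating the cubic along q_0, the
    coefficient of the derivative vanishes because \<open>Xc\<close> is a double root, and k (1 -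
    Xc) = 0 remains, contrary to Xc > 1.\<close>
  have Ec_le: "Ec \<le> e2"
  proof (rule ccontr)
    assume n: "\<not> Ec \<le> e2"
    have EcS: "of_real Ec \<notin> S" using n by (auto simp: S_def)
    obtain d where d: "(q0 has_field_derivative d) (at (of_real Ec))"
      using holomorphic_on_imp_differentiable_at[OF q0_holo oS] EcS by (auto simp: field_differentiable_def)
    have "filterlim (\<lambda>y. Complex Ec y) (nhds (of_real Ec)) (at_left 0)"
      using filterlim_vertical_at_left[of Ec] unfolding filterlim_at by simp
    from filterlim_compose[OF DERIV_isCont[OF d, unfolded isCont_def tendsto_at_iff_tendsto_nhds] this]
    have "q0 (of_real Ec) = P Ec" using tendsto_unique[OF trivial_limit_at_left_real _ P(3)] by blast
    then have qE: "q0 (of_real Ec) = of_real Xc" using P_Ec by simp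
    have "((\<lambda>z. curve_cubic k z (q0 z)) has_field_derivative
        3 * (of_real Xc)\<^sup>2 * d - (of_real k * of_real Xc + d * (of_real k * (1 + of_real Ec))) + of_real k) (at (of_real Ec))"
      unfolding curve_cubic_def using qE
      by (auto intro!: derivative_eq_intros d simp: power2_eq_square algebra_simps)
    moreover have "eventually (\<lambda>z. curve_cubic k z (q0 z) = 0) (nhds (of_real Ec))"
      using eventually_nhds_in_open[OF oS, of "of_real Ec"] EcS by (auto elim!: eventually_mono simp: q0_root)
    ultimately have "((\<lambda>z. 0) has_field_derivative
        3 * (of_real Xc)\<^sup>2 * d - (of_real k * of_real Xc + d * (of_real k * (1 + of_real Ec))) + of_real k) (at (complex_of_real Ec))"
      using DERIV_cong_ev[OF refl _ refl, of "\<lambda>z. curve_cubic k z (q0 z)" "\<lambda>z. 0" "of_real Ec"] by blast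
    then have "3 * (of_real Xc)\<^sup>2 * d - (of_real k * of_real Xc + d * (of_real k * (1 + of_real Ec))) + of_real k = 0"
      using DERIV_unique DERIV_const by blast
    moreover have "of_real k * (1 + complex_of_real Ec) = 3 * (of_real Xc)\<^sup>2"
    proof -
      have "3 * Xc\<^sup>2 = k * (1 + Ec)" unfolding Ec_def by (rule cubic_double_root(2)) simp
      then have "complex_of_real (3 * Xc\<^sup>2) = of_real (k * (1 + Ec))" by (simp only:)
      then show ?thesis by simp
    qed
    ultimately have "of_real k * (1 - complex_of_real Xc) = 0" by algebra
    then have "complex_of_real Xc = 1" using k by simp
    then show False using crit by (metis of_real_eq_1_iff order_less_irrefl)
  qed

  \<comment> \<open>Intervals on which the densities are 0 or 1\<close>
  have \<rho>0_zero: "\<rho>0 x = 0" if "x < 0 \<or> x > Ec" for x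
  proof -
    have "x \<noteq> 0" using that Ec0 by auto
    then have "pi * \<rho>0 x = 0" using \<rho>0_val[of x] upper_angle_K0(1,2)[OF PQ(1,2,3,4)[of x]] that by (auto simp: Ec_def)
    then show ?thesis by simp
  qed
  have \<rho>0_one: "\<rho>0 x = 1" if "0 < x" "x < E1" for x
    using \<rho>0_val[of x] upper_angle_K0(3)[OF PQ(1,2,3,4)[of x]] that by (auto simp: E1_def)
  have \<rho>2_zero: "\<rho>2 x = 0" if "x > 0" for x
    using \<rho>2_val[of x] upper_angle_K2(1)[OF PQ(1,2,3,4)[of x]] that by auto
  have \<rho>2_one: "\<rho>2 x = 1" if "Em < x" "x < 0" for x
    using \<rho>2_val[of x] upper_angle_K2(2)[OF PQ(1,2,3,4)[of x]] that by (auto simp: Em_def)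

  \<comment> \<open>The potentials in terms of the sheets\<close>
  have li0: "integrable lborel (\<lambda>t. \<rho>0 t * ln (cmod (z - of_real t)))" for z
    by (rule integrable_log_kernel[OF \<rho>0(2,3,4) integrable_density_log_of_compact_support[OF \<rho>0(2,4), of Ec]])
      (use \<rho>0_zero Ec0 in \<open>auto simp: abs_if split: if_splits\<close>)
  have li2: "integrable lborel (\<lambda>t. \<rho>2 t * ln (cmod (z - of_real t)))" for z
    by (rule integrable_log_kernel[OF \<rho>2(2,3,4) second_density_log_integrable[OF PQ \<rho>2_val \<rho>2(1,2,3)]])
  have H_form: "H z = of_real 1 * Ln (curve_w k (q0 z)) + of_real (- ln (1 - k))" if z: "Im z < 0" for z
  proof -
    have q: "q0 z \<noteq> 0" using q0_quad[OF z] by auto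
    have wn: "curve_w k (q0 z) \<noteq> 0" using Im_curve_w_sign(1)[of "q0 z"] q0_quad[OF z] by auto
    have "H z = Ln (curve_phi k (q0 z))" using H_Ln[OF z] q0_phi[of z] HmS z by auto
    also have "curve_phi k (q0 z) = of_real (1 / (1 - k)) * curve_w k (q0 z)"
      unfolding curve_phi_eq_w[OF q] by (simp only: of_real_divide of_real_1 times_divide_eq_left mult_1_left)
    also have "Ln \<dots> = Ln (of_real (1 / (1 - k))) + Ln (curve_w k (q0 z))"
      using Ln_times_of_real[of "1 / (1 - k)" "curve_w k (q0 z)"] k wn by simp
    also have "Ln (complex_of_real (1 / (1 - k))) = of_real (- ln (1 - k))"
      using Ln_of_real[of "1 / (1 - k)"] k by (simp add: ln_div)
    finally show ?thesis by simp
  qed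
  have Pn: "P x \<noteq> 0" and Qn: "Q x \<noteq> 0" for x
    using K_Re_nonzero(1)[OF P(1)[of x]] K_Re_nonzero(2)[OF Q(1)[of x]] by auto
  obtain C0 where C0: "\<And>x. (\<integral>t. \<rho>0 t * ln (cmod (of_real x - of_real t)) \<partial>lborel)
      = 1 * (pot (P x) + x * ln (1 - k)) + (- ln (1 - k)) * x + C0"
    using sheet_potential[OF q0_holo' q0_rootH conjunct1[OF q0_quad] H_form P(2,3) Pn \<rho>0(2,4,6) li0] by blast
  have F2_form: "F2 z = of_real (- 1) * Ln (curve_w k (q2 z)) + of_real 0" for z by (simp add: F2_def)
  obtain C2 where C2: "\<And>x. (\<integral>t. \<rho>2 t * ln (cmod (of_real x - of_real t)) \<partial>lborel)
      = (- 1) * (pot (Q x) + x * ln (1 - k)) + 0 * x + C2"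
    using sheet_potential[OF q2(1,2) conjunct1[OF q2(3)] F2_form Q(2,3) Qn \<rho>2(2,4,6) li2] by blast

  define lam where "lam = density lborel (\<lambda>x. ennreal (\<rho>0 x))"
  define mu where "mu = density lborel (\<lambda>x. ennreal (\<rho>2 x))"
  define R where "R x = - P x - Q x" for x
  have neq: "P x \<noteq> Q x" for x by (rule sheets_signs(3)[OF PQ])
  have sum: "pot (P x) + pot (Q x) + pot (R x) = - 2 * (x + 1) * ln (1 - k)" for x
    unfolding R_def by (rule pot_sum[OF P(2) Q(2) neq])
  \<comment> \<open>Replacing one sheet by means of \<open>pot_sum\<close> cancels all terms linear
    in x, in W_1 together with the external field, and leaves these constants.\<close>
  define \<kappa>1 where "\<kappa>1 = 2 * ln (1 - k) - 2 * C0 + C2"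
  define \<kappa>2 where "\<kappa>2 = - 2 * ln (1 - k) - 2 * C2 + C0"
  have W1: "W1 c lam mu (of_real x) = pot (R x) - pot (P x) + \<kappa>1" for x
    using sum[of x] unfolding W1_def lam_def mu_def log_potential_density[OF \<rho>0(1,2)] log_potential_density[OF \<rho>2(1,2)] C0 C2 ck \<kappa>1_def
    by (simp add: algebra_simps)
  have W2: "W2 lam mu (of_real x) = pot (Q x) - pot (R x) + \<kappa>2" for x
    using sum[of x] unfolding W2_def lam_def mu_def log_potential_density[OF \<rho>0(1,2)] log_potential_density[OF \<rho>2(1,2)] C0 C2 \<kappa>2_def
    by (simp add: algebra_simps)

  \<comment> \<open>Supports of the measures and of the differences from Lebesgue measure\<close>
  have supp_lam: "0 \<le> x \<and> x \<le> Ec" if "x \<in> supp lam" for x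
  proof (rule ccontr)
    assume "\<not> (0 \<le> x \<and> x \<le> Ec)"
    then have "x \<in> {..<0} \<union> {Ec<..}" by auto
    then have "x \<notin> supp lam" unfolding lam_def
      by (rule not_in_supp_density[OF \<rho>0(1,2), rotated]) (use \<rho>0_zero in auto)
    then show False using that by simp
  qed
  have supp_mu: "x \<le> 0" if "x \<in> supp mu" for x
  proof (rule ccontr)
    assume "\<not> x \<le> 0"
    then have "x \<in> {0<..}" by auto
    then have "x \<notin> supp mu" unfolding mu_def
      by (rule not_in_supp_density[OF \<rho>2(1,2), rotated]) (use \<rho>2_zero in auto)
    then show False using that by simp
  qed
  have nz_AE: "AE y in lborel. (y::real) \<noteq> 0" by (rule AE_lborel_singleton)
  have slack_lam: "E1 \<le> x" if "x \<in> {0..} \<inter> supp (slack {0..} lam)" for x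
  proof (rule ccontr)
    assume n: "\<not> E1 \<le> x"
    \<comment> \<open>The interval reaches to the left of 0, where density and indicator both
      vanish, so that 0 becomes an interior point. At 0 itself the density is 1/2 and the indicator
      1, hence the statement almost everywhere.\<close>
    have "AE y in lborel. y \<in> {-1<..<E1} \<longrightarrow> \<rho>0 y = indicator {0..} y"
      using nz_AE by eventually_elim (use \<rho>0_one \<rho>0_zero in \<open>auto simp: indicator_def not_le\<close>)
    then have "x \<notin> supp (slack {0..} lam)" unfolding lam_def
      by (rule not_in_supp_slack_density[OF \<rho>0(1,2), rotated]) (use that n in auto)
    then show False using that by simp
  qed
  have slack_mu: "x \<le> Em" if "x \<in> {..0} \<inter> supp (slack {..0} mu)" for x
  proof (rule ccontr)
    assume n: "\<not> x \<le> Em"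
    have "AE y in lborel. y \<in> {Em<..<1} \<longrightarrow> \<rho>2 y = indicator {..0} y"
      using nz_AE by eventually_elim (use \<rho>2_one \<rho>2_zero in \<open>auto simp: indicator_def not_le\<close>)
    then have "x \<notin> supp (slack {..0} mu)" unfolding mu_def
      by (rule not_in_supp_slack_density[OF \<rho>2(1,2), rotated]) (use that n in auto)
    then show False using that by simp
  qed

  \<comment> \<open>The variational inequalities\<close>
  have real_P: "\<exists>t. P x = of_real t \<and> Xb \<le> t \<and> t \<le> Xc \<and> t \<noteq> 1 \<and> curve_zr k t = x" if "Im (P x) = 0" for x
  proof -
    obtain t where t: "P x = of_real t" using \<open>Im (P x) = 0\<close> by (metis complex_is_Real_iff Reals_cases)
    have "t \<noteq> 1" using cubic_root_ne_1[OF P(2)[of x]] t by auto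
    then show ?thesis using t P(1)[of x] K0_real P(2)[of x] cubic_real_iff by auto
  qed
  have c1: "W1 c lam mu (of_real x) \<le> \<kappa>1" if "x \<in> supp lam" for x
  proof -
    have x: "0 \<le> x" "x \<le> Ec" using supp_lam[OF that] by auto
    have "pot (R x) \<le> pot (P x)"
    proof (cases "Im (P x) \<noteq> 0 \<or> Re (P x) < 1")
      case True
      then show ?thesis unfolding R_def using pot_middle_le_p[OF PQ x(1)] pot_middle_eq_p[OF PQ] by fastforce
    next
      case False
      then obtain t where t: "P x = of_real t" "Xb \<le> t" "t \<le> Xc" "t \<noteq> 1" "curve_zr k t = x" using real_P by blast
      have t1: "1 < t" using False t by auto
      \<comment> \<open>On (1, Xc] the function z decreases to \<open>Ec\<close>, so x <= Ec leaves
        only the double root.\<close>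
      have "t = Xc"
      proof (rule ccontr)
        assume "t \<noteq> Xc"
        then have "Ec < x" unfolding Ec_def t(5)[symmetric]
          by (intro curve_zr_strict_decreasing) (use t t1 crit in auto)
        then show False using x by simp
      qed
      then have "R x = P x" unfolding R_def
        using middle_root_at_critical_p[of Xc "Q x"] Q(1,2)[of x] t by auto
      then show ?thesis by simp
    qed
    then show ?thesis unfolding W1 by simp
  qed
  have c2: "W1 c lam mu (of_real x) \<ge> \<kappa>1" if "x \<in> {0..} \<inter> supp (slack {0..} lam)" for x
  proof -
    have x: "0 \<le> x" "E1 \<le> x" using slack_lam[OF that] that by auto
    have "pot (P x) \<le> pot (R x)"
    proof (cases "Re (P x) \<ge> 1 \<or> Im (P x) \<noteq> 0")
      case True
      then show ?thesis unfolding R_def using pot_middle_ge_p[OF PQ] x by blast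
    next
      case False
      then obtain t where t: "P x = of_real t" "Xb \<le> t" "t \<le> Xc" "t \<noteq> 1" "curve_zr k t = x" using real_P by blast
      have t1: "t < 1" using False t by auto
      \<comment> \<open>On [Xb, 1) the function z decreases from \<open>E1\<close>, so x >= E1
        leaves only the double root.\<close>
      have "t = Xb"
      proof (rule ccontr)
        assume "t \<noteq> Xb"
        then have "x < E1" unfolding E1_def t(5)[symmetric]
          by (intro curve_zr_strict_decreasing) (use t t1 crit in auto)
        then show False using x by simp
      qed
      then have "R x = P x" unfolding R_def
        using middle_root_at_critical_p[of Xb "Q x"] Q(1,2)[of x] t by auto
      then show ?thesis by simp
    qed
    then show ?thesis unfolding W1 by simp
  qed
  have c3: "W2 lam mu (of_real x) \<le> \<kappa>2" if "x \<in> supp mu" for x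
    using pot_q_le_middle[OF PQ supp_mu[OF that]] unfolding W2 R_def by simp
  have c4: "W2 lam mu (of_real x) \<ge> \<kappa>2" if "x \<in> {..0} \<inter> supp (slack {..0} mu)" for x
  proof -
    have x: "x \<le> Em" using slack_mu[OF that] .
    have "pot (R x) = pot (Q x)"
    proof (cases "Im (Q x) = 0")
      case False
      then show ?thesis unfolding R_def by (rule pot_middle_eq_q[OF PQ])
    next
      case True
      then obtain t where t: "Q x = of_real t" by (metis complex_is_Real_iff Reals_cases)
      have tb: "t \<le> Xa" using Q(1)[of x] K2_real t by auto
      have zt: "curve_zr k t = x" using Q(2)[of x] t tb crit cubic_real_iff[of t x] by auto
      \<comment> \<open>Up to \<open>Xa\<close> the function z decreases to \<open>Em\<close>, so x
        <= Em leaves only the double root.\<close>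
      have "t = Xa"
      proof (rule ccontr)
        assume "t \<noteq> Xa"
        then have "Em < x" unfolding Em_def zt[symmetric]
          by (intro curve_zr_strict_decreasing) (use tb crit in auto)
        then show False using x by simp
      qed
      then have "R x = Q x" unfolding R_def
        using middle_root_at_critical_q[of "P x"] P(1,2)[of x] t zt by auto
      then show ?thesis by simp
    qed
    then show ?thesis unfolding W2 by simp
  qed

  \<comment> \<open>The solution and its density\<close>
  have E2: "solves_E2 c lam mu"
    unfolding solves_E2_def
  proof (intro conjI)
    show "sets lam = sets borel" "sets mu = sets borel" by (simp_all add: lam_def mu_def)
    show "emeasure lam UNIV = 2" unfolding lam_def emeasure_density_UNIV[OF \<rho>0(1,2,4)] \<rho>0(5) by simp
    show "emeasure mu UNIV = 1" unfolding mu_def emeasure_density_UNIV[OF \<rho>2(1,2,4)] \<rho>2(5) by simp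
    show "\<forall>A\<in>sets borel. emeasure lam A \<le> emeasure lborel A"
      unfolding lam_def using emeasure_density_le_lborel[OF \<rho>0(1,2,3)] by blast
    show "\<forall>A\<in>sets borel. emeasure mu A \<le> emeasure lborel A"
      unfolding mu_def using emeasure_density_le_lborel[OF \<rho>2(1,2,3)] by blast
    show "supp lam \<subseteq> {0..}" using supp_lam by auto
    show "supp mu \<subseteq> {..0}" using supp_mu by auto
    show "has_log_potential lam" unfolding lam_def by (rule has_log_potential_density[OF \<rho>0(1,2) li0])
    show "has_log_potential mu" unfolding mu_def by (rule has_log_potential_density[OF \<rho>2(1,2) li2])
  qed (use c1 c2 c3 c4 in blast)
  have ac: "absolutely_continuous lborel lam"
    unfolding lam_def by (rule absolutely_continuousI_density) (use \<rho>0(1) in simp)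
  \<comment> \<open>The density vanishes off [0, Ec], and Ec <= e_2, so the cut-off at e_2 changes
    nothing.\<close>
  have "\<rho>0 x * indicator {0..e2} x = \<rho>0 x" for x
  proof (cases "x < 0 \<or> x > Ec")
    case False
    then have "x \<in> {0..e2}" using Ec_le by auto
    then show ?thesis by simp
  qed (simp add: \<rho>0_zero)
  then have lam_eq: "lam = density lborel (\<lambda>x. ennreal (\<rho>0 x * indicator {0..e2} x))"
    unfolding lam_def by (simp only:)
  have lim: "((\<lambda>y::real. 1 / pi * Im (H (Complex x y))) \<longlongrightarrow> \<rho>0 x) (at_left 0)" for x
    using tendsto_mult[OF tendsto_const[of "1 / pi"] \<rho>0_lim[of x]] by simp
  show ?thesis
  proof (intro exI conjI ballI)
    show "solves_E2 c lam mu" by (rule E2)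
    show "absolutely_continuous lborel lam" by (rule ac)
    show "supp lam \<subseteq> {0..e2}" using supp_lam Ec_le by fastforce
    show "lam = density lborel (\<lambda>x. ennreal (\<rho>0 x * indicator {0..e2} x))" by (rule lam_eq)
  qed (rule \<rho>0(1) \<rho>0(2) lim)+
qed

end
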